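(* Let $\lambda>0$ and let $k\ge1$ be an integer. Assume: (i) $f\in C(\mathbb{R})$, $f(0)=0$, $f'(0)$ exists and $f'(0)=1$; (ii) $f$ is strictly concave for $u>0$ and strictly convex for $u<0$; (iii) there are $p\ge2$ and constants $C_1,\dots,C_4>0$ such that $|f(u)|\le C_1+C_2|u|^{p-1}$ for all $u\in\mathbb{R}$, and moreover $f(u)u\le C_3-C_4|u|^p$ for all $u\in\mathbb{R}$ if $p>2$, while $\limsup_{u\to\pm\infty}\frac{f(u)}{u}\le0$ if $p=2$; (iv) $a\in C(\mathbb{R}^+)$ and $a(s)\ge m>0$ for all $s\ge0$; (v) $a(0)\pi^2k^2<\lambda$. Let $l(u)=\|u\|_{H_0^1}^r$ or $l(u)=\|u\|_{L^q}^r$, with $q\ge1$ and $r>0$, and consider the nonlocal problem $$-a(l(u))u_{xx}=\lambda f(u),\quad 0<x<1,\qquad u(0)=u(1)=0.\qquad(N)$$ Then: 1. For any $1\le j\le k$ (and for either choice of sign, $u_j^d=u_{j,d}^+$ or $u_j^d=u_{j,d}^-$) there exists $d_j^*<d_j$ such that $u_j^{d_j^*}$ is a solution of $(N)$. 2. If $\lambda\le a(0)\pi^2(k+1)^2$ and $a(0)=\min_{s\ge0}a(s)$, then for every $j>k$ there are no solutions of $(N)$ of the form $u_{j,d}^{\pm}$. 3. If $N\ge k$ is the first integer such that $\lambda\le\inf_{s\ge0}\{a(s)\pi^2(N+1)^2\}$, then for every $j>N$ there are no solutions of $(N)$ of the form $u_{j,d}^{\pm}$. 4. If $l(u)=\|u\|_{H_0^1}^r$,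 $\lambda\le a(0)\pi^2(k+1)^2$ and $a$ is non-decreasing, then $(N)$ has exactly $2k+1$ solutions: $0,\ u_{1,d_1^*}^{\pm},\dots,u_{k,d_k^*}^{\pm}$. 5. If $l(u)=\|u\|_{L^q}^r$, $\lambda\le a(0)\pi^2(k+1)^2$, $f$ is odd and $a$ is non-decreasing, then $(N)$ has exactly $2k+1$ solutions: $0,\ u_{1,d_1^*}^{\pm},\dots,u_{k,d_k^*}^{\pm}$. (Each value $d_j^*$ is associated with the chosen sign.)
   Context: $\mathbb{R}^+=[0,\infty)$ and $\|u\|_{H_0^1}=\|u'\|_{L^2(0,1)}$. Notation for the local problem: under hypotheses (i)-(iii), for $\widetilde\lambda>0$ with $n^2\pi^2<\widetilde\lambda\le(n+1)^2\pi^2$ ($n\ge0$ an integer), the Chafee–Infante problem $-u''=\widetilde\lambda f(u)$ on $(0,1)$, $u(0)=u(1)=0$, is known to have exactly $2n+1$ solutions $v_0\equiv0,v_1^\pm,\dots,v_n^\pm$, where $v_j^\pm$ has exactly $j+1$ zeros in $[0,1]$, all simple, $v_j^+$ being positive and $v_j^-$ negative between its first two zeros. For $d\ge0$ with $\lambda>a(d)\pi^2j^2$, $u_{j,d}^{\pm}$ denotes the solution $v_j^\pm$ for $\widetilde\lambda=\lambda/a(d)$, i.e. of $-a(d)u''=\lambda f(u)$, $u(0)=u(1)=0$; $u_j^d$ denotes either one of $u_{j,d}^+,u_{j,d}^-$. A function $u_{j,d}^\pm$ solves $(N)$ exactly when $l(u_{j,d}^\pm)=d$ up to replacing $d$ by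 a value giving the same function, and every solution of $(N)$ solves the local problem with $d=l(u)$. $d_j=\sup\{d\ge 0:\lambda>a(\overline d)\pi^2j^2\ \ \forall\,0\le\overline d\le d\}\in(0,+\infty]$. *)

theory Defs
  imports "HOL-Analysis.Analysis"
begin

definition strictly_convex_on :: "real set \<Rightarrow> (real \<Rightarrow> real) \<Rightarrow> bool" where
  "strictly_convex_on S f \<longleftrightarrow> convex S \<and>
     (\<forall>x\<in>S. \<forall>y\<in>S. \<forall>t. x \<noteq> y \<and> 0 < t \<and> t < 1 \<longrightarrow>
        f ((1 - t) * x + t * y) < (1 - t) * f x + t * f y)"

definition strictly_concave_on :: "real set \<Rightarrow> (real \<Rightarrow> real) \<Rightarrow> bool" where
  "strictly_concave_on S f \<longleftrightarrow> strictly_convex_on S (\<lambda>x. - f x)"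

text \<open>Only the values of \<open>u\<close> on the open unit interval enter the two norms below.\<close>

definition H01_norm :: "(real \<Rightarrow> real) \<Rightarrow> real" where
  "H01_norm u = sqrt (LINT x:{0<..<1}|lborel. (deriv u x)\<^sup>2)"

definition Lq_norm :: "real \<Rightarrow> (real \<Rightarrow> real) \<Rightarrow> real" where
  "Lq_norm q u = (LINT x:{0<..<1}|lborel. \<bar>u x\<bar> powr q) powr (1 / q)"

text \<open>
  \<open>dirichlet_solution c g u\<close>: \<open>u\<close> is a twice continuously differentiable function on the
  closed unit interval (one-sided derivatives at the end points) with \<open>- c u'' = g(u)\<close> in the
  interior and \<open>u(0) = u(1) = 0\<close>. As HOL functions are total, \<open>u\<close> is required to vanish outside
  the unit interval, so that solutions can be compared by equality and counted by \<open>card\<close>.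
\<close>

definition dirichlet_solution ::
    "real \<Rightarrow> (real \<Rightarrow> real) \<Rightarrow> (real \<Rightarrow> real) \<Rightarrow> bool" where
  "dirichlet_solution c g u \<longleftrightarrow>
     (\<forall>x. x \<notin> {0..1} \<longrightarrow> u x = 0) \<and> u 0 = 0 \<and> u 1 = 0 \<and>
     (\<exists>u' u''.
        (\<forall>x\<in>{0..1}. (u has_real_derivative u' x) (at x within {0..1})) \<and>
        (\<forall>x\<in>{0..1}. (u' has_real_derivative u'' x) (at x within {0..1})) \<and>
        continuous_on {0..1} u'' \<and>
        (\<forall>x\<in>{0<..<1}. - c * u'' x = g (u x)))"

definition chafee_infante_solution ::
    "(real \<Rightarrow> real) \<Rightarrow> real \<Rightarrow> (real \<Rightarrow> real) \<Rightarrow> bool" where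
  "chafee_infante_solution f \<mu> u \<longleftrightarrow> dirichlet_solution 1 (\<lambda>s. \<mu> * f s) u"

definition nonlocal_solution ::
    "(real \<Rightarrow> real) \<Rightarrow> (real \<Rightarrow> real) \<Rightarrow> ((real \<Rightarrow> real) \<Rightarrow> real) \<Rightarrow> real \<Rightarrow> (real \<Rightarrow> real) \<Rightarrow> bool" where
  "nonlocal_solution f a l lam u \<longleftrightarrow> dirichlet_solution (a (l u)) (\<lambda>s. lam * f s) u"

text \<open>
  \<open>is_v f \<mu> \<sigma> j u\<close>: \<open>u\<close> is the solution \<open>v\<^sub>j\<close> with sign \<open>\<sigma>\<close> (\<open>1\<close> or \<open>- 1\<close>) of the
  Chafee-Infante problem with parameter \<open>\<mu>\<close>. The first zero of \<open>u\<close> is \<open>0\<close>, and the point \<open>z\<close>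
  is necessarily the second one.
\<close>

definition is_v ::
    "(real \<Rightarrow> real) \<Rightarrow> real \<Rightarrow> real \<Rightarrow> nat \<Rightarrow> (real \<Rightarrow> real) \<Rightarrow> bool" where
  "is_v f \<mu> \<sigma> j u \<longleftrightarrow>
     chafee_infante_solution f \<mu> u \<and>
     card {x\<in>{0..1}. u x = 0} = j + 1 \<and>
     (\<forall>x\<in>{0..1}. u x = 0 \<longrightarrow> \<not> (u has_real_derivative 0) (at x within {0..1})) \<and>
     (\<exists>z. 0 < z \<and> z \<le> 1 \<and> u z = 0 \<and> (\<forall>x\<in>{0<..<z}. 0 < \<sigma> * u x))"

text \<open>
  \<open>is_u f a lam \<sigma> j d u\<close>: \<open>u\<close> is the function \<open>u\<^sub>j\<^sub>,\<^sub>d\<close> with sign \<open>\<sigma>\<close>. The restriction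
  \<open>lam > a(d) \<pi>\<^sup>2 j\<^sup>2\<close> is deliberately not built in: it is the condition for such a function to
  exist, and building it in would make the absence of solutions of this form for large \<open>j\<close>
  true by definition.
\<close>

definition is_u ::
    "(real \<Rightarrow> real) \<Rightarrow> (real \<Rightarrow> real) \<Rightarrow> real \<Rightarrow> real \<Rightarrow> nat \<Rightarrow> real \<Rightarrow> (real \<Rightarrow> real) \<Rightarrow> bool" where
  "is_u f a lam \<sigma> j d u \<longleftrightarrow> 0 \<le> d \<and> is_v f (lam / a d) \<sigma> j u"

definition d_sup :: "(real \<Rightarrow> real) \<Rightarrow> real \<Rightarrow> nat \<Rightarrow> ereal" where
  "d_sup a lam j =
     Sup (ereal ` {d. 0 \<le> d \<and> (\<forall>d'\<in>{0..d}. a d' * pi\<^sup>2 * (real j)\<^sup>2 < lam)})"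

end

theory Submission
  imports Defs
begin

text \<open>
  With \<open>F\<close> the primitive of \<open>f\<close>, put \<open>Phi u = sgn u * sqrt (2 F u)\<close>. In the coordinates
  \<open>(Phi u, u' / sqrt \<mu>)\<close> the equation \<open>- u'' = \<mu> f(u)\<close> is a rotation with angular velocity
  \<open>sqrt \<mu> * Phi' u\<close>, so a solution leaving \<open>0\<close> with \<open>u'(0) > 0\<close> is \<open>u = psi (s sin \<theta>)\<close> with
  \<open>psi\<close> the inverse of \<open>Phi\<close> and \<open>dx / d\<theta> = G (s sin \<theta>) / sqrt \<mu>\<close> with \<open>G = psi'\<close>. The boundary
  condition at \<open>1\<close> says that \<open>sqrt \<mu>\<close> is the time map \<open>J j s\<close>, the integral of \<open>G (s sin t)\<close> over
  \<open>0 \<le> t \<le> j pi\<close>. Since \<open>f\<close> is concave on the right and convex on the left of \<open>0\<close>, \<open>G w\<close> increases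
  with \<open>|w|\<close> from \<open>G 0 = 1\<close>, so \<open>J j\<close> increases from \<open>j pi\<close> to infinity and each branch is
  parametrised by its amplitude \<open>s\<close>.

  On a branch both norms are continuous functions of \<open>s\<close>, and the nonlocal problem is one scalar
  equation, solved by the intermediate value theorem. The \<open>H\<^sub>0\<^sup>1\<close> norm is visibly increasing in
  \<open>s\<close>; for the \<open>L\<^sup>q\<close> norm and odd \<open>f\<close> all lobes are congruent, which reduces monotonicity to Sturm
  comparison of positive solutions. If \<open>a\<close> is non-decreasing, monotone norms leave at most one
  solution per branch. Solutions with \<open>u'(0) < 0\<close> are handled by the reflection
  \<open>f(u) \<mapsto> - f(- u)\<close>.
\<close>

section \<open>Antiderivatives and chords of a concave function\<close>

text \<open>Differentiability of \<open>f\<close> is assumed only at \<open>0\<close> and concavity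
  only on the open half-line, so estimates that would use \<open>f'\<close> are made with chords and
  with \<open>f u / u\<close>. The phase coordinates need \<open>u * f u > 0\<close> off
  \<open>0\<close> along the whole orbit, so a solution has to be kept strictly between the zeros of
  \<open>f\<close> nearest to \<open>0\<close>. Concavity makes \<open>f\<close> vanish at most
  linearly at a positive zero, so an orbit at that energy would need infinite time to get there. The
  same slowing down makes the time map diverge logarithmically when such a zero exists; without one,
  divergence comes from sublinear growth. No uniqueness theorem for the initial value problem is
  invoked: rotating the phase point of a given solution back by its own angle leaves two constants,
  which recover the solution from its amplitude. The strict inequality with \<open>d_sup\<close> is
  the reason for taking the least root of the scalar equation. In the \<open>L^q\<close> norm of a
  branch the time map is a denominator that also grows with \<open>s\<close>, so monotonicity cannot
  be read off; hence the detour through positive solutions.\<close>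

definition prim :: "(real \<Rightarrow> real) \<Rightarrow> real \<Rightarrow> real" where
  "prim g = (SOME F. F 0 = 0 \<and> (\<forall>x. (F has_real_derivative g x) (at x)))"

lemma
  assumes "continuous_on UNIV g"
  shows prim_0: "prim g 0 = 0"
    and prim_deriv: "(prim g has_real_derivative g x) (at x)"
proof -
  obtain F where F: "\<And>x. (F has_vector_derivative g x) (at x)"
    using einterval_antiderivative[of "-\<infinity>" "\<infinity>" g] assms
    by (auto simp: continuous_on_eq_continuous_at)
  define H where "H = (\<lambda>x. F x - F 0)"
  have "(H has_real_derivative g x) (at x)" for x
    using F unfolding H_def
    by (auto simp: has_real_derivative_iff_has_vector_derivative intro!: derivative_eq_intros)
  then have "H 0 = 0 \<and> (\<forall>x. (H has_real_derivative g x) (at x))"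
    by (simp add: H_def)
  then have "prim g 0 = 0 \<and> (\<forall>x. (prim g has_real_derivative g x) (at x))"
    unfolding prim_def by (rule someI[where x = H])
  then show "prim g 0 = 0" "(prim g has_real_derivative g x) (at x)"
    by auto
qed

lemma prim_eqI:
  assumes "continuous_on UNIV g" "H 0 = 0" "\<And>x. (H has_real_derivative g x) (at x)"
  shows "prim g = H"
proof
  fix x
  have "((\<lambda>x. prim g x - H x) has_real_derivative 0) (at x)" for x
    using prim_deriv[OF assms(1)] assms(3) by (auto intro!: derivative_eq_intros)
  then have "prim g x - H x = prim g 0 - H 0"
    using DERIV_isconst_all by blast
  then show "prim g x = H x"
    using prim_0[OF assms(1)] assms(2) by simp
qed

lemma integral_eq_diffI:
  fixes H h :: "real \<Rightarrow> real"
  assumes "a \<le> b" "\<And>x. x \<in> {a..b} \<Longrightarrow> (H has_real_derivative h x) (at x within {a..b})"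
  shows "integral {a..b} h = H b - H a"
  using fundamental_theorem_of_calculus[OF assms(1), of H h] assms(2)
  by (auto simp: has_real_derivative_iff_has_vector_derivative intro!: integral_unique)

lemma integral_eq_prim:
  assumes "continuous_on UNIV g" "0 \<le> b"
  shows "integral {0..b} g = prim g b"
  using integral_eq_diffI[OF assms(2), of "prim g" g] prim_0[OF assms(1)]
    has_field_derivative_at_within[OF prim_deriv[OF assms(1)]] by simp

text \<open>Since \<open>1 <= g\<close>, the difference \<open>prim g t - t\<close> is
  nondecreasing; so \<open>prim g\<close> is at least as steep as the identity and hence onto. The
  inverse later converts elapsed time into phase angle.\<close>

lemma
  assumes g: "continuous_on UNIV g" and g1: "\<And>t. 1 \<le> g t"
  shows prim_strict_mono: "strict_mono (prim g)"
    and inv_prim_prim: "inv (prim g) (prim g t) = t"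
    and prim_inv_prim: "prim g (inv (prim g) x) = x"
    and inv_prim_deriv: "(inv (prim g) has_real_derivative 1 / g (inv (prim g) x)) (at x)"
proof -
  have gpos: "0 < g t" for t
    using g1[of t] by simp
  have D: "(prim g has_real_derivative g t) (at t)" for t
    by (rule prim_deriv[OF g])
  show sm: "strict_mono (prim g)"
    unfolding strict_mono_def
  proof (intro allI impI)
    fix s t :: real assume "s < t"
    then show "prim g s < prim g t"
      by (rule DERIV_pos_imp_increasing) (use D gpos in blast)
  qed
  then have inj: "inj (prim g)"
    by (rule strict_mono_imp_inj_on)
  have cont: "isCont (prim g) t" for t
    using D by (rule DERIV_isCont)
  have mono: "prim g s - s \<le> prim g t - t" if "s \<le> t" for s t
  proof (rule DERIV_nonneg_imp_nondecreasing[OF that])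
    fix x
    have "((\<lambda>t. prim g t - t) has_real_derivative g x - 1) (at x)"
      by (intro DERIV_diff D DERIV_ident)
    then show "\<exists>y. ((\<lambda>t. prim g t - t) has_real_derivative y) (at x) \<and> 0 \<le> y"
      using g1[of x] by auto
  qed
  have surj: "\<exists>t. prim g t = y" for y
  proof (cases "0 \<le> y")
    case True
    then have "y \<le> prim g y"
      using mono[of 0 y] prim_0[OF g] by simp
    then show ?thesis
      using IVT[of "prim g" 0 y y] True cont prim_0[OF g] by auto
  next
    case False
    then have "prim g y \<le> y"
      using mono[of y 0] prim_0[OF g] by simp
    then show ?thesis
      using IVT[of "prim g" y y 0] False cont prim_0[OF g] by auto
  qed
  show left: "inv (prim g) (prim g t) = t" for t
    using inj by simp
  show right: "prim g (inv (prim g) x) = x" for x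
    using surj[of x] by (auto intro: f_inv_into_f)
  have "isCont (inv (prim g)) (prim g t)" for t
    by (rule isCont_inverse_function[where d = 1]) (simp_all only: left cont zero_less_one)
  from this[of "inv (prim g) x"] have c: "isCont (inv (prim g)) x"
    by (simp only: right)
  have "(inv (prim g) has_real_derivative inverse (g (inv (prim g) x))) (at x)"
  proof (rule DERIV_inverse_function[where f = "prim g" and a = "x - 1" and b = "x + 1"])
    show "g (inv (prim g) x) \<noteq> 0"
      using gpos[of "inv (prim g) x"] by simp
  qed (simp_all add: D right c)
  then show "(inv (prim g) has_real_derivative 1 / g (inv (prim g) x)) (at x)"
    by (simp add: divide_inverse)
qed

text \<open>The norms are Lebesgue integrals over the open interval, while the calculus below uses
  gauge integrals over the closed one.\<close>

lemma set_lborel_integral_open_interval: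
  fixes h :: "real \<Rightarrow> real"
  assumes "continuous_on {0..1} h"
  shows "(LINT x:{0<..<1}|lborel. h x) = integral {0..1} h"
proof -
  have i: "set_integrable lborel {0..1} h"
    using borel_integrable_atLeastAtMost'[OF assms] .
  then have "set_integrable lborel {0<..<1} h"
    by (rule set_integrable_subset) auto
  then have "(LINT x:{0<..<1}|lborel. h x) = integral {0<..<1} h"
    by (rule set_borel_integral_eq_integral)
  then show ?thesis
    by (simp add: integral_open_interval_real)
qed

text \<open>\<open>f_top\<close> and \<open>f_bot\<close> condense the two growth alternatives for
  the exponent \<open>p\<close> into sublinearity at both ends. Reflection exchanges them, as it
  exchanges concavity and convexity.\<close>

locale ci_nonlin =
  fixes f :: "real \<Rightarrow> real"
  assumes f_cont: "continuous_on UNIV f"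
    and f_0: "f 0 = 0"
    and f_deriv_0: "(f has_real_derivative 1) (at 0)"
    and f_concave: "strictly_concave_on {0<..} f"
    and f_convex: "strictly_convex_on {..<0} f"
    and f_top: "0 < \<epsilon> \<Longrightarrow> \<exists>M. \<forall>u\<ge>M. f u \<le> \<epsilon> * u"
    and f_bot: "0 < \<epsilon> \<Longrightarrow> \<exists>M. \<forall>u\<ge>M. f (- u) \<ge> - \<epsilon> * u"

text \<open>Not only the negative branches but also the estimates at negative arguments are obtained
  through this instance, called \<open>R\<close> in the interpretations below.\<close>

lemma (in ci_nonlin) reflect: "ci_nonlin (\<lambda>x. - f (- x))"
proof
  show "continuous_on UNIV (\<lambda>x. - f (- x))"
    by (intro continuous_intros continuous_on_compose2[OF f_cont]) auto
  show "((\<lambda>x. - f (- x)) has_real_derivative 1) (at 0)"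
    using DERIV_chain2[of f 1 uminus 0 "-1" UNIV] f_deriv_0
    by (auto intro!: DERIV_cong[OF DERIV_minus[of _ "-1"]] DERIV_cong[OF DERIV_minus[OF DERIV_ident]])
  show "- f (- 0) = 0"
    using f_0 by simp
  show "strictly_concave_on {0<..} (\<lambda>x. - f (- x))"
    unfolding strictly_concave_on_def strictly_convex_on_def
  proof (intro conjI ballI allI impI)
    fix x y t :: real assume *: "x \<in> {0<..}" "y \<in> {0<..}" "x \<noteq> y \<and> 0 < t \<and> t < 1"
    then have "f ((1 - t) * - x + t * - y) < (1 - t) * f (-x) + t * f (-y)"
      using f_convex unfolding strictly_convex_on_def
      by (metis greaterThan_iff lessThan_iff neg_less_0_iff_less neg_equal_iff_equal)
    then show "- (- f (- ((1 - t) * x + t * y))) < (1 - t) * - (- f (- x)) + t * - (- f (- y))"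
      by (simp add: algebra_simps)
  qed auto
  show "strictly_convex_on {..<0} (\<lambda>x. - f (- x))"
    unfolding strictly_convex_on_def
  proof (intro conjI ballI allI impI)
    fix x y t :: real assume *: "x \<in> {..<0}" "y \<in> {..<0}" "x \<noteq> y \<and> 0 < t \<and> t < 1"
    then have "- f ((1 - t) * - x + t * - y) < (1 - t) * - f (-x) + t * - f (-y)"
      using f_concave unfolding strictly_concave_on_def strictly_convex_on_def
      by (metis greaterThan_iff lessThan_iff neg_0_less_iff_less neg_equal_iff_equal)
    then show "- f (- ((1 - t) * x + t * y)) < (1 - t) * - f (- x) + t * - f (- y)"
      by (simp add: algebra_simps)
  qed auto
  show "\<exists>M. \<forall>u\<ge>M. - f (- u) \<le> \<epsilon> * u" if "0 < \<epsilon>" for \<epsilon>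
    using f_bot[OF that] by (metis minus_le_iff minus_mult_minus mult_minus_left)
  show "\<exists>M. \<forall>u\<ge>M. - \<epsilon> * u \<le> - f (- (- u))" if "0 < \<epsilon>" for \<epsilon>
    using f_top[OF that] by auto
qed

context ci_nonlin
begin

lemma isCont_f: "isCont f x"
  using f_cont by (simp add: continuous_on_eq_continuous_at)

lemma chord_above:
  assumes "0 < x" "x < y" "y < z"
  shows "(f z - f x) * (y - x) < (f y - f x) * (z - x)"
proof -
  define t where "t = (y - x) / (z - x)"
  have t: "0 < t" "t < 1" and ty: "t * (z - x) = y - x"
    using assms by (auto simp: t_def)
  then have y: "y = (1 - t) * x + t * z"
    by (simp add: algebra_simps)
  have "- f y < (1 - t) * - f x + t * - f z"
    unfolding y using f_concave t assms unfolding strictly_concave_on_def strictly_convex_on_def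
    by auto
  then have "t * (f z - f x) < f y - f x"
    by (simp add: algebra_simps)
  then have "t * (f z - f x) * (z - x) < (f y - f x) * (z - x)"
    using assms by (simp add: mult_strict_right_mono)
  then show ?thesis
    using ty by (metis mult.assoc mult.commute)
qed

lemma slopes_decrease:
  assumes "0 < x" "x < y" "y < z"
  shows "(f z - f y) / (z - y) < (f y - f x) / (y - x)"
  using chord_above[OF assms] assms by (simp add: field_simps)

text \<open>Strict concavity is assumed on the open half-line only, so the chord through \<open>0\<close> is
  obtained as a limit.\<close>

lemma ratio_strict_antimono:
  assumes "0 < u" "u < v"
  shows "f v / v < f u / u"
proof -
  have le: "f v * u \<le> f u * v" if "0 < u" "u < v" for u v
  proof (rule tendsto_upperbound)
    have *: "(f \<longlongrightarrow> 0) (at_right 0)"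
      using isCont_f[of 0] f_0 by (auto simp: isCont_def intro: filterlim_mono at_le)
    have "((\<lambda>x. (f v - f x) * (u - x) - (f u - f x) * (v - x)) \<longlongrightarrow>
        (f v - 0) * (u - 0) - (f u - 0) * (v - 0)) (at_right 0)"
      by (intro tendsto_intros *)
    then show "((\<lambda>x. (f v - f x) * (u - x) - (f u - f x) * (v - x) + f u * v) \<longlongrightarrow> f v * u) (at_right 0)"
      by (auto dest: tendsto_add[OF _ tendsto_const[of "f u * v"]])
    show "\<forall>\<^sub>F x in at_right 0. (f v - f x) * (u - x) - (f u - f x) * (v - x) + f u * v \<le> f u * v"
      unfolding eventually_at_right_field
      using that chord_above[of _ u v] by (intro exI[of _ u]) force
  qed auto
  \<comment> \<open>The limit has only given a weak inequality. Equality at \<open>u\<close> and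
    \<open>v\<close> would squeeze \<open>f\<close> at the midpoint \<open>w\<close> onto the same
    line through the origin, against strict concavity on \<open>u < w < v\<close>.\<close>
  define w where "w = (u + v) / 2"
  have w: "u < w" "w < v" "0 < w"
    using assms by (auto simp: w_def)
  have "f v * u \<noteq> f u * v"
  proof
    assume eq: "f v * u = f u * v"
    have "f w \<le> f u / u * w"
      using le[of u w] w assms by (simp add: field_simps)
    moreover have fv: "f v = f u / u * v"
      using eq assms by (simp add: field_simps)
    moreover have "f u / u * w * v \<le> f w * v"
      using le[of w v] w fv by (simp add: mult_ac)
    then have "f u / u * w \<le> f w"
      using w assms by (meson less_trans mult_right_le_imp_le)
    ultimately have fw: "f w = f u / u * w"
      by simp
    show False
    proof -
      define c where "c = f u / u"
      have "f u = c * u" "f v = c * v" "f w = c * w"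
        using fv fw assms by (auto simp: c_def)
      then show False
        using chord_above[OF assms(1) w(1,2)] by (simp add: algebra_simps)
    qed
  qed
  with le[OF assms] have "f v * u < f u * v"
    by simp
  then show ?thesis
    using assms by (simp add: field_simps)
qed

lemma f_div_tendsto: "((\<lambda>u. f u / u) \<longlongrightarrow> 1) (at 0)"
  using f_deriv_0 f_0 by (simp add: has_field_derivative_iff)

text \<open>\<open>f u / u\<close> decreases strictly from its limit 1 at \<open>0\<close>. The
  limit yields only a weak bound at \<open>u / 2\<close>; the strict one follows from there to
  \<open>u\<close>.\<close>

lemma f_less_self:
  assumes "0 < u" shows "f u < u"
proof -
  have lim: "((\<lambda>u. f u / u) \<longlongrightarrow> 1) (at_right 0)"
    using f_div_tendsto by (rule filterlim_mono) (auto intro: at_le)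
  have "\<forall>\<^sub>F x in at_right 0. f (u/2) / (u/2) \<le> f x / x"
    unfolding eventually_at_right_field
    using ratio_strict_antimono[of _ "u/2"] assms
    by (intro exI[of _ "u/2"]) (auto intro: less_imp_le)
  then have "f (u/2) / (u/2) \<le> 1"
    using lim by (intro tendsto_lowerbound) auto
  then have "f u / u < 1"
    using ratio_strict_antimono[of "u/2" u] assms by linarith
  then show ?thesis
    using assms by simp
qed

end

section \<open>Phase-plane coordinates\<close>

context ci_nonlin
begin

definition pot :: "real \<Rightarrow> real" where "pot = prim f"

text \<open>The open interval around \<open>0\<close> that ends at the nearest zeros of
  \<open>f\<close>, where these exist. \<open>Phi\<close> is an increasing change of variable on it;
  at such a zero the angular velocity would vanish.\<close>

definition uset :: "real set" where "uset = {u. u = 0 \<or> 0 < u * f u}"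

definition Phi :: "real \<Rightarrow> real" where "Phi u = sgn u * sqrt (2 * pot u)"

text \<open>The derivative of \<open>Phi\<close>; the value at \<open>0\<close> is the limit, as
  both \<open>f u / u\<close> and \<open>Phi u / u\<close> tend to 1.\<close>

definition dPhi :: "real \<Rightarrow> real" where "dPhi u = (if u = 0 then 1 else f u / Phi u)"

definition wset :: "real set" where "wset = Phi ` uset"

definition psi :: "real \<Rightarrow> real" where "psi = inv_into uset Phi"

definition G :: "real \<Rightarrow> real" where "G w = 1 / dPhi (psi w)"

lemma pot_0: "pot 0 = 0"
  unfolding pot_def by (rule prim_0[OF f_cont])

lemma pot_deriv: "(pot has_real_derivative f u) (at u)"
  unfolding pot_def by (rule prim_deriv[OF f_cont])

lemma isCont_pot: "isCont pot u"
  using pot_deriv by (rule DERIV_isCont)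

text \<open>A decreasing quotient \<open>f u / u\<close> that is positive at \<open>u\<close> is
  positive to the left of it: this is why \<open>uset\<close> has no gaps.\<close>

lemma f_pos_below:
  assumes "0 < v" "v \<le> u" "0 < f u"
  shows "0 < f v"
proof (cases "v = u")
  case False
  then have "0 < f u / u" "f u / u < f v / v"
    using assms ratio_strict_antimono[of v u] by auto
  then have "0 < f v / v"
    by linarith
  then show ?thesis
    using assms by (simp add: zero_less_divide_iff)
qed (use assms in simp)

lemma uset_pos_iff: "0 < u \<Longrightarrow> u \<in> uset \<longleftrightarrow> 0 < f u"
  by (simp add: uset_def zero_less_mult_iff)

lemma uset_0: "0 \<in> uset"
  by (simp add: uset_def)

lemma uset_below: "u \<in> uset \<Longrightarrow> 0 \<le> v \<Longrightarrow> v \<le> u \<Longrightarrow> v \<in> uset"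
  using f_pos_below[of v u] uset_0 uset_pos_iff[of u] uset_pos_iff[of v]
  by (cases "v = 0") auto

lemma pot_pos:
  assumes "u \<in> uset" "0 < u"
  shows "0 < pot u"
proof -
  have "pot 0 < pot u"
  proof (rule DERIV_pos_imp_increasing_open[OF assms(2)])
    fix x assume "0 < x" "x < u"
    then have "0 < f x"
      using assms uset_pos_iff f_pos_below[of x u] by auto
    then show "\<exists>y. (pot has_real_derivative y) (at x) \<and> 0 < y"
      using pot_deriv by blast
  qed (use isCont_pot in \<open>simp add: continuous_at_imp_continuous_on\<close>)
  then show ?thesis
    by (simp add: pot_0)
qed

lemma Phi_pos: "u \<in> uset \<Longrightarrow> 0 < u \<Longrightarrow> 0 < Phi u"
  using pot_pos by (simp add: Phi_def)

lemma Phi_0: "Phi 0 = 0"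
  by (simp add: Phi_def)

lemma f_div_2_tendsto: "((\<lambda>u. f u / (2 * u)) \<longlongrightarrow> 1 / 2) (at 0)"
proof -
  have "((\<lambda>u. f u / u / 2) \<longlongrightarrow> 1 / 2) (at 0)"
    by (intro tendsto_intros f_div_tendsto) auto
  then show ?thesis
    by (simp add: mult.commute)
qed

lemma pot_div_tendsto: "((\<lambda>u. pot u / u\<^sup>2) \<longlongrightarrow> 1 / 2) (at 0)"
proof (rule lhopital[where f' = f and g' = "\<lambda>u. 2 * u"])
  show "(pot \<longlongrightarrow> 0) (at 0)"
    using isCont_pot[of 0] by (simp add: isCont_def pot_0)
  show "((\<lambda>u. u\<^sup>2) \<longlongrightarrow> 0) (at (0::real))"
    by (rule tendsto_eq_intros refl | simp)+
  show "\<forall>\<^sub>F u in at 0. u\<^sup>2 \<noteq> (0::real)" "\<forall>\<^sub>F u in at 0. 2 * u \<noteq> (0::real)"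
    by (auto simp: eventually_at intro: exI[of _ 1])
qed (auto intro!: always_eventually pot_deriv f_div_2_tendsto derivative_eq_intros)

lemma Phi_div_tendsto: "((\<lambda>u. Phi u / u) \<longlongrightarrow> 1) (at 0)"
proof -
  have "((\<lambda>u. sqrt (2 * (pot u / u\<^sup>2))) \<longlongrightarrow> sqrt (2 * (1 / 2))) (at 0)"
    by (intro tendsto_intros pot_div_tendsto)
  moreover have "sqrt (2 * (pot u / u\<^sup>2)) = Phi u / u" for u
    by (auto simp: Phi_def real_sqrt_mult real_sqrt_divide sgn_if)
  ultimately show ?thesis
    by simp
qed

lemma Phi_deriv_pos:
  assumes "u \<in> uset" "0 < u"
  shows "(Phi has_real_derivative dPhi u) (at u)"
proof (rule has_field_derivative_transform_within_open[where S = "{0<..}"])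
  have "((\<lambda>u. sqrt (2 * pot u)) has_real_derivative inverse (sqrt (2 * pot u)) / 2 * (2 * f u)) (at u)"
    using DERIV_chain2[OF DERIV_real_sqrt[of "2 * pot u"] DERIV_cmult[OF pot_deriv, of 2]]
      pot_pos[OF assms] by simp
  moreover have "inverse (sqrt (2 * pot u)) / 2 * (2 * f u) = dPhi u"
    using assms by (simp add: dPhi_def Phi_def field_simps)
  ultimately show "((\<lambda>u. sqrt (2 * pot u)) has_real_derivative dPhi u) (at u)"
    by simp
qed (use assms in \<open>auto simp: Phi_def\<close>)

interpretation R: ci_nonlin "\<lambda>x. - f (- x)"
  by (rule reflect)

lemma reflect_pot: "R.pot u = pot (- u)"
proof -
  have "((\<lambda>u. pot (- u)) has_real_derivative - f (- x)) (at x)" for x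
    using DERIV_chain2[OF pot_deriv[of "- x"] DERIV_minus[OF DERIV_ident]] by simp
  then show ?thesis
    using prim_eqI[OF R.f_cont, of "\<lambda>u. pot (- u)"] by (simp add: R.pot_def pot_0)
qed

lemma reflect_uset: "u \<in> R.uset \<longleftrightarrow> - u \<in> uset"
  by (simp add: R.uset_def uset_def)

lemma reflect_Phi: "R.Phi u = - Phi (- u)"
  by (simp add: R.Phi_def Phi_def reflect_pot sgn_minus)

lemma reflect_dPhi: "R.dPhi u = dPhi (- u)"
  by (simp add: R.dPhi_def dPhi_def reflect_Phi)

lemma reflect_wset: "w \<in> R.wset \<longleftrightarrow> - w \<in> wset"
proof
  assume "w \<in> R.wset"
  then show "- w \<in> wset"
    by (auto simp: R.wset_def wset_def reflect_uset reflect_Phi)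
next
  assume "- w \<in> wset"
  then obtain u where "- w = Phi u" "u \<in> uset"
    by (auto simp: wset_def)
  then have "w = R.Phi (- u)" "- u \<in> R.uset"
    by (auto simp: reflect_uset reflect_Phi)
  then show "w \<in> R.wset"
    by (simp add: R.wset_def)
qed

lemma uset_between:
  assumes "u \<in> uset" "v \<in> uset" "u \<le> x" "x \<le> v"
  shows "x \<in> uset"
proof (cases "0 \<le> x")
  case True
  then show ?thesis
    using uset_below[of v x] assms by auto
next
  case False
  then show ?thesis
    using R.uset_below[of "- u" "- x"] assms by (auto simp: reflect_uset)
qed

text \<open>At the adjoined point \<open>0\<close> openness comes from \<open>f u / u\<close>
  tending to 1; elsewhere the strict inequality is an open condition.\<close>

lemma open_uset: "open uset"
proof -
  have "((\<lambda>u. f u / u) \<longlongrightarrow> 1) (at 0)"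
    by (rule f_div_tendsto)
  then have "\<forall>\<^sub>F u in at 0. 0 < f u / u"
    by (rule order_tendstoD) simp
  then obtain d where d: "0 < d" "\<And>u. u \<noteq> 0 \<Longrightarrow> \<bar>u\<bar> < d \<Longrightarrow> 0 < f u / u"
    by (auto simp: eventually_at dist_real_def)
  then have "0 < u * f u" if "u \<noteq> 0" "\<bar>u\<bar> < d" for u
    using d(2)[OF that] by (auto simp: zero_less_divide_iff zero_less_mult_iff)
  then have "u \<in> uset \<longleftrightarrow> 0 < u * f u \<or> u \<in> {- d<..<d}" for u
    using d(1) by (cases "u = 0") (auto simp: uset_def abs_less_iff)
  then have "uset = {u. 0 < u * f u} \<union> {- d<..<d}"
    by blast
  moreover have "open {u. 0 < u * f u}"
    by (intro open_Collect_less continuous_intros f_cont)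
  ultimately show ?thesis
    by (metis open_Un open_greaterThanLessThan)
qed

lemma Phi_square:
  assumes "u \<in> uset" shows "(Phi u)\<^sup>2 = 2 * pot u"
proof -
  have "0 \<le> pot u"
    using assms pot_pos[of u] R.pot_pos[of "- u"] reflect_uset[of "- u"] reflect_pot[of "- u"] pot_0
    by (cases u "0 :: real" rule: linorder_cases) auto
  then show ?thesis
    by (auto simp: Phi_def power_mult_distrib sgn_if pot_0)
qed

lemma Phi_nonzero: "u \<in> uset \<Longrightarrow> u \<noteq> 0 \<Longrightarrow> Phi u \<noteq> 0"
  using Phi_pos[of u] R.Phi_pos[of "- u"] reflect_uset[of "- u"] reflect_Phi[of "- u"]
  by (cases u "0 :: real" rule: linorder_cases) auto

lemma Phi_dPhi: "u \<in> uset \<Longrightarrow> Phi u * dPhi u = f u"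
  using Phi_nonzero by (simp add: dPhi_def Phi_0 f_0)

lemma dPhi_pos:
  assumes "u \<in> uset" shows "0 < dPhi u"
proof -
  have "0 < dPhi u" if "0 < u" "u \<in> uset"
    using that Phi_pos uset_pos_iff by (simp add: dPhi_def)
  moreover have "0 < R.dPhi (- u)" if "u < 0" "u \<in> uset"
    using that R.Phi_pos[of "- u"] R.uset_pos_iff[of "- u"] reflect_uset[of "- u"]
    by (auto simp: R.dPhi_def intro: divide_neg_pos)
  ultimately show ?thesis
    using assms reflect_dPhi[of "- u"]
    by (cases u "0 :: real" rule: linorder_cases) (auto simp: dPhi_def)
qed

lemma Phi_deriv:
  assumes "u \<in> uset"
  shows "(Phi has_real_derivative dPhi u) (at u)"
proof (cases u "0 :: real" rule: linorder_cases)
  case less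
  have "((\<lambda>x. - R.Phi (- x)) has_real_derivative - (R.dPhi (- u) * - 1)) (at u)"
    using DERIV_minus[OF DERIV_chain2[OF R.Phi_deriv_pos[of "- u"] DERIV_minus[OF DERIV_ident]]]
      less assms by (simp add: reflect_uset)
  then show ?thesis
    by (simp add: reflect_Phi reflect_dPhi)
next
  case equal
  then show ?thesis
    using Phi_div_tendsto by (simp add: has_field_derivative_iff Phi_0 dPhi_def)
qed (use assms Phi_deriv_pos in auto)

lemma isCont_Phi: "u \<in> uset \<Longrightarrow> isCont Phi u"
  using Phi_deriv by (rule DERIV_isCont)

lemma isCont_dPhi:
  assumes "u \<in> uset" shows "isCont dPhi u"
proof (cases "u = 0")
  case True
  have "((\<lambda>x. (f x / x) / (Phi x / x)) \<longlongrightarrow> 1 / 1) (at 0)"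
    by (intro tendsto_intros f_div_tendsto Phi_div_tendsto) auto
  then have "(dPhi \<longlongrightarrow> 1 / 1) (at 0)"
    by (rule Lim_transform_eventually) (auto simp: dPhi_def eventually_at intro: exI[of _ 1])
  then show ?thesis
    using True by (simp add: isCont_def dPhi_def)
next
  case False
  have "isCont (\<lambda>x. f x / Phi x) u"
    by (intro continuous_intros isCont_f isCont_Phi assms Phi_nonzero False)
  moreover have "\<forall>\<^sub>F x in nhds u. f x / Phi x = dPhi x"
    using t1_space_nhds[OF False] by eventually_elim (simp add: dPhi_def)
  ultimately show ?thesis
    by (simp only: isCont_cong)
qed

lemma Phi_less:
  assumes "u \<in> uset" "v \<in> uset" "u < v"
  shows "Phi u < Phi v"
  by (rule DERIV_pos_imp_increasing[OF assms(3)])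
    (use assms uset_between Phi_deriv dPhi_pos in blast)

lemma inj_Phi: "inj_on Phi uset"
  by (rule linorder_inj_onI) (use Phi_less in force)+

lemma psi_Phi: "u \<in> uset \<Longrightarrow> psi (Phi u) = u"
  unfolding psi_def by (rule inv_into_f_f[OF inj_Phi])

lemma Phi_psi: "w \<in> wset \<Longrightarrow> Phi (psi w) = w"
  unfolding psi_def wset_def by (rule f_inv_into_f)

lemma psi_in: "w \<in> wset \<Longrightarrow> psi w \<in> uset"
  unfolding psi_def wset_def by (rule inv_into_into)

lemma wset_0: "0 \<in> wset"
  using uset_0 Phi_0 unfolding wset_def by force

lemma psi_0: "psi 0 = 0"
  using psi_Phi[OF uset_0] Phi_0 by simp

lemma G_0: "G 0 = 1"
  by (simp add: G_def psi_0 dPhi_def)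

lemma Phi_sign: "u \<in> uset \<Longrightarrow> sgn (Phi u) = sgn u"
  using Phi_less[of 0 u] Phi_less[of u 0] Phi_0 uset_0
  by (cases u "0 :: real" rule: linorder_cases) auto

lemma psi_sign: "w \<in> wset \<Longrightarrow> sgn (psi w) = sgn w"
  using Phi_sign[of "psi w"] Phi_psi[of w] psi_in[of w] by simp

lemma psi_less:
  assumes "v \<in> wset" "w \<in> wset" "v < w"
  shows "psi v < psi w"
proof (rule ccontr)
  assume "\<not> psi v < psi w"
  then have "Phi (psi w) \<le> Phi (psi v)"
    using Phi_less[of "psi w" "psi v"] psi_in assms by (cases "psi v = psi w") auto
  then show False
    using Phi_psi assms by simp
qed

lemma wset_between:
  assumes "v \<in> wset" "w \<in> wset" "v \<le> x" "x \<le> w"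
  shows "x \<in> wset"
proof -
  have sub: "{psi v..psi w} \<subseteq> uset"
    using assms psi_in by (auto intro: uset_between[of "psi v" "psi w"])
  have "psi v \<le> psi w"
    using psi_less[of v w] assms by (cases "v = w") auto
  then obtain u where "psi v \<le> u" "u \<le> psi w" "Phi u = x"
    using IVT'[of Phi "psi v" x "psi w"] assms Phi_psi isCont_Phi sub
    by (metis continuous_at_imp_continuous_on subsetD)
  then show ?thesis
    using sub by (auto simp: wset_def)
qed

lemma wset_scale:
  assumes "w \<in> wset" "0 \<le> t" "t \<le> 1"
  shows "t * w \<in> wset"
  using assms wset_0 wset_between[of 0 w "t * w"] wset_between[of w 0 "t * w"]
    mult_left_le_one_le[of w t] mult_left_le_one_le[of "- w" t]
  by (cases "0 \<le> w") (auto simp: mult_le_0_iff)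

text \<open>Openness of \<open>uset\<close> leaves room on both sides of \<open>psi w\<close>; the
  images of two nearby points bound a neighbourhood of \<open>w\<close>, which the inverse function
  rule requires.\<close>

lemma psi_local:
  assumes "w \<in> wset"
  obtains a b where "a < w" "w < b" "{a<..<b} \<subseteq> wset" "isCont psi w"
proof -
  define u where "u = psi w"
  have u: "u \<in> uset" "Phi u = w"
    using assms psi_in Phi_psi by (auto simp: u_def)
  obtain d where d: "0 < d" "cball u d \<subseteq> uset"
    using open_uset u open_contains_cball by blast
  then have in_uset: "z \<in> uset" if "\<bar>z - u\<bar> \<le> d" for z
    using that by (auto simp: cball_def dist_real_def abs_minus_commute)
  have "isCont psi (Phi u)"
    by (rule isCont_inverse_function[where d = d])
      (use d in_uset psi_Phi isCont_Phi in auto)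
  moreover have "Phi (u - d) < w" "w < Phi (u + d)"
    using Phi_less[of "u - d" u] Phi_less[of u "u + d"] d in_uset u by auto
  moreover have "{Phi (u - d)<..<Phi (u + d)} \<subseteq> wset"
    using wset_between[of "Phi (u - d)" "Phi (u + d)"] in_uset d(1) by (auto simp: wset_def)
  ultimately show ?thesis
    using that u by blast
qed

lemma isCont_psi: "w \<in> wset \<Longrightarrow> isCont psi w"
  by (rule psi_local)

lemma psi_deriv:
  assumes "w \<in> wset"
  shows "(psi has_real_derivative G w) (at w)"
proof -
  obtain a b where ab: "a < w" "w < b" "{a<..<b} \<subseteq> wset"
    using psi_local[OF assms] .
  have "(psi has_real_derivative inverse (dPhi (psi w))) (at w)"
  proof (rule DERIV_inverse_function[where f = Phi and a = a and b = b])
    show "(Phi has_real_derivative dPhi (psi w)) (at (psi w))"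
      using assms by (intro Phi_deriv psi_in)
    show "dPhi (psi w) \<noteq> 0"
      using dPhi_pos[of "psi w"] psi_in[OF assms] by simp
  qed (use ab Phi_psi isCont_psi assms in auto)
  then show ?thesis
    by (simp add: G_def divide_inverse)
qed

lemma isCont_G:
  assumes "w \<in> wset" shows "isCont G w"
proof -
  have "isCont (\<lambda>w. dPhi (psi w)) w"
    using isCont_o2[OF isCont_psi isCont_dPhi] assms psi_in by blast
  moreover have "dPhi (psi w) \<noteq> 0"
    using dPhi_pos[of "psi w"] psi_in[OF assms] by simp
  ultimately show ?thesis
    unfolding G_def by (intro continuous_intros)
qed

lemma G_pos: "w \<in> wset \<Longrightarrow> 0 < G w"
  using dPhi_pos psi_in by (simp add: G_def)

end

context ci_nonlin
begin

interpretation R: ci_nonlin "\<lambda>x. - f (- x)"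
  by (rule reflect)

lemma reflect_psi:
  assumes "w \<in> R.wset" shows "R.psi w = - psi (- w)"
proof -
  have "- w \<in> wset"
    using assms reflect_wset by simp
  then have "w = R.Phi (- psi (- w))" "- psi (- w) \<in> R.uset"
    using Phi_psi[of "- w"] psi_in[of "- w"] by (auto simp: reflect_Phi reflect_uset)
  then show ?thesis
    using R.psi_Phi by metis
qed

lemma reflect_G:
  assumes "w \<in> R.wset" shows "R.G w = G (- w)"
  using reflect_psi[OF assms] by (simp add: R.G_def G_def reflect_dPhi)

end

section \<open>Monotonicity and blow-up of the time map\<close>

text \<open>Turns pointwise chord bounds on \<open>f\<close> into bounds on increments of
  \<open>pot\<close>.\<close>

lemma le_of_deriv_le:
  fixes g h :: "real \<Rightarrow> real"
  assumes "a \<le> b"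
    and "\<And>x. a \<le> x \<Longrightarrow> x \<le> b \<Longrightarrow> (g has_real_derivative g' x) (at x)"
    and "\<And>x. a \<le> x \<Longrightarrow> x \<le> b \<Longrightarrow> (h has_real_derivative h' x) (at x)"
    and "\<And>x. a \<le> x \<Longrightarrow> x \<le> b \<Longrightarrow> g' x \<le> h' x"
  shows "g b - g a \<le> h b - h a"
proof -
  have "h a - g a \<le> h b - g b"
  proof (rule DERIV_nonneg_imp_nondecreasing[OF assms(1)])
    fix x assume "a \<le> x" "x \<le> b"
    then show "\<exists>y. ((\<lambda>x. h x - g x) has_real_derivative y) (at x) \<and> 0 \<le> y"
      using assms(2-4) by (intro exI[of _ "h' x - g' x"]) (auto intro: DERIV_diff)
  qed
  then show ?thesis
    by simp
qed

context ci_nonlin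
begin

text \<open>The end point \<open>v\<close> may be a zero of \<open>f\<close>: strict decrease of
  \<open>f u / u\<close> still makes \<open>f\<close> positive inside.\<close>

lemma pot_less:
  assumes "0 < u" "u < v" "0 \<le> f v"
  shows "pot u < pot v"
proof (rule DERIV_pos_imp_increasing_open[OF assms(2)])
  fix x assume x: "u < x" "x < v"
  then have "0 \<le> f v / v" "f v / v < f x / x"
    using assms ratio_strict_antimono[of x v] by auto
  then have "0 < f x / x"
    by linarith
  then have "0 < f x"
    using x assms by (simp add: zero_less_divide_iff)
  then show "\<exists>y. (pot has_real_derivative y) (at x) \<and> 0 < y"
    using pot_deriv by blast
qed (use isCont_pot in \<open>simp add: continuous_at_imp_continuous_on\<close>)

text \<open>The graph lies above its chord from \<open>0\<close> to \<open>u\<close>;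
  \<open>pot u\<close> is the area under the graph and \<open>u * f u / 2\<close> that of the
  triangle under the chord.\<close>

lemma pot_ge_triangle:
  assumes "0 < u"
  shows "u * f u \<le> 2 * pot u"
proof -
  have "f u / u * u\<^sup>2 / 2 - f u / u * 0\<^sup>2 / 2 \<le> pot u - pot 0"
  proof (rule le_of_deriv_le)
    fix x assume x: "0 \<le> x" "x \<le> u"
    show "((\<lambda>x. f u / u * x\<^sup>2 / 2) has_real_derivative f u / u * x) (at x)"
      using assms by (auto intro!: derivative_eq_intros)
    show "f u / u * x \<le> f x"
    proof (cases "x = 0 \<or> x = u")
      case False
      then have "0 < x" "x < u"
        using x by auto
      then show ?thesis
        using ratio_strict_antimono[of x u] pos_less_divide_eq[of x "f u / u" "f x"] by simp
    qed (use assms f_0 in auto)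
  qed (use assms pot_deriv in auto)
  then show ?thesis
    using assms by (simp add: pot_0 power2_eq_square mult_ac)
qed

text \<open>The function \<open>pot / f\<^sup>2\<close> is strictly increasing. If \<open>f\<close> were differentiable this would be
  \<open>2 * pot * f' < f\<^sup>2\<close>; here the slope \<open>p\<close> of the chord takes the place of \<open>f'\<close>.\<close>

lemma pot_over_f_square_strict_mono:
  assumes "0 < u" "u < v" "0 < f u" "0 < f v"
  shows "pot u * (f v)\<^sup>2 < pot v * (f u)\<^sup>2"
proof -
  have pot: "pot u < pot v" "0 < pot u"
    using assms pot_less pot_pos uset_pos_iff by auto
  show ?thesis
  proof (cases "f v \<le> f u")
    case True
    then have "pot u * (f v)\<^sup>2 \<le> pot u * (f u)\<^sup>2"
      using assms pot by (intro mult_left_mono power_mono) auto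
    also have "\<dots> < pot v * (f u)\<^sup>2"
      using assms pot by (intro mult_strict_right_mono) auto
    finally show ?thesis .
  next
    case False
    \<comment> \<open>The line of slope \<open>p\<close> through \<open>(u, f u)\<close> lies above
      the graph to the left of \<open>u\<close> and below it between \<open>u\<close> and
      \<open>v\<close>; \<open>below\<close> and \<open>above\<close> integrate these two
      bounds.\<close>
    define p where "p = (f v - f u) / (v - u)"
    have p: "0 < p" "p * (v - u) = f v - f u"
      using False assms by (auto simp: p_def)
    have pu: "p * u < f u"
    proof -
      have "f v * u < f u * v"
        using ratio_strict_antimono[OF assms(1,2)] assms by (simp add: field_simps)
      then have "(f v - f u) * u < f u * (v - u)"
        by (simp add: algebra_simps)
      then show ?thesis
        using assms by (simp add: p_def field_simps)
    qed
    have below: "pot u - pot 0 \<le> (f u * u - p * (u * u - u\<^sup>2 / 2)) - (f u * 0 - p * (u * 0 - 0\<^sup>2 / 2))"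
    proof (rule le_of_deriv_le)
      fix x assume x: "0 \<le> x" "x \<le> u"
      show "((\<lambda>x. f u * x - p * (u * x - x\<^sup>2 / 2)) has_real_derivative f u - p * (u - x)) (at x)"
        by (auto intro!: derivative_eq_intros)
      consider "x = 0" | "x = u" | "0 < x" "x < u"
        using x by linarith
      then show "f x \<le> f u - p * (u - x)"
      proof cases
        case 3
        then have "p < (f u - f x) / (u - x)"
          using slopes_decrease[of x u v] assms by (simp add: p_def)
        then show ?thesis
          using 3 by (simp add: pos_less_divide_eq)
      qed (use pu f_0 in auto)
    qed (use assms pot_deriv in auto)
    have above: "(f u * v + p * (v - u)\<^sup>2 / 2) - (f u * u + p * (u - u)\<^sup>2 / 2) \<le> pot v - pot u"
    proof (rule le_of_deriv_le)
      fix x assume x: "u \<le> x" "x \<le> v"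
      show "((\<lambda>x. f u * x + p * (x - u)\<^sup>2 / 2) has_real_derivative f u + p * (x - u)) (at x)"
        by (auto intro!: derivative_eq_intros)
      consider "x = u" | "x = v" | "u < x" "x < v"
        using x by linarith
      then show "f u + p * (x - u) \<le> f x"
      proof cases
        case 3
        then have "(f v - f u) * (x - u) / (v - u) < f x - f u"
          using chord_above[of u x v] assms by (simp add: pos_divide_less_eq)
        then show ?thesis
          by (simp add: p_def)
      qed (use p in auto)
    qed (use assms pot_deriv in auto)
    \<comment> \<open>Completing the square isolates \<open>f u - p * u\<close>, the height of the
      line over \<open>0\<close>, which is positive by \<open>pu\<close>. This is the source of
      strictness.\<close>
    have "(2 * p) * pot u \<le> (2 * p) * (f u * u - p * u\<^sup>2 / 2)"
      using below p by (intro mult_left_mono) (auto simp: pot_0 power2_eq_square)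
    also have "\<dots> = (f u)\<^sup>2 - (f u - p * u)\<^sup>2"
      by (simp add: power2_eq_square algebra_simps)
    also have "\<dots> < (f u)\<^sup>2"
      using pu by simp
    finally have 1: "2 * p * pot u < (f u)\<^sup>2" .
    have "(f v)\<^sup>2 - (f u)\<^sup>2 = (2 * f u + p * (v - u)) * (p * (v - u))"
      unfolding p by (simp add: power2_eq_square algebra_simps)
    also have "\<dots> = (2 * p) * (f u * (v - u) + p * (v - u)\<^sup>2 / 2)"
    proof -
      have "(2 * f u + p * x) * (p * x) = (2 * p) * (f u * x + p * x\<^sup>2 / 2)" for x
        by (simp add: power2_eq_square algebra_simps)
      then show ?thesis .
    qed
    also have "\<dots> \<le> (2 * p) * (pot v - pot u)"
      using above p by (intro mult_left_mono) (auto simp: algebra_simps)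
    finally have 2: "(f v)\<^sup>2 - (f u)\<^sup>2 \<le> 2 * p * (pot v - pot u)" .
    have "pot u * ((f v)\<^sup>2 - (f u)\<^sup>2) \<le> pot u * (2 * p * (pot v - pot u))"
      using 2 pot by (intro mult_left_mono) auto
    also have "\<dots> = (2 * p * pot u) * (pot v - pot u)"
      by simp
    also have "\<dots> < (f u)\<^sup>2 * (pot v - pot u)"
      using 1 pot by (intro mult_strict_right_mono) auto
    finally show ?thesis
      by (simp add: algebra_simps)
  qed
qed

lemma psi_pos: "w \<in> wset \<Longrightarrow> 0 < w \<Longrightarrow> 0 < psi w"
  using psi_sign[of w] by (cases "psi w" "0 :: real" rule: linorder_cases) auto

lemma G_psi_pos:
  assumes "w \<in> wset" "0 < w"
  shows "0 < f (psi w)" "G w = w / f (psi w)" "w\<^sup>2 = 2 * pot (psi w)"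
proof -
  have u: "psi w \<in> uset" "0 < psi w"
    using assms psi_in psi_pos by auto
  show "0 < f (psi w)"
    using u uset_pos_iff by blast
  show "G w = w / f (psi w)"
    using u assms Phi_psi by (simp add: G_def dPhi_def)
  show "w\<^sup>2 = 2 * pot (psi w)"
    using Phi_square[OF u(1)] Phi_psi assms by simp
qed

text \<open>With \<open>u = psi w\<close>, the bounds \<open>f u < u\<close> and
  \<open>u * f u <= 2 * pot u\<close> give \<open>(f u)^2 < w^2\<close>, and \<open>G w\<close> is
  \<open>w / f u\<close>.\<close>

lemma G_gt_1_pos:
  assumes "w \<in> wset" "0 < w"
  shows "1 < G w"
proof -
  define u where "u = psi w"
  have u: "0 < u" "0 < f u" "w\<^sup>2 = 2 * pot u" "G w = w / f u"
    using G_psi_pos[OF assms] psi_pos[OF assms] by (auto simp: u_def)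
  have "(f u)\<^sup>2 < u * f u"
    using f_less_self[OF u(1)] u(2) by (simp add: power2_eq_square)
  then have "(f u)\<^sup>2 < w\<^sup>2"
    using pot_ge_triangle[OF u(1)] u(3) by simp
  then have "f u < w"
    using assms(2) by (simp add: power_less_imp_less_base)
  then show ?thesis
    using u by simp
qed

text \<open>The square of \<open>G w\<close> is \<open>2 * pot u / (f u)^2\<close> at
  \<open>u = psi w\<close>, and this quotient increases with \<open>u\<close>.\<close>

lemma G_less_pos:
  assumes "w \<in> wset" "0 < v" "v < w"
  shows "G v < G w"
proof -
  have vw: "v \<in> wset"
    using wset_between[OF wset_0 assms(1)] assms by simp
  note v = G_psi_pos[OF vw assms(2)]
  have w0: "0 < w"
    using assms by simp
  note w = G_psi_pos[OF assms(1) w0]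
  have "pot (psi v) * (f (psi w))\<^sup>2 < pot (psi w) * (f (psi v))\<^sup>2"
    by (rule pot_over_f_square_strict_mono)
      (use psi_pos vw assms psi_less v w in auto)
  then have "(v * f (psi w))\<^sup>2 < (w * f (psi v))\<^sup>2"
    using v(3) w(3) by (simp add: power_mult_distrib)
  then have "v * f (psi w) < w * f (psi v)"
    using w0 v by - (rule power_less_imp_less_base[of _ 2], auto)
  then show ?thesis
    using v w by (simp add: pos_divide_less_eq pos_less_divide_eq)
qed

section \<open>Divergence of the time integral over one lobe\<close>

lemma f_ge_f_1:
  assumes pos: "\<And>u. 0 < u \<Longrightarrow> 0 < f u" and v: "1 \<le> v"
  shows "f 1 \<le> f v"
proof (rule ccontr)
  assume less: "\<not> f 1 \<le> f v"
  then have v1: "1 < v"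
    using v by (cases "v = 1") auto
  define p where "p = (f 1 - f v) / (v - 1)"
  have p: "0 < p"
    using less v1 by (simp add: p_def)
  \<comment> \<open>The line of slope \<open>- p\<close> through \<open>(v, f v)\<close> reaches 0
    at \<open>z\<close>. A concave function that has dropped from 1 to \<open>v\<close> stays below
    this line afterwards, so \<open>f z < 0\<close>.\<close>
  define z where "z = v + f v / p"
  have z: "v < z"
    using p pos[of v] v1 by (simp add: z_def)
  have "(f z - f v) / (z - v) < - p"
    using slopes_decrease[of 1 v z] v1 z by (simp add: p_def minus_divide_left)
  then have "f z - f v < - p * (z - v)"
    using z by (simp add: pos_divide_less_eq)
  also have "\<dots> = - f v"
    using p by (simp add: z_def)
  finally show False
    using pos[of z] z v1 by simp
qed

lemma sin_in_unit: "t \<in> {0..pi} \<Longrightarrow> 0 \<le> sin t \<and> sin t \<le> 1"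
  using sin_ge_zero by auto

lemma continuous_on_G_sin:
  assumes "\<And>t. t \<in> S \<Longrightarrow> s * sin t \<in> wset"
  shows "continuous_on S (\<lambda>t. G (s * sin t))"
  by (rule continuous_on_compose2[of wset G])
    (use assms isCont_G in \<open>auto intro!: continuous_intros continuous_at_imp_continuous_on\<close>)

lemma lobe_wset: "s \<in> wset \<Longrightarrow> t \<in> {0..pi} \<Longrightarrow> s * sin t \<in> wset"
  using wset_scale[of s "sin t"] sin_in_unit[of t] by (simp add: mult.commute)

text \<open>On this window \<open>sin t\<close> is at least \<open>1 / 2\<close>, so the orbit has
  at least half its amplitude; the rest of the lobe contributes a nonnegative amount.\<close>

lemma lobe_lower_bound:
  assumes s: "s \<in> wset" "0 < s" and h: "continuous_on {pi / 6..pi / 2} h"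
    and le: "\<And>t. t \<in> {pi / 6..pi / 2} \<Longrightarrow> h t \<le> G (s * sin t)"
  shows "integral {pi / 6..pi / 2} h \<le> integral {0..pi} (\<lambda>t. G (s * sin t))"
proof -
  have sub: "{pi / 6..pi / 2} \<subseteq> {0..pi}"
    by auto
  have c: "continuous_on {0..pi} (\<lambda>t. G (s * sin t))"
    using lobe_wset s by (intro continuous_on_G_sin) auto
  have "integral {pi / 6..pi / 2} h \<le> integral {pi / 6..pi / 2} (\<lambda>t. G (s * sin t))"
    using h c le sub by (intro integral_le integrable_continuous_real)
      (auto intro: continuous_on_subset)
  also have "\<dots> \<le> integral {0..pi} (\<lambda>t. G (s * sin t))"
    using c sub lobe_wset[OF s(1)] G_pos
    by (intro integral_subset_le integrable_continuous_real)
      (auto intro: continuous_on_subset less_imp_le)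
  finally show ?thesis .
qed

lemma sin_ge_half: "t \<in> {pi / 6..pi / 2} \<Longrightarrow> 1 / 2 \<le> sin t"
  using sin_monotone_2pi_le[of "pi / 6" t] by (auto simp: sin_30)

text \<open>From \<open>(G w)^2 >= u / f u\<close> with \<open>u = psi w\<close>, sublinear growth
  gives \<open>G w >= B\<close> for some \<open>w\<close>. Amplitude \<open>2 * w\<close> keeps the
  orbit above \<open>w\<close> on a window of length \<open>pi / 3 > 1\<close>.\<close>

lemma lobe_unbounded_no_zero:
  assumes pos: "\<And>u. 0 < u \<Longrightarrow> 0 < f u" and B: "0 < B"
  shows "\<exists>s\<in>wset. 0 < s \<and> B \<le> integral {0..pi} (\<lambda>t. G (s * sin t))"
proof -
  obtain M where M: "\<And>u. u \<ge> M \<Longrightarrow> f u \<le> 1 / B\<^sup>2 * u"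
    using f_top[of "1 / B\<^sup>2"] B by auto
  have uset: "u \<in> uset" if "0 < u" for u
    using that pos uset_pos_iff by blast
  define u where "u = max M 1"
  have u: "0 < u" "M \<le> u" "u \<in> uset"
    using uset by (auto simp: u_def)
  define w where "w = Phi u"
  have w: "0 < w" "w \<in> wset" "psi w = u"
    using Phi_pos psi_Phi u by (auto simp: w_def wset_def)
  have GB: "B \<le> G w"
  proof -
    have "(B * f u)\<^sup>2 = B\<^sup>2 * f u * f u"
      by (simp add: power2_eq_square)
    also have "\<dots> \<le> u * f u"
      using M[OF u(2)] B pos[OF u(1)] by (intro mult_right_mono) (auto simp: field_simps)
    also have "\<dots> \<le> w\<^sup>2"
      using pot_ge_triangle[OF u(1)] G_psi_pos(3)[OF w(2,1)] w by simp
    finally have "B * f u \<le> w"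
      using w by - (rule power2_le_imp_le, auto)
    then show ?thesis
      using G_psi_pos[OF w(2,1)] w by (simp add: pos_le_divide_eq)
  qed
  \<comment> \<open>Beyond 1 the potential grows at least with slope \<open>f 1\<close>, so
    \<open>pot v >= 2 * w^2\<close>, that is \<open>Phi v >= 2 * w\<close>: the amplitude
    \<open>2 * w\<close> is admissible.\<close>
  define v where "v = 1 + 2 * w\<^sup>2 / f 1"
  have v: "1 \<le> v"
    using pos[of 1] by (simp add: v_def)
  have "f 1 * v - f 1 * 1 \<le> pot v - pot 1"
  proof (rule le_of_deriv_le[OF v])
    fix x :: real assume "1 \<le> x" "x \<le> v"
    then show "f 1 \<le> f x"
      using f_ge_f_1 pos by blast
    show "((*) (f 1) has_real_derivative f 1) (at x)"
      by (auto intro!: derivative_eq_intros)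
  qed (rule pot_deriv)
  moreover have "0 < pot 1"
    using pot_pos uset by auto
  ultimately have "2 * w\<^sup>2 \<le> pot v"
    using pos[of 1] by (simp add: v_def algebra_simps)
  then have "(2 * w)\<^sup>2 \<le> (Phi v)\<^sup>2"
    using Phi_square[of v] uset v by (simp add: power_mult_distrib)
  then have "2 * w \<le> Phi v"
    using Phi_pos[of v] uset v by - (rule power2_le_imp_le, auto)
  then have s: "2 * w \<in> wset"
    using wset_between[OF wset_0, of "Phi v" "2 * w"] uset[of v] v w by (auto simp: wset_def)
  have "B \<le> pi / 3 * B"
    using pi_gt3 B by simp
  also have "\<dots> \<le> integral {pi / 6..pi / 2} (\<lambda>t. B)"
    by simp
  also have "\<dots> \<le> integral {0..pi} (\<lambda>t. G (2 * w * sin t))"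
  proof (rule lobe_lower_bound)
    fix t :: real assume t: "t \<in> {pi / 6..pi / 2}"
    have "w \<le> 2 * w * sin t"
      using sin_ge_half[OF t] w by simp
    moreover have "2 * w * sin t \<in> wset"
      using lobe_wset[OF s, of t] t by auto
    ultimately have "G w \<le> G (2 * w * sin t)"
      using G_less_pos[of "2 * w * sin t" w] w(1) by (metis le_less order_refl)
    then show "B \<le> G (2 * w * sin t)"
      using GB by simp
  qed (use s w in auto)
  finally show ?thesis
    using s w by (intro bexI[of _ "2 * w"]) auto
qed

text \<open>Chord slopes decrease, so the chord from \<open>x\<close> to the zero \<open>M\<close>
  falls less steeply than the one from \<open>M\<close> to \<open>M + 1\<close>: \<open>f\<close>
  vanishes at most linearly at \<open>M\<close>.\<close>

lemma f_le_near_zero: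
  assumes "f M = 0" "0 < x" "x < M"
  shows "f x \<le> - f (M + 1) * (M - x)"
proof -
  have "f x / (M - x) < - f (M + 1)"
    using slopes_decrease[of x M "M + 1"] assms by simp
  then show ?thesis
    using assms by (simp add: pos_divide_less_eq)
qed

text \<open>The motion slows down near a zero \<open>E\<close> of \<open>f\<close>. With
  \<open>S = Phi E\<close> and \<open>s^2 = S^2 * (1 - d^2)\<close>, the integrand is at least
  \<open>c / (d + pi / 2 - t)\<close> on the window, and the integral of this bound grows like
  \<open>- c * ln d\<close>.\<close>

lemma lobe_unbounded_zero:
  assumes v: "0 < v" "f v \<le> 0"
  shows "\<exists>s\<in>wset. 0 < s \<and> B \<le> integral {0..pi} (\<lambda>t. G (s * sin t))"
proof -
  obtain e where e: "0 < e" "{- e<..<e} \<subseteq> uset"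
  proof -
    obtain e where "0 < e" "ball 0 e \<subseteq> uset"
      using open_uset uset_0 open_contains_ball by blast
    moreover have "{- e<..<e} = ball 0 e"
      by (auto simp: dist_real_def abs_less_iff)
    ultimately show ?thesis
      using that by simp
  qed
  define e' where "e' = min (e / 2) v"
  have e': "0 < e'" "e' \<le> v"
    using e v by (auto simp: e'_def)
  have "0 \<le> f e'"
  proof (cases "e' = v")
    case False
    then have "e' = e / 2"
      by (auto simp: e'_def min_def split: if_splits)
    then have "e' \<in> uset"
      using e by auto
    then show ?thesis
      using e' uset_pos_iff by force
  next
    case True
    then have "e' \<in> uset" if "v < e"
      using that e v by auto
    moreover have "e' = v" "v \<le> e / 2"
      using True by (auto simp: e'_def)
    ultimately show ?thesis
      using e' e uset_pos_iff[of e'] by auto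
  qed
  then obtain E where "e' \<le> E" "f E = 0"
    using IVT2[of f v 0 e'] isCont_f e' v by auto
  then have E: "0 < E" "f E = 0"
    using e' by auto
  have pos: "0 < f x" if "0 < x" "x < E" for x
    using ratio_strict_antimono[OF that] E that by (simp add: zero_less_divide_iff)
  have uset: "x \<in> uset" if "0 < x" "x < E" for x
    using that pos uset_pos_iff by blast
  define L where "L = - f (E + 1)"
  have L: "0 < L"
    using ratio_strict_antimono[of E "E + 1"] E by (simp add: L_def divide_less_0_iff)
  have f_le: "f x \<le> L * (E - x)" if "0 < x" "x < E" for x
    using f_le_near_zero[OF E(2) that] by (simp add: L_def)
  \<comment> \<open>The product of two bounds: \<open>f u <= L * (E - u)\<close>, and
    \<open>pot E - pot u >= f u * (E - u) / 2\<close> from the chord joining \<open>(u, f u)\<close>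
    to \<open>(E, 0)\<close>.\<close>
  have f_sq: "(f u)\<^sup>2 \<le> L * (2 * pot E - 2 * pot u)" if u: "0 < u" "u < E" for u
  proof -
    define c where "c = f u / (E - u)"
    have c: "c * (E - u) = f u"
      using u by (simp add: c_def)
    have "(- c * (E - E)\<^sup>2 / 2) - (- c * (E - u)\<^sup>2 / 2) \<le> pot E - pot u"
    proof (rule le_of_deriv_le)
      fix x assume x: "u \<le> x" "x \<le> E"
      show "((\<lambda>x. - c * (E - x)\<^sup>2 / 2) has_real_derivative c * (E - x)) (at x)"
        by (auto intro!: derivative_eq_intros simp: field_simps)
      consider "x = u" | "x = E" | "u < x" "x < E"
        using x by linarith
      then show "c * (E - x) \<le> f x"
      proof cases
        case 3
        have "f u * (E - x) \<le> f x * (E - u)"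
          using chord_above[of u x E] E u 3 by (simp add: algebra_simps)
        then show ?thesis
          using u by (simp add: c_def field_simps)
      qed (use c E in auto)
    qed (use u pot_deriv in auto)
    then have "c * (E - u) * (E - u) \<le> 2 * pot E - 2 * pot u"
      by (simp add: power2_eq_square)
    then have 1: "f u * (E - u) \<le> 2 * pot E - 2 * pot u"
      by (simp add: c)
    have "(f u)\<^sup>2 \<le> f u * (L * (E - u))"
      using f_le[OF u] pos[OF u] by (simp add: power2_eq_square)
    also have "\<dots> = L * (f u * (E - u))"
      by simp
    also have "\<dots> \<le> L * (2 * pot E - 2 * pot u)"
      using 1 L by (intro mult_left_mono) auto
    finally show ?thesis .
  qed
  define S where "S = sqrt (2 * pot E)"
  have potE: "0 < pot E"
    using pot_less[of "E / 2" E] pot_pos[of "E / 2"] uset[of "E / 2"] E by simp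
  have S: "0 < S" "S\<^sup>2 = 2 * pot E"
    using potE by (auto simp: S_def)
  \<comment> \<open>\<open>c\<close> is what remains when \<open>w >= S / 4\<close> is divided by
    \<open>f (psi w) <= sqrt L * S * (d + (pi / 2 - t))\<close>. The choice of \<open>d\<close>
    makes \<open>- c * ln d >= B\<close>, and \<open>d <= 1 / 2\<close> keeps \<open>s\<close> above
    \<open>S / 2\<close>.\<close>
  define c where "c = 1 / (4 * sqrt L)"
  have c: "0 < c"
    using L by (simp add: c_def)
  define d where "d = min (1 / 2) (exp (- B / c))"
  have d: "0 < d" "d \<le> 1 / 2" "d \<le> exp (- B / c)"
    by (auto simp: d_def)
  have d2: "d\<^sup>2 \<le> 1 / 4" "0 < d\<^sup>2"
    using power_mono[OF d(2), of 2] d by (auto simp: power2_eq_square)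
  have "pot 0 \<le> pot E * (1 - d\<^sup>2)" "pot E * (1 - d\<^sup>2) \<le> pot E"
    using potE d2 by (auto simp: pot_0 mult_left_le)
  then obtain u0 where u0: "0 \<le> u0" "u0 \<le> E" "pot u0 = pot E * (1 - d\<^sup>2)"
    using IVT[of pot 0 "pot E * (1 - d\<^sup>2)" E] isCont_pot E by force
  then have "u0 \<noteq> 0" "u0 \<noteq> E"
    using potE d2 by (auto simp: pot_0)
  with u0 have u0': "0 < u0" "u0 < E"
    by auto
  define s where "s = Phi u0"
  have s: "s \<in> wset" "0 < s" "s\<^sup>2 = S\<^sup>2 * (1 - d\<^sup>2)"
    using Phi_pos Phi_square uset u0' u0 S by (auto simp: s_def wset_def)
  have "(S / 2)\<^sup>2 \<le> S\<^sup>2 * (1 - d\<^sup>2)"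
    using mult_left_mono[of "1 / 4" "1 - d\<^sup>2" "S\<^sup>2"] d2 by (simp add: power_divide)
  then have s2: "S / 2 \<le> s"
    using s by - (rule power2_le_imp_le, auto)
  have lower: "c / (d + (pi / 2 - t)) \<le> G (s * sin t)" if t: "t \<in> {pi / 6..pi / 2}" for t
  proof -
    define w where "w = s * sin t"
    have w: "w \<in> wset" "0 < w" "w \<le> s"
      using lobe_wset[OF s(1), of t] t s sin_ge_half[OF t] by (auto simp: w_def)
    note Gw = G_psi_pos[OF w(1,2)]
    have "psi w \<le> psi s"
      using psi_less[of w s] w s by (cases "w = s") auto
    then have psi: "0 < psi w" "psi w < E"
      using psi_pos w u0' psi_Phi[of u0] uset[of u0] by (auto simp: s_def)
    have cos: "0 \<le> cos t" "cos t \<le> pi / 2 - t"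
      using cos_ge_zero[of t] sin_x_le_x[of "pi / 2 - t"] t by (auto simp: sin_diff)
    have "S\<^sup>2 - w\<^sup>2 = S\<^sup>2 - s\<^sup>2 * (1 - (cos t)\<^sup>2)"
      by (simp add: w_def power_mult_distrib sin_squared_eq)
    also have "\<dots> = S\<^sup>2 * (d\<^sup>2 + (1 - d\<^sup>2) * (cos t)\<^sup>2)"
      unfolding s(3) by (simp add: algebra_simps)
    also have "\<dots> \<le> S\<^sup>2 * (d + (pi / 2 - t))\<^sup>2"
    proof (rule mult_left_mono)
      have "(1 - d\<^sup>2) * (cos t)\<^sup>2 \<le> 1 * (pi / 2 - t)\<^sup>2"
        using d2 cos by (intro mult_mono power_mono) auto
      also have "d\<^sup>2 + 1 * (pi / 2 - t)\<^sup>2 \<le> (d + (pi / 2 - t))\<^sup>2"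
        using d t by (simp add: power2_sum)
      finally show "d\<^sup>2 + (1 - d\<^sup>2) * (cos t)\<^sup>2 \<le> (d + (pi / 2 - t))\<^sup>2"
        by simp
    qed simp
    finally have "S\<^sup>2 - w\<^sup>2 \<le> S\<^sup>2 * (d + (pi / 2 - t))\<^sup>2" .
    then have "L * (S\<^sup>2 - w\<^sup>2) \<le> L * (S\<^sup>2 * (d + (pi / 2 - t))\<^sup>2)"
      using L by (intro mult_left_mono) auto
    moreover have "L = (sqrt L)\<^sup>2"
      using L by simp
    ultimately have "(f (psi w))\<^sup>2 \<le> (sqrt L * S * (d + (pi / 2 - t)))\<^sup>2"
      using f_sq[OF psi] Gw(3) S(2) by (simp add: power_mult_distrib mult_ac)
    then have f_le: "f (psi w) \<le> sqrt L * S * (d + (pi / 2 - t))"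
      using L S d t by - (rule power2_le_imp_le, auto)
    have "S / 4 \<le> w"
      using mult_mono[OF s2 sin_ge_half[OF t]] s S by (simp add: w_def)
    then have "(S / 4) / (sqrt L * S * (d + (pi / 2 - t))) \<le> w / f (psi w)"
      using f_le Gw(1) S w by (intro frac_le) auto
    moreover have "(S / 4) / (sqrt L * S * (d + (pi / 2 - t))) = c / (d + (pi / 2 - t))"
      using S by (simp add: c_def)
    ultimately show ?thesis
      using Gw(2) by (simp add: w_def)
  qed
  \<comment> \<open>The end \<open>pi / 2\<close> contributes \<open>- c * ln d >= B\<close>; at
    \<open>pi / 6\<close> the argument of the logarithm exceeds 1, so that term is
    nonnegative.\<close>
  have "integral {pi / 6..pi / 2} (\<lambda>t. c / (d + (pi / 2 - t))) =
      - c * ln (d + (pi / 2 - pi / 2)) - (- c * ln (d + (pi / 2 - pi / 6)))"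
    by (rule integral_eq_diffI) (use d in \<open>auto intro!: derivative_eq_intros simp: field_simps\<close>)
  moreover have "c * ln d \<le> - B"
  proof -
    have "ln d \<le> - B / c"
      using d by (metis ln_exp ln_le_cancel_iff exp_gt_zero)
    then show ?thesis
      using c by (simp add: field_simps)
  qed
  moreover have "0 \<le> c * ln (d + (pi / 2 - pi / 6))"
    using c d pi_gt3 by (intro mult_nonneg_nonneg ln_ge_zero) auto
  moreover have "integral {pi / 6..pi / 2} (\<lambda>t. c / (d + (pi / 2 - t))) \<le>
      integral {0..pi} (\<lambda>t. G (s * sin t))"
    by (rule lobe_lower_bound) (use s lower d in \<open>auto intro!: continuous_intros\<close>)
  ultimately have "B \<le> integral {0..pi} (\<lambda>t. G (s * sin t))"
    by simp
  then show ?thesis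
    using s by blast
qed

lemma lobe_unbounded: "\<exists>s\<in>wset. 0 < s \<and> B \<le> integral {0..pi} (\<lambda>t. G (s * sin t))"
proof (cases "\<forall>u>0. 0 < f u")
  case True
  then obtain s where "s \<in> wset" "0 < s" "max B 1 \<le> integral {0..pi} (\<lambda>t. G (s * sin t))"
    using lobe_unbounded_no_zero[of "max B 1"] by fastforce
  then show ?thesis
    by (intro bexI[of _ s]) auto
next
  case False
  then show ?thesis
    using lobe_unbounded_zero by (meson not_le)
qed

end

section \<open>Construction of the branches\<close>

lemma real_derivative_unique_unit_interval:
  fixes u :: "real \<Rightarrow> real"
  assumes "x \<in> {0..1}" "(u has_real_derivative c) (at x within {0..1})"
    "(u has_real_derivative d) (at x within {0..1})"
  shows "c = d"
  using vector_derivative_unique_within_closed_interval[of 0 1 x u c d] assms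
  by (simp add: has_real_derivative_iff_has_vector_derivative)

lemma sin_zero_iff_le:
  assumes "0 \<le> t" "t \<le> real j * pi"
  shows "sin t = 0 \<longleftrightarrow> (\<exists>i\<le>j. t = real i * pi)"
proof
  assume "sin t = 0"
  then obtain n where n: "even n" "t = real n * (pi / 2)"
    using sin_zero_lemma assms by blast
  then obtain i where "n = 2 * i"
    by blast
  then have "t = real i * pi"
    using n by simp
  moreover from this have "i \<le> j"
    using assms by simp
  ultimately show "\<exists>i\<le>j. t = real i * pi"
    by blast
qed auto

context ci_nonlin
begin

interpretation R: ci_nonlin "\<lambda>x. - f (- x)"
  by (rule reflect)

lemma G_gt_1:
  assumes "w \<in> wset" "w \<noteq> 0" shows "1 < G w"
  using G_gt_1_pos[of w] R.G_gt_1_pos[of "- w"] reflect_wset[of "- w"] reflect_G[of "- w"] assms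
  by (cases w "0 :: real" rule: linorder_cases) auto

lemma G_ge_1: "w \<in> wset \<Longrightarrow> 1 \<le> G w"
  using G_gt_1[of w] G_0 by (cases "w = 0") auto

text \<open>Scaling towards \<open>0\<close> expresses monotonicity in the modulus for both signs at
  once; reflection supplies the case of negative \<open>w\<close>.\<close>

lemma G_scale_less:
  assumes "w \<in> wset" "w \<noteq> 0" "0 \<le> c" "c < 1"
  shows "G (c * w) < G w"
proof (cases "c = 0")
  case False
  show ?thesis
  proof (cases "0 < w")
    case True
    then show ?thesis
      using G_less_pos[of w "c * w"] assms False by simp
  next
    case less: False
    then have w: "- w \<in> R.wset" "0 < - w"
      using assms by (auto simp: reflect_wset)
    have c: "0 < c"
      using False assms by simp
    have "0 < c * - w" "c * - w < 1 * - w"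
      using mult_pos_pos[OF c w(2)] mult_strict_right_mono[OF assms(4) w(2)] by auto
    then have "R.G (c * - w) < R.G (- w)"
      using R.G_less_pos[OF w(1), of "c * - w"] by simp
    moreover have "c * - w \<in> R.wset"
      using R.wset_scale[OF w(1)] assms by simp
    ultimately show ?thesis
      using w by (simp add: reflect_G)
  qed
qed (use G_gt_1 G_0 assms in simp)

text \<open>Admissible amplitudes for \<open>j\<close> half turns. One half turn tests only the
  positive side of \<open>wset\<close>, two or more test both sides.\<close>

definition amp :: "nat \<Rightarrow> real set" where
  "amp j = {s. 0 \<le> s \<and> (\<forall>t\<in>{0..real j * pi}. s * sin t \<in> wset)}"

definition J :: "nat \<Rightarrow> real \<Rightarrow> real" where
  "J j s = integral {0..real j * pi} (\<lambda>t. G (s * sin t))"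

lemma amp_wset: "s \<in> amp j \<Longrightarrow> t \<in> {0..real j * pi} \<Longrightarrow> s * sin t \<in> wset"
  by (simp add: amp_def)

lemma amp_below:
  assumes "s \<in> amp j" "0 \<le> r" "r \<le> s"
  shows "r \<in> amp j"
proof (cases "s = 0")
  case False
  then have "r * sin t = (r / s) * (s * sin t)" for t
    by simp
  moreover have "0 \<le> r / s" "r / s \<le> 1"
    using assms False by (auto simp: divide_le_eq_1)
  ultimately show ?thesis
    using assms(1,2) wset_scale[of "s * sin _" "r / s"] unfolding amp_def by auto
qed (use assms in auto)

lemma J_0: "J j 0 = real j * pi"
  by (simp add: J_def G_0)

text \<open>Serves the time map (\<open>c t = 1\<close>, \<open>K = G\<close>), the
  \<open>H01_norm\<close> (\<open>c t = (cos t)^2\<close>, \<open>K = G\<close>) and the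
  \<open>Lq_norm\<close> (\<open>K w = |psi w|^q * G w\<close>).\<close>

lemma continuous_on_amp_integral:
  fixes c K :: "real \<Rightarrow> real"
  assumes "continuous_on UNIV c" "continuous_on wset K"
  shows "continuous_on (amp j) (\<lambda>s. integral {0..real j * pi} (\<lambda>t. c t * K (s * sin t)))"
proof -
  have "continuous_on (amp j \<times> {0..real j * pi}) (\<lambda>p. c (snd p) * K (fst p * sin (snd p)))"
  proof (rule continuous_on_mult)
    show "continuous_on (amp j \<times> {0..real j * pi}) (\<lambda>p. c (snd p))"
      by (rule continuous_on_compose2[OF assms(1)]) (auto intro!: continuous_intros)
    show "continuous_on (amp j \<times> {0..real j * pi}) (\<lambda>p. K (fst p * sin (snd p)))"
      by (rule continuous_on_compose2[OF assms(2)])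
        (use amp_wset in \<open>auto intro!: continuous_intros\<close>)
  qed
  then have "continuous_on (amp j \<times> cbox 0 (real j * pi)) (\<lambda>(s, t). c t * K (s * sin t))"
    by (simp add: case_prod_beta)
  then show ?thesis
    using integral_continuous_on_param[of "amp j" 0 "real j * pi" "\<lambda>s t. c t * K (s * sin t)"]
    by simp
qed

lemma continuous_on_G: "continuous_on wset G"
  using isCont_G by (simp add: continuous_at_imp_continuous_on)

lemma continuous_on_J: "continuous_on (amp j) (J j)"
  using continuous_on_amp_integral[of "\<lambda>_. 1" G j] continuous_on_G
  by (simp add: J_def[abs_def])

lemma continuous_on_G_amp:
  assumes "s \<in> amp j" "S \<subseteq> {0..real j * pi}"
  shows "continuous_on S (\<lambda>t. G (s * sin t))"
  using assms amp_wset by (intro continuous_on_G_sin) blast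

lemma G_amp_mono:
  assumes "s \<in> amp j" "0 \<le> r" "r \<le> s" "t \<in> {0..real j * pi}"
  shows "G (r * sin t) \<le> G (s * sin t)"
proof (cases "r = s \<or> sin t = 0")
  case False
  then have "r * sin t = (r / s) * (s * sin t)" "0 \<le> r / s" "r / s < 1" "s * sin t \<noteq> 0"
    using assms by auto
  then show ?thesis
    using G_scale_less[of "s * sin t" "r / s"] amp_wset[OF assms(1,4)] by simp
qed auto

text \<open>The larger amplitude gives a pointwise larger integrand, strictly so at
  \<open>pi / 2\<close>; for continuous integrands one such point is enough.\<close>

lemma J_less:
  assumes "s \<in> amp j" "0 \<le> r" "r < s" "1 \<le> j"
  shows "J j r < J j s"
proof -
  have r: "r \<in> amp j"
    using amp_below assms by auto
  have pi: "pi / 2 \<le> real j * pi" "0 < real j * pi"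
    using assms(4) mult_right_mono[of 1 "real j" pi] pi_gt_zero by auto
  let ?h = "\<lambda>t. G (s * sin t) - G (r * sin t)"
  have "?h (pi / 2) > 0"
    using G_scale_less[of s "r / s"] amp_wset[OF assms(1), of "pi / 2"] assms pi by simp
  then have "integral {0..real j * pi} ?h \<noteq> 0"
    using pi assms r G_amp_mono[OF assms(1,2)]
    by (subst integral_eq_0_iff) (auto intro!: continuous_intros continuous_on_G_amp bexI[of _ "pi / 2"])
  moreover have "0 \<le> integral {0..real j * pi} ?h"
    using G_amp_mono[OF assms(1,2)] assms r
    by (intro integral_nonneg integrable_continuous_real continuous_intros continuous_on_G_amp) auto
  moreover have "integral {0..real j * pi} ?h = J j s - J j r"
    unfolding J_def using assms r
    by (intro integral_diff integrable_continuous_real continuous_on_G_amp) auto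
  ultimately show ?thesis
    by simp
qed

lemma J_ge: "s \<in> amp j \<Longrightarrow> 1 \<le> j \<Longrightarrow> real j * pi \<le> J j s"
  using J_less[of s j 0] J_0 by (cases "s = 0") (auto simp: amp_def)

lemma J_gt: "s \<in> amp j \<Longrightarrow> 0 < s \<Longrightarrow> 1 \<le> j \<Longrightarrow> real j * pi < J j s"
  using J_less[of s j 0] J_0 by auto

lemma J_pos: "s \<in> amp j \<Longrightarrow> 1 \<le> j \<Longrightarrow> 0 < J j s"
  using J_ge[of s j] pi_gt_zero by (metis le_zero_eq less_le_trans mult_pos_pos not_gr_zero not_one_le_zero of_nat_0_less_iff)

lemma amp_of_both: "0 \<le> s \<Longrightarrow> s \<in> wset \<Longrightarrow> - s \<in> wset \<Longrightarrow> s \<in> amp j"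
proof -
  assume s: "0 \<le> s" "s \<in> wset" "- s \<in> wset"
  have "s * sin t \<in> wset" for t
    using s wset_between[of "- s" s "s * sin t"] mult_left_mono[of "sin t" 1 s]
      mult_left_mono[of "-1" "sin t" s] by simp
  then show ?thesis
    using s by (simp add: amp_def)
qed

lemma J_ge_lobe:
  assumes "s \<in> amp j" "i < j"
  shows "integral {real i * pi..real i * pi + pi} (\<lambda>t. G (s * sin t)) \<le> J j s"
  unfolding J_def
proof (rule integral_subset_le)
  have "real (Suc i) * pi \<le> real j * pi"
    using assms(2) by (intro mult_right_mono) (auto simp del: of_nat_Suc)
  then show sub: "{real i * pi..real i * pi + pi} \<subseteq> {0..real j * pi}"
    unfolding atLeastatMost_subset_iff by (simp add: algebra_simps)
  show "(\<lambda>t. G (s * sin t)) integrable_on {real i * pi..real i * pi + pi}"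
    "(\<lambda>t. G (s * sin t)) integrable_on {0..real j * pi}"
    by (intro integrable_continuous_real continuous_on_G_amp[OF assms(1)] sub order_refl)+
  show "\<forall>t\<in>{0..real j * pi}. 0 \<le> G (s * sin t)"
    using G_ge_1 amp_wset[OF assms(1)] by force
qed

text \<open>If the amplitude \<open>s\<close> found on the positive side does not fit, then
  \<open>wset\<close> ends earlier on the negative side. An amplitude \<open>r\<close> found there
  is smaller than \<open>s\<close>, hence fits on both sides, and the second lobe, from
  \<open>pi\<close> to \<open>2 * pi\<close>, carries the bound.\<close>

lemma J_unbounded:
  assumes "1 \<le> j"
  shows "\<exists>s\<in>amp j. B \<le> J j s"
proof -
  obtain s where s: "s \<in> wset" "0 < s" "B \<le> integral {0..pi} (\<lambda>t. G (s * sin t))"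
    using lobe_unbounded by blast
  show ?thesis
  proof (cases "s \<in> amp j")
    case True
    then have "B \<le> J j s"
      using J_ge_lobe[OF True, of 0] s assms by simp
    then show ?thesis
      using True by blast
  next
    case False
    then have ms: "- s \<notin> wset"
      using amp_of_both s by auto
    have j: "j \<noteq> 1"
      using False s lobe_wset by (auto simp: amp_def)
    obtain r where r: "r \<in> R.wset" "0 < r" "B \<le> integral {0..pi} (\<lambda>t. R.G (r * sin t))"
      using R.lobe_unbounded by blast
    have mr: "- r \<in> wset"
      using r reflect_wset by auto
    have "r < s"
    proof (rule ccontr)
      assume "\<not> r < s"
      then have "- s \<in> wset"
        using wset_between[OF mr wset_0, of "- s"] s by simp
      then show False
        using ms by simp
    qed
    then have "r \<in> wset"
      using wset_between[OF wset_0 s(1), of r] r by simp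
    then have amp: "r \<in> amp j"
      using amp_of_both mr r by simp
    have "B \<le> integral {0..pi} (\<lambda>t. R.G (r * sin t))"
      by (rule r)
    also have "\<dots> = integral {0..pi} (\<lambda>t. G (r * sin (t + pi)))"
      using R.lobe_wset[OF r(1)] by (intro integral_cong) (simp add: reflect_G)
    also have "\<dots> = integral {pi..pi + pi} (\<lambda>t. G (r * sin t))"
      using integral_shift_real_ivl[of pi pi "pi + pi" "\<lambda>t. G (r * sin t)"] by simp
    also have "\<dots> \<le> J j r"
      using J_ge_lobe[OF amp, of 1] assms j by simp
    finally show ?thesis
      using amp by blast
  qed
qed

section \<open>The solution with given amplitude\<close>

definition gs :: "nat \<Rightarrow> real \<Rightarrow> real \<Rightarrow> real" where
  "gs j s t = G (s * sin (max 0 (min t (real j * pi))))"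

text \<open>The phase angle at position \<open>x\<close>: elapsed time as a function of the angle is
  inverted, scaled so that \<open>x = 1\<close> is reached at angle \<open>j * pi\<close>.\<close>

definition Theta :: "nat \<Rightarrow> real \<Rightarrow> real \<Rightarrow> real" where
  "Theta j s x = inv (prim (gs j s)) (J j s * x)"

definition U :: "nat \<Rightarrow> real \<Rightarrow> real \<Rightarrow> real" where
  "U j s x = (if x \<in> {0..1} then psi (s * sin (Theta j s x)) else 0)"

lemma gs_eq: "t \<in> {0..real j * pi} \<Longrightarrow> gs j s t = G (s * sin t)"
  by (simp add: gs_def)

lemma clamp_mem: "max 0 (min t (real j * pi)) \<in> {0..real j * pi}"
  by simp

text \<open>Clamping the angle in \<open>gs\<close> extends the integrand to the whole line with
  values at least 1, so that its primitive can be inverted globally.\<close>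

lemma
  assumes "s \<in> amp j"
  shows continuous_gs: "continuous_on UNIV (gs j s)"
    and gs_ge_1: "1 \<le> gs j s t"
    and prim_gs_end: "prim (gs j s) (real j * pi) = J j s"
proof -
  show c: "continuous_on UNIV (gs j s)"
    unfolding gs_def
    by (rule continuous_on_compose2[OF continuous_on_G])
      (use amp_wset[OF assms clamp_mem] in \<open>auto intro!: continuous_intros\<close>)
  show "1 \<le> gs j s t"
    unfolding gs_def by (intro G_ge_1 amp_wset[OF assms] clamp_mem)
  have "prim (gs j s) (real j * pi) = integral {0..real j * pi} (gs j s)"
    using integral_eq_prim[OF c] by simp
  also have "\<dots> = J j s"
    unfolding J_def using gs_eq by (intro integral_cong) auto
  finally show "prim (gs j s) (real j * pi) = J j s" .
qed

lemma
  assumes s: "s \<in> amp j" and j: "1 \<le> j"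
  shows Theta_0: "Theta j s 0 = 0"
    and Theta_1: "Theta j s 1 = real j * pi"
    and Theta_le_iff: "Theta j s x \<le> Theta j s y \<longleftrightarrow> x \<le> y"
    and Theta_prim: "Theta j s (prim (gs j s) t / J j s) = t"
    and Theta_in: "x \<in> {0..1} \<Longrightarrow> Theta j s x \<in> {0..real j * pi}"
    and Theta_deriv_gs: "(Theta j s has_real_derivative J j s / gs j s (Theta j s x)) (at x)"
    and Theta_deriv: "x \<in> {0..1} \<Longrightarrow>
      (Theta j s has_real_derivative J j s / G (s * sin (Theta j s x))) (at x)"
proof -
  note g = continuous_gs[OF s] gs_ge_1[OF s]
  note J = J_pos[OF s j]
  show "Theta j s 0 = 0"
    using inv_prim_prim[OF g, of 0] prim_0[OF g(1)] by (simp add: Theta_def)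
  then have *: "Theta j s 0 = 0" .
  show "Theta j s 1 = real j * pi"
    using inv_prim_prim[OF g, of "real j * pi"] prim_gs_end[OF s] by (simp add: Theta_def)
  then have **: "Theta j s 1 = real j * pi" .
  have prim: "prim (gs j s) (Theta j s x) = J j s * x" for x
    using prim_inv_prim[OF g] by (simp add: Theta_def)
  show le: "Theta j s x \<le> Theta j s y \<longleftrightarrow> x \<le> y" for x y
    using strict_mono_less_eq[OF prim_strict_mono[OF g], of "Theta j s x" "Theta j s y"] J
    by (simp add: prim)
  show "Theta j s (prim (gs j s) t / J j s) = t"
    using inv_prim_prim[OF g] J by (simp add: Theta_def)
  show in_dom: "x \<in> {0..1} \<Longrightarrow> Theta j s x \<in> {0..real j * pi}" for x
    using le[of 0 x] le[of x 1] * ** by simp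
  show D: "(Theta j s has_real_derivative J j s / gs j s (Theta j s x)) (at x)" for x
    using DERIV_chain2[OF inv_prim_deriv[OF g, of "J j s * x"] DERIV_cmult[OF DERIV_ident, of "J j s"]]
    by (simp add: Theta_def[abs_def])
  show "x \<in> {0..1} \<Longrightarrow> (Theta j s has_real_derivative J j s / G (s * sin (Theta j s x))) (at x)" for x
    using D[of x] in_dom[of x] gs_eq by simp
qed

lemma U_eq: "x \<in> {0..1} \<Longrightarrow> U j s x = psi (s * sin (Theta j s x))"
  by (simp add: U_def)

text \<open>The factor \<open>G\<close> contributed by \<open>psi\<close> cancels the
  \<open>1 / G\<close> of the angular speed. What remains is smooth in the angle, so
  \<open>U\<close> can be differentiated twice although \<open>G\<close> is only known to be
  continuous.\<close>

lemma U_deriv: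
  assumes s: "s \<in> amp j" and j: "1 \<le> j" and x: "x \<in> {0..1}"
  shows "(U j s has_real_derivative J j s * s * cos (Theta j s x)) (at x within {0..1})"
proof -
  let ?w = "s * sin (Theta j s x)"
  have w: "?w \<in> wset"
    using amp_wset[OF s Theta_in[OF s j x]] .
  have "((\<lambda>x. s * sin (Theta j s x)) has_real_derivative
      s * (cos (Theta j s x) * (J j s / G ?w))) (at x)"
    by (auto intro!: derivative_eq_intros Theta_deriv[OF s j x])
  then have "((\<lambda>x. psi (s * sin (Theta j s x))) has_real_derivative
      G ?w * (s * (cos (Theta j s x) * (J j s / G ?w)))) (at x)"
    by (intro DERIV_chain2[where f = psi] psi_deriv w)
  moreover have "G ?w * (s * (cos (Theta j s x) * (J j s / G ?w))) = J j s * s * cos (Theta j s x)"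
    using G_pos[OF w] by simp
  ultimately have "((\<lambda>x. psi (s * sin (Theta j s x))) has_real_derivative
      J j s * s * cos (Theta j s x)) (at x within {0..1})"
    by (simp add: has_field_derivative_at_within)
  then show ?thesis
    by (rule has_field_derivative_transform_within[OF _ zero_less_one x]) (simp add: U_eq)
qed

lemma U_solution:
  assumes s: "s \<in> amp j" and j: "1 \<le> j"
  shows "chafee_infante_solution f ((J j s)\<^sup>2) (U j s)"
  unfolding chafee_infante_solution_def dirichlet_solution_def
proof (intro conjI allI impI)
  show "U j s x = 0" if "x \<notin> {0..1}" for x
    using that unfolding U_def by (rule if_not_P)
  show "U j s 0 = 0" "U j s 1 = 0"
    using Theta_0[OF s j] Theta_1[OF s j] sin_npi[of j] by (simp_all add: U_def psi_0)
  let ?u' = "\<lambda>x. J j s * s * cos (Theta j s x)" and ?u'' = "\<lambda>x. - ((J j s)\<^sup>2 * f (U j s x))"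
  have "(?u' has_real_derivative ?u'' x) (at x within {0..1})" if x: "x \<in> {0..1}" for x
  proof -
    let ?w = "s * sin (Theta j s x)"
    have w: "?w \<in> wset"
      using amp_wset[OF s Theta_in[OF s j x]] .
    have "(?u' has_real_derivative J j s * s * (- sin (Theta j s x) * (J j s / G ?w)))
        (at x within {0..1})"
      by (rule has_field_derivative_at_within)
        (auto intro!: derivative_eq_intros Theta_deriv[OF s j x])
    moreover have "f (psi ?w) = ?w / G ?w"
      using Phi_dPhi[OF psi_in[OF w]] Phi_psi[OF w] by (simp add: G_def)
    then have "J j s * s * (- sin (Theta j s x) * (J j s / G ?w)) = - ((J j s)\<^sup>2 * f (psi ?w))"
      by (simp add: power2_eq_square)
    then have "J j s * s * (- sin (Theta j s x) * (J j s / G ?w)) = ?u'' x"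
      using x by (simp only: U_eq)
    ultimately show ?thesis
      by simp
  qed
  moreover have "continuous_on {0..1} (U j s)"
    using U_deriv[OF s j] by (intro DERIV_continuous_on) blast
  then have "continuous_on {0..1} ?u''"
    by (intro continuous_intros continuous_on_compose2[OF f_cont]) auto
  ultimately show "\<exists>u' u''.
      (\<forall>x\<in>{0..1}. (U j s has_real_derivative u' x) (at x within {0..1})) \<and>
      (\<forall>x\<in>{0..1}. (u' has_real_derivative u'' x) (at x within {0..1})) \<and>
      continuous_on {0..1} u'' \<and> (\<forall>x\<in>{0<..<1}. - 1 * u'' x = (J j s)\<^sup>2 * f (U j s x))"
    using U_deriv[OF s j] by - (rule exI[of _ ?u'], rule exI[of _ ?u''], simp)
qed

lemma U_zero_iff:
  assumes s: "s \<in> amp j" "0 < s" and j: "1 \<le> j" and x: "x \<in> {0..1}"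
  shows "U j s x = 0 \<longleftrightarrow> sin (Theta j s x) = 0"
  using psi_sign[OF amp_wset[OF s(1) Theta_in[OF s(1) j x]]] s(2) x
  by (auto simp: U_eq sgn_0_0 psi_0 sgn_if split: if_splits)

text \<open>\<open>Theta\<close> carries the zeros bijectively to the angles \<open>i * pi\<close>
  with \<open>0 <= i <= j\<close>.\<close>

lemma U_card_zeros:
  assumes s: "s \<in> amp j" "0 < s" and j: "1 \<le> j"
  shows "card {x \<in> {0..1}. U j s x = 0} = j + 1"
proof -
  have "bij_betw (Theta j s) {x \<in> {0..1}. U j s x = 0} ((\<lambda>i. real i * pi) ` {..j})"
  proof (rule bij_betwI')
    fix x y
    show "Theta j s x = Theta j s y \<longleftrightarrow> x = y"
      using Theta_le_iff[OF s(1) j, of x y] Theta_le_iff[OF s(1) j, of y x] by auto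
  next
    fix x assume x: "x \<in> {x \<in> {0..1}. U j s x = 0}"
    then have "sin (Theta j s x) = 0" "Theta j s x \<in> {0..real j * pi}"
      using U_zero_iff[OF s j] Theta_in[OF s(1) j] by blast+
    then show "Theta j s x \<in> (\<lambda>i. real i * pi) ` {..j}"
      using sin_zero_iff_le[of "Theta j s x" j] by auto
  next
    fix t assume "t \<in> (\<lambda>i. real i * pi) ` {..j}"
    then obtain i where i: "i \<le> j" "t = real i * pi"
      by auto
    then have t: "t \<in> {0..real j * pi}" "sin t = 0"
      by (auto simp: mult_right_mono)
    define x where "x = prim (gs j s) t / J j s"
    have x: "Theta j s x = t"
      unfolding x_def by (rule Theta_prim[OF s(1) j])
    then have "x \<in> {0..1}"
      using Theta_le_iff[OF s(1) j, of 0 x] Theta_le_iff[OF s(1) j, of x 1]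
        Theta_0[OF s(1) j] Theta_1[OF s(1) j] t by simp
    then show "\<exists>x\<in>{x \<in> {0..1}. U j s x = 0}. t = Theta j s x"
      using x U_zero_iff[OF s j] t by (intro bexI[of _ x]) auto
  qed
  then have "card {x \<in> {0..1}. U j s x = 0} = card ((\<lambda>i. real i * pi) ` {..j})"
    by (rule bij_betw_same_card)
  also have "\<dots> = j + 1"
    by (subst card_image) (auto simp: inj_on_def)
  finally show ?thesis .
qed

lemma is_v_U:
  assumes s: "s \<in> amp j" "0 < s" and j: "1 \<le> j"
  shows "is_v f ((J j s)\<^sup>2) 1 j (U j s)"
  unfolding is_v_def
proof (intro conjI ballI impI)
  show "chafee_infante_solution f ((J j s)\<^sup>2) (U j s)"
    by (rule U_solution[OF s(1) j])
  show "card {x \<in> {0..1}. U j s x = 0} = j + 1"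
    by (rule U_card_zeros[OF s j])
  show "\<not> (U j s has_real_derivative 0) (at x within {0..1})" if x: "x \<in> {0..1}" "U j s x = 0" for x
  proof
    assume "(U j s has_real_derivative 0) (at x within {0..1})"
    then have "J j s * s * cos (Theta j s x) = 0"
      using real_derivative_unique_unit_interval[OF x(1)] U_deriv[OF s(1) j x(1)] by blast
    then have "cos (Theta j s x) = 0"
      using J_pos[OF s(1) j] s by simp
    moreover have "sin (Theta j s x) = 0"
      using U_zero_iff[OF s j x(1)] x by simp
    ultimately show False
      using sin_cos_squared_add[of "Theta j s x"] by simp
  qed
  \<comment> \<open>The position at which the first half turn is completed, hence the second
    zero.\<close>
  define z where "z = prim (gs j s) pi / J j s"
  have Theta_z: "Theta j s z = pi"
    unfolding z_def by (rule Theta_prim[OF s(1) j])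
  have z: "0 < z" "z \<le> 1"
    using Theta_le_iff[OF s(1) j, of z 0] Theta_le_iff[OF s(1) j, of z 1]
      Theta_0[OF s(1) j] Theta_1[OF s(1) j] Theta_z j pi_gt_zero by (auto simp: not_le[symmetric])
  have "U j s z = 0"
    using z Theta_z by (simp add: U_def psi_0)
  moreover have "0 < U j s x" if x: "x \<in> {0<..<z}" for x
  proof -
    have "0 < Theta j s x" "Theta j s x < pi"
      using Theta_le_iff[OF s(1) j, of x 0] Theta_le_iff[OF s(1) j, of z x]
        Theta_0[OF s(1) j] Theta_z x by auto
    then have "0 < s * sin (Theta j s x)"
      using s by (simp add: sin_gt_zero)
    moreover have "s * sin (Theta j s x) \<in> wset"
      using x z amp_wset[OF s(1) Theta_in[OF s(1) j]] by simp
    ultimately show ?thesis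
      using psi_pos x z by (simp add: U_eq)
  qed
  ultimately show "\<exists>z>0. z \<le> 1 \<and> U j s z = 0 \<and> (\<forall>x\<in>{0<..<z}. 0 < 1 * U j s x)"
    using z by auto
qed

end

section \<open>Every solution lies on a branch\<close>

lemma le_of_deriv_nonneg_within:
  fixes h :: "real \<Rightarrow> real"
  assumes "a \<le> b" "\<And>x. x \<in> {a..b} \<Longrightarrow> (h has_real_derivative h' x) (at x within {a..b})"
    "\<And>x. x \<in> {a..b} \<Longrightarrow> 0 \<le> h' x"
  shows "h a \<le> h b"
proof -
  have "(h' has_integral (h b - h a)) {a..b}"
    using assms by (intro fundamental_theorem_of_calculus)
      (auto simp: has_real_derivative_iff_has_vector_derivative)
  then have "0 \<le> h b - h a"
    by (rule has_integral_nonneg) (rule assms(3))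
  then show ?thesis
    by simp
qed

lemma constant_of_deriv_zero_within:
  fixes h :: "real \<Rightarrow> real"
  assumes "\<And>x. x \<in> {0..1} \<Longrightarrow> (h has_real_derivative 0) (at x within {0..1})" "x \<in> {0..1}" "y \<in> {0..1}"
  shows "h x = h y"
  using has_field_derivative_zero_constant[of "{0..1}" h] assms by (metis convex_real_interval(5))

lemma chafee_infante_solution_reflect:
  assumes "chafee_infante_solution f \<mu> u"
  shows "chafee_infante_solution (\<lambda>x. - f (- x)) \<mu> (\<lambda>x. - u x)"
proof -
  obtain u' u'' where "\<forall>x\<in>{0..1}. (u has_real_derivative u' x) (at x within {0..1})"
    "\<forall>x\<in>{0..1}. (u' has_real_derivative u'' x) (at x within {0..1})"
    "continuous_on {0..1} u''" "\<forall>x\<in>{0<..<1}. - 1 * u'' x = \<mu> * f (u x)"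
    using assms unfolding chafee_infante_solution_def dirichlet_solution_def by blast
  then have "\<forall>x\<in>{0..1}. ((\<lambda>x. - u x) has_real_derivative - u' x) (at x within {0..1})"
    "\<forall>x\<in>{0..1}. ((\<lambda>x. - u' x) has_real_derivative - u'' x) (at x within {0..1})"
    "continuous_on {0..1} (\<lambda>x. - u'' x)" "\<forall>x\<in>{0<..<1}. - 1 * - u'' x = \<mu> * - f (- (- u x))"
    by (auto intro: DERIV_minus continuous_on_minus)
  then show ?thesis
    using assms unfolding chafee_infante_solution_def dirichlet_solution_def by fastforce
qed

lemma is_v_reflect:
  assumes "is_v f \<mu> \<sigma> j u"
  shows "is_v (\<lambda>x. - f (- x)) \<mu> (- \<sigma>) j (\<lambda>x. - u x)"
proof -
  have D: "(u has_real_derivative 0) (at x within {0..1})"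
    if "((\<lambda>x. - u x) has_real_derivative 0) (at x within {0..1})" for x
    using DERIV_minus[OF that] by simp
  show ?thesis
    using assms chafee_infante_solution_reflect D unfolding is_v_def by fastforce
qed

context ci_nonlin
begin

text \<open>The equation is given on the open interval; continuity of \<open>u''\<close> and of
  \<open>f\<close> along \<open>u\<close> carries it to the end points, where the later derivative
  arguments use it one-sidedly.\<close>

lemma chafee_infante_solutionE:
  assumes "chafee_infante_solution f \<mu> u"
  obtains u' where "\<And>x. x \<in> {0..1} \<Longrightarrow> (u has_real_derivative u' x) (at x within {0..1})"
    "\<And>x. x \<in> {0..1} \<Longrightarrow> (u' has_real_derivative - (\<mu> * f (u x))) (at x within {0..1})"
    "u 0 = 0" "u 1 = 0" "\<And>x. x \<notin> {0..1} \<Longrightarrow> u x = 0"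
proof -
  obtain u' u'' where u: "\<forall>x\<in>{0..1}. (u has_real_derivative u' x) (at x within {0..1})"
    "\<forall>x\<in>{0..1}. (u' has_real_derivative u'' x) (at x within {0..1})"
    "continuous_on {0..1} u''" "\<forall>x\<in>{0<..<1}. - 1 * u'' x = \<mu> * f (u x)"
    and u0: "u 0 = 0" "u 1 = 0" "\<And>x. x \<notin> {0..1} \<Longrightarrow> u x = 0"
    using assms unfolding chafee_infante_solution_def dirichlet_solution_def by blast
  have "continuous_on {0..1} u"
    using u(1) by (intro DERIV_continuous_on) blast
  then have "continuous_on {0..1} (\<lambda>x. u'' x + \<mu> * f (u x))"
    by (intro continuous_intros u(3) continuous_on_compose2[OF f_cont]) auto
  then have c: "continuous_on (closure {0<..<1}) (\<lambda>x. u'' x + \<mu> * f (u x))"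
    by simp
  have "u'' x + \<mu> * f (u x) = 0" if "x \<in> {0..1}" for x
  proof (rule continuous_constant_on_closure[OF c])
    show "u'' y + \<mu> * f (u y) = 0" if "y \<in> {0<..<1}" for y
      using bspec[OF u(4) that] by linarith
  qed (use that in simp)
  then have "u'' x = - (\<mu> * f (u x))" if "x \<in> {0..1}" for x
    using that by (simp add: eq_neg_iff_add_eq_0)
  then show ?thesis
    using that[of u'] u u0 by metis
qed

text \<open>Between \<open>0\<close> and \<open>M\<close> concavity gives the bound. For
  \<open>x <= 0\<close> compactness bounds \<open>f\<close> by a constant, which is at most a
  multiple of \<open>M - x\<close> because \<open>M - x >= M\<close>.\<close>

lemma f_le_linear:
  assumes M: "f M = 0" "0 < M"
  shows "\<exists>C>0. \<forall>x\<in>{b..M}. f x \<le> C * (M - x)"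
proof -
  have "compact {min b 0..0}" "{min b 0..0} \<noteq> {}"
    by auto
  then obtain y where y: "\<forall>x\<in>{min b 0..0}. f x \<le> f y"
    using continuous_attains_sup[of "{min b 0..0}" f] continuous_on_subset[OF f_cont] by blast
  define C where "C = \<bar>f (M + 1)\<bar> + \<bar>f y\<bar> / M + 1"
  have C: "0 < C" "\<bar>f (M + 1)\<bar> \<le> C" "\<bar>f y\<bar> / M \<le> C"
    using M by (auto simp: C_def add_nonneg_pos)
  have "f x \<le> C * (M - x)" if x: "x \<in> {b..M}" for x
  proof -
    consider "x \<le> 0" | "0 < x" "x < M" | "x = M"
      using x by force
    then show ?thesis
    proof cases
      case 1
      then have "f x \<le> f y"
        using y x by simp
      then have "f x \<le> \<bar>f y\<bar>"
        by simp
      also have "\<dots> = \<bar>f y\<bar> / M * M"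
        using M by simp
      also have "\<dots> \<le> C * (M - x)"
        using C 1 M by (intro mult_mono) auto
      finally show ?thesis .
    next
      case 2
      then have "f x \<le> - f (M + 1) * (M - x)"
        by (rule f_le_near_zero[OF M(1)])
      also have "\<dots> \<le> C * (M - x)"
        using C 2 by (intro mult_right_mono) auto
      finally show ?thesis .
    qed (use M in simp)
  qed
  then show ?thesis
    using C(1) by blast
qed

text \<open>At a maximum with \<open>f < 0\<close> the second derivative would be positive. If
  \<open>f\<close> vanishes there, conservation of energy gives \<open>u' <= k * (u x0 - u)\<close>:
  the gap to the maximum shrinks at most exponentially and cannot close at
  \<open>x0\<close>.\<close>

lemma max_in_uset:
  assumes sol: "chafee_infante_solution f \<mu> u" and \<mu>: "0 < \<mu>"
    and x0: "x0 \<in> {0..1}" and max: "\<And>x. x \<in> {0..1} \<Longrightarrow> u x \<le> u x0" and pos: "0 < u x0"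
  shows "u x0 \<in> uset"
proof (rule ccontr)
  assume notin: "u x0 \<notin> uset"
  obtain u' where u': "\<And>x. x \<in> {0..1} \<Longrightarrow> (u has_real_derivative u' x) (at x within {0..1})"
    and u'': "\<And>x. x \<in> {0..1} \<Longrightarrow> (u' has_real_derivative - (\<mu> * f (u x))) (at x within {0..1})"
    and bdry: "u 0 = 0" "u 1 = 0"
    using chafee_infante_solutionE[OF sol] by metis
  have x0': "0 < x0" "x0 < 1"
    using x0 bdry pos by (auto simp: less_le)
  have at: "at x within {0..1} = at x" if "0 < x" "x < 1" for x :: real
    using that by (rule at_within_Icc_at)
  have "u' x0 = 0"
  proof (rule DERIV_local_max)
    show "(u has_real_derivative u' x0) (at x0)"
      using u'[OF x0] at[OF x0'] by simp
    show "0 < min x0 (1 - x0)"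
      using x0' by simp
    show "\<forall>y. \<bar>x0 - y\<bar> < min x0 (1 - x0) \<longrightarrow> u y \<le> u x0"
      using max by (auto simp: abs_less_iff)
  qed
  have "0 \<le> f (u x0)"
  proof (rule ccontr)
    assume "\<not> 0 \<le> f (u x0)"
    then have "0 < - (\<mu> * f (u x0))"
      using \<mu> by (simp add: mult_less_0_iff)
    then obtain d where d: "0 < d" "\<And>h. 0 < h \<Longrightarrow> x0 + h \<in> {0..1} \<Longrightarrow> h < d \<Longrightarrow> u' x0 < u' (x0 + h)"
      using has_real_derivative_pos_inc_right[OF u''[OF x0]] by blast
    define e where "e = min (d / 2) ((1 - x0) / 2)"
    have e: "0 < e" "e < d" "x0 + e < 1"
      using d x0' by (auto simp: e_def min_def field_simps)
    have "u x0 < u (x0 + e)"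
    proof (rule DERIV_pos_imp_increasing_open[where f = u])
      fix x assume x: "x0 < x" "x < x0 + e"
      then have "0 < u' x"
        using d(2)[of "x - x0"] e x0' \<open>u' x0 = 0\<close> by simp
      then show "\<exists>y. (u has_real_derivative y) (at x) \<and> 0 < y"
        using u'[of x] at[of x] x x0' e by auto
    next
      have "continuous_on {0..1} u"
        using u' by (rule DERIV_continuous_on)
      then show "continuous_on {x0..x0 + e} u"
        by (rule continuous_on_subset) (use x0' e in auto)
    qed (use e in simp)
    then show False
      using max[of "x0 + e"] x0' e by simp
  qed
  then have fM: "f (u x0) = 0"
    using notin pos uset_pos_iff by force
  have cont: "continuous_on {0..1} u"
    using u' by (rule DERIV_continuous_on)
  obtain x1 where x1: "x1 \<in> {0..1}" "\<And>x. x \<in> {0..1} \<Longrightarrow> u x1 \<le> u x"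
    using continuous_attains_inf[OF _ _ cont] by auto
  obtain C where C: "0 < C" "\<And>v. v \<in> {u x1..u x0} \<Longrightarrow> f v \<le> C * (u x0 - v)"
    using f_le_linear[OF fM pos] by blast
  define E where "E = (\<lambda>x. (u' x)\<^sup>2 + 2 * \<mu> * pot (u x))"
  have "(E has_real_derivative 0) (at x within {0..1})" if x: "x \<in> {0..1}" for x
  proof -
    have "((\<lambda>x. pot (u x)) has_real_derivative f (u x) * u' x) (at x within {0..1})"
      by (rule DERIV_chain2[where f = pot, OF pot_deriv u'[OF x]])
    then show ?thesis
      unfolding E_def by (auto intro!: derivative_eq_intros u''[OF x] simp: algebra_simps)
  qed
  then have E: "E x = E x0" if "x \<in> {0..1}" for x
    using constant_of_deriv_zero_within that x0 by blast
  define k where "k = sqrt (\<mu> * C)"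
  have k: "0 \<le> k" "k\<^sup>2 = \<mu> * C"
    using \<mu> C by (auto simp: k_def)
  have u'_le: "u' x \<le> k * (u x0 - u x)" if x: "x \<in> {0..1}" for x
  proof (rule power2_le_imp_le)
    let ?v = "u x" and ?M = "u x0"
    have v: "u x1 \<le> ?v" "?v \<le> ?M"
      using x1 max x by auto
    have "pot ?M - pot ?v \<le> (- C * (?M - ?M)\<^sup>2 / 2) - (- C * (?M - ?v)\<^sup>2 / 2)"
    proof (rule le_of_deriv_le)
      fix y assume y: "?v \<le> y" "y \<le> ?M"
      show "((\<lambda>y. - C * (?M - y)\<^sup>2 / 2) has_real_derivative C * (?M - y)) (at y)"
        by (auto intro!: derivative_eq_intros simp: field_simps)
      show "f y \<le> C * (?M - y)"
        using C(2) y v by simp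
    qed (use v pot_deriv in auto)
    then have "2 * (pot ?M - pot ?v) \<le> C * (?M - ?v)\<^sup>2"
      by simp
    then have "\<mu> * (2 * (pot ?M - pot ?v)) \<le> \<mu> * (C * (?M - ?v)\<^sup>2)"
      using \<mu> by (intro mult_left_mono) auto
    moreover have "(u' x)\<^sup>2 = \<mu> * (2 * (pot ?M - pot ?v))"
      using E[OF x] \<open>u' x0 = 0\<close> by (simp add: E_def algebra_simps)
    moreover have "(k * (?M - ?v))\<^sup>2 = \<mu> * (C * (?M - ?v)\<^sup>2)"
      by (simp add: power_mult_distrib k(2))
    ultimately show "(u' x)\<^sup>2 \<le> (k * (?M - ?v))\<^sup>2"
      by simp
    show "0 \<le> k * (?M - ?v)"
      using k v by simp
  qed
  \<comment> \<open>With the integrating factor \<open>exp (k * x)\<close> the gap is nondecreasing,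
    yet it is positive at \<open>0\<close> and zero at \<open>x0\<close>.\<close>
  have "(u x0 - u 0) * exp (k * 0) \<le> (u x0 - u x0) * exp (k * x0)"
  proof (rule le_of_deriv_nonneg_within[where h = "\<lambda>x. (u x0 - u x) * exp (k * x)"])
    fix x assume "x \<in> {0..x0}"
    then have x: "x \<in> {0..1}"
      using x0 by simp
    have "((\<lambda>x. (u x0 - u x) * exp (k * x)) has_real_derivative
        (- u' x + k * (u x0 - u x)) * exp (k * x)) (at x within {0..1})"
      by (auto intro!: derivative_eq_intros u'[OF x] simp: algebra_simps)
    then show "((\<lambda>x. (u x0 - u x) * exp (k * x)) has_real_derivative
        (- u' x + k * (u x0 - u x)) * exp (k * x)) (at x within {0..x0})"
      by (rule DERIV_subset) (use x0 in auto)
    show "0 \<le> (- u' x + k * (u x0 - u x)) * exp (k * x)"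
      using u'_le[OF x] by simp
  qed (use x0 in simp)
  then show False
    using pos bdry by simp
qed

end

context ci_nonlin
begin

interpretation R: ci_nonlin "\<lambda>x. - f (- x)"
  by (rule reflect)

text \<open>The maximum and, by reflection, the minimum lie in \<open>uset\<close>; since
  \<open>uset\<close> is an interval, so does the whole range. This makes the phase coordinates
  available along every solution.\<close>

lemma solution_in_uset:
  assumes sol: "chafee_infante_solution f \<mu> u" and \<mu>: "0 < \<mu>" and x: "x \<in> {0..1}"
  shows "u x \<in> uset"
proof -
  obtain u' where u': "\<And>x. x \<in> {0..1} \<Longrightarrow> (u has_real_derivative u' x) (at x within {0..1})"
    and bdry: "u 0 = 0"
    using chafee_infante_solutionE[OF sol] by metis
  have cont: "continuous_on {0..1} u"
    using u' by (rule DERIV_continuous_on)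
  obtain x0 where x0: "x0 \<in> {0..1}" "\<And>x. x \<in> {0..1} \<Longrightarrow> u x \<le> u x0"
    using continuous_attains_sup[OF _ _ cont] by auto
  obtain x1 where x1: "x1 \<in> {0..1}" "\<And>x. x \<in> {0..1} \<Longrightarrow> u x1 \<le> u x"
    using continuous_attains_inf[OF _ _ cont] by auto
  have "u x0 \<in> uset"
    using max_in_uset[OF sol \<mu> x0] x0(2)[of 0] bdry uset_0 by (cases "u x0 = 0") auto
  moreover have "- u x1 \<in> R.uset"
    using R.max_in_uset[OF chafee_infante_solution_reflect[OF sol] \<mu> x1(1)] x1(2) x1(2)[of 0] bdry R.uset_0
    by (cases "u x1 = 0") auto
  ultimately show ?thesis
    using uset_between[of "u x1" "u x0" "u x"] x0(2) x1(2) x reflect_uset by auto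
qed

text \<open>In the coordinates \<open>(Phi u, u' / sqrt \<mu>)\<close> the equation is a rotation with angular
  velocity \<open>sqrt \<mu> * dPhi u\<close>.\<close>

lemma phase_plane:
  assumes sol: "chafee_infante_solution f \<mu> u" and \<mu>: "0 < \<mu>"
    and c: "(u has_real_derivative c) (at 0 within {0..1})"
  obtains \<theta> where "\<theta> 0 = 0" "\<theta> 0 < \<theta> 1"
    "\<And>x. x \<in> {0..1} \<Longrightarrow> (\<theta> has_real_derivative sqrt \<mu> * dPhi (u x)) (at x within {0..1})"
    "\<And>x. x \<in> {0..1} \<Longrightarrow> Phi (u x) = c / sqrt \<mu> * sin (\<theta> x)"
proof -
  obtain u' where u': "\<And>x. x \<in> {0..1} \<Longrightarrow> (u has_real_derivative u' x) (at x within {0..1})"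
    and u'': "\<And>x. x \<in> {0..1} \<Longrightarrow> (u' has_real_derivative - (\<mu> * f (u x))) (at x within {0..1})"
    and bdry: "u 0 = 0"
    using chafee_infante_solutionE[OF sol] by metis
  have c_eq: "u' 0 = c"
    using real_derivative_unique_unit_interval[OF _ u' c] by simp
  define r where "r = sqrt \<mu>"
  have r: "0 < r" "r * r = \<mu>"
    using \<mu> by (auto simp: r_def)
  have uset: "u x \<in> uset" if "x \<in> {0..1}" for x
    using solution_in_uset[OF sol \<mu> that] .
  have cont: "continuous_on {0..1} u"
    using u' by (rule DERIV_continuous_on)
  define D where "D = (\<lambda>x. dPhi (u (max 0 (min x 1))))"
  have D_eq: "D x = dPhi (u x)" if "x \<in> {0..1}" for x
    using that by (simp add: D_def)
  have D_pos: "0 < D x" for x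
    unfolding D_def by (intro dPhi_pos uset) simp
  have D_cont: "continuous_on UNIV D"
    unfolding D_def
  proof (rule continuous_on_compose2[of uset dPhi])
    show "continuous_on uset dPhi"
      using isCont_dPhi by (simp add: continuous_at_imp_continuous_on)
    show "continuous_on UNIV (\<lambda>x. u (max 0 (min x 1)))"
      by (rule continuous_on_compose2[OF cont]) (auto intro!: continuous_intros)
    show "(\<lambda>x. u (max 0 (min x 1))) ` UNIV \<subseteq> uset"
      using uset by auto
  qed
  define \<theta> where "\<theta> = (\<lambda>x. r * prim D x)"
  have \<theta>0: "\<theta> 0 = 0"
    by (simp add: \<theta>_def prim_0[OF D_cont])
  have \<theta>1: "\<theta> 0 < \<theta> 1"
  proof (rule DERIV_pos_imp_increasing[where f = \<theta>])
    fix x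
    show "\<exists>y. (\<theta> has_real_derivative y) (at x) \<and> 0 < y"
      unfolding \<theta>_def using DERIV_cmult[OF prim_deriv[OF D_cont]] D_pos r
      by (intro exI[of _ "r * D x"]) auto
  qed simp
  have \<theta>': "(\<theta> has_real_derivative r * dPhi (u x)) (at x within {0..1})" if "x \<in> {0..1}" for x
    unfolding \<theta>_def D_eq[OF that, symmetric]
    by (rule has_field_derivative_at_within[OF DERIV_cmult[OF prim_deriv[OF D_cont]]])
  \<comment> \<open>The phase point \<open>(Phi u, u' / r)\<close> rotated back by the angle
    \<open>\<theta>\<close>. Both components turn out constant: \<open>A\<close> is 0 and
    \<open>B\<close> is the amplitude \<open>c / r\<close>.\<close>
  define A where "A = (\<lambda>x. Phi (u x) * cos (\<theta> x) - u' x / r * sin (\<theta> x))"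
  define B where "B = (\<lambda>x. Phi (u x) * sin (\<theta> x) + u' x / r * cos (\<theta> x))"
  have P': "((\<lambda>x. Phi (u x)) has_real_derivative dPhi (u x) * u' x) (at x within {0..1})"
    if "x \<in> {0..1}" for x
    by (rule DERIV_chain2[where f = Phi, OF Phi_deriv[OF uset[OF that]] u'[OF that]])
  have Q': "((\<lambda>x. u' x / r) has_real_derivative - r * (Phi (u x) * dPhi (u x))) (at x within {0..1})"
    if "x \<in> {0..1}" for x
  proof -
    have "- (\<mu> * f (u x)) / r = - r * (Phi (u x) * dPhi (u x))"
      using r Phi_dPhi[OF uset[OF that]] by (simp add: field_simps flip: r(2))
    then show ?thesis
      using DERIV_cdivide[OF u''[OF that], of r] by simp
  qed
  have sin': "((\<lambda>x. sin (\<theta> x)) has_real_derivative cos (\<theta> x) * (r * dPhi (u x))) (at x within {0..1})"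
    and cos': "((\<lambda>x. cos (\<theta> x)) has_real_derivative - sin (\<theta> x) * (r * dPhi (u x))) (at x within {0..1})"
    if "x \<in> {0..1}" for x
    by (rule DERIV_chain2[OF DERIV_sin \<theta>'[OF that]], rule DERIV_chain2[OF DERIV_cos \<theta>'[OF that]])
  have "(A has_real_derivative 0) (at x within {0..1})" if "x \<in> {0..1}" for x
    unfolding A_def
    by (rule DERIV_cong[OF DERIV_diff[OF DERIV_mult[OF P'[OF that] cos'[OF that]]
          DERIV_mult[OF Q'[OF that] sin'[OF that]]]])
      (use r in \<open>simp add: algebra_simps\<close>)
  then have A: "A x = 0" if "x \<in> {0..1}" for x
    using constant_of_deriv_zero_within[of A x 0] that by (simp add: A_def \<theta>0 bdry Phi_0)
  have "(B has_real_derivative 0) (at x within {0..1})" if "x \<in> {0..1}" for x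
    unfolding B_def
    by (rule DERIV_cong[OF DERIV_add[OF DERIV_mult[OF P'[OF that] sin'[OF that]]
          DERIV_mult[OF Q'[OF that] cos'[OF that]]]])
      (use r in \<open>simp add: algebra_simps\<close>)
  then have B: "B x = c / r" if "x \<in> {0..1}" for x
    using constant_of_deriv_zero_within[of B x 0] that by (simp add: B_def \<theta>0 bdry Phi_0 c_eq)
  have "Phi (u x) = B x * sin (\<theta> x) + A x * cos (\<theta> x)" for x
  proof -
    have "B x * sin (\<theta> x) + A x * cos (\<theta> x) = Phi (u x) * ((sin (\<theta> x))\<^sup>2 + (cos (\<theta> x))\<^sup>2)"
    proof -
      have "(p * s + q * c) * s + (p * c - q * s) * c = p * (s\<^sup>2 + c\<^sup>2)" for p q s c :: real
        by (simp add: algebra_simps power2_eq_square)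
      then show ?thesis
        unfolding A_def B_def .
    qed
    then show ?thesis
      by simp
  qed
  then have "Phi (u x) = c / r * sin (\<theta> x)" if "x \<in> {0..1}" for x
    using A B that by simp
  then show ?thesis
    using that[of \<theta>] \<theta>0 \<theta>1 \<theta>' by (simp add: r_def)
qed

lemma solution_zero:
  assumes sol: "chafee_infante_solution f \<mu> u" and \<mu>: "0 < \<mu>"
    and c: "(u has_real_derivative 0) (at 0 within {0..1})"
  shows "u = (\<lambda>x. 0)"
proof
  fix x
  show "u x = 0"
  proof (cases "x \<in> {0..1}")
    case True
    obtain \<theta> where "\<And>x. x \<in> {0..1} \<Longrightarrow> Phi (u x) = 0 / sqrt \<mu> * sin (\<theta> x)"
      by (rule phase_plane[OF sol \<mu> c]) blast
    then have "Phi (u x) = 0"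
      using True by simp
    then show ?thesis
      using Phi_nonzero solution_in_uset[OF sol \<mu> True] by blast
  next
    case False
    then show ?thesis
      using chafee_infante_solutionE[OF sol] by metis
  qed
qed

text \<open>The amplitude is \<open>c / sqrt \<mu>\<close>, and \<open>u 1 = 0\<close> forces the
  final angle to be a multiple \<open>j * pi\<close>. Elapsed time, as a function of the angle, is
  then the one inverted by \<open>Theta\<close>, so the two angles coincide.\<close>

lemma solution_form:
  assumes sol: "chafee_infante_solution f \<mu> u" and \<mu>: "0 < \<mu>"
    and c: "(u has_real_derivative c) (at 0 within {0..1})" "0 < c"
  shows "\<exists>j\<ge>1. \<exists>s\<in>amp j. 0 < s \<and> \<mu> = (J j s)\<^sup>2 \<and> u = U j s"
proof -
  obtain \<theta> where \<theta>0: "\<theta> 0 = 0" and \<theta>1: "\<theta> 0 < \<theta> 1"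
    and \<theta>': "\<And>x. x \<in> {0..1} \<Longrightarrow> (\<theta> has_real_derivative sqrt \<mu> * dPhi (u x)) (at x within {0..1})"
    and Phi_u: "\<And>x. x \<in> {0..1} \<Longrightarrow> Phi (u x) = c / sqrt \<mu> * sin (\<theta> x)"
    by (rule phase_plane[OF sol \<mu> c(1)]) blast
  have bdry: "u 1 = 0" "\<And>x. x \<notin> {0..1} \<Longrightarrow> u x = 0"
    using chafee_infante_solutionE[OF sol] by metis+
  define s where "s = c / sqrt \<mu>"
  have s: "0 < s"
    using c \<mu> by (simp add: s_def)
  have "sin (\<theta> 1) = 0"
    using Phi_u[of 1] bdry s Phi_0 by (simp flip: s_def)
  then obtain n where n: "even n" "\<theta> 1 = real n * (pi / 2)"
    using sin_zero_lemma[of "\<theta> 1"] \<theta>0 \<theta>1 by auto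
  then obtain j where "n = 2 * j"
    by blast
  then have j: "\<theta> 1 = real j * pi"
    using n by simp
  then have j1: "1 \<le> j"
    using \<theta>0 \<theta>1 by (cases j) auto
  have cont: "continuous_on {0..1} \<theta>"
    using \<theta>' by (rule DERIV_continuous_on)
  \<comment> \<open>By continuity every angle up to \<open>j * pi\<close> is attained, and there
    \<open>s * sin t\<close> equals \<open>Phi (u x)\<close> with \<open>u x\<close> in
    \<open>uset\<close>.\<close>
  have amp: "s \<in> amp j"
    unfolding amp_def
  proof (intro CollectI conjI ballI)
    fix t assume "t \<in> {0..real j * pi}"
    then obtain x where x: "x \<in> {0..1}" "\<theta> x = t"
      using IVT'[of \<theta> 0 t 1] cont \<theta>0 j by auto
    then have "s * sin t = Phi (u x)"
      using Phi_u by (simp add: s_def)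
    then show "s * sin t \<in> wset"
      using solution_in_uset[OF sol \<mu> x(1)] by (simp add: wset_def)
  qed (use s in simp)
  have mono: "\<theta> x \<le> \<theta> y" if "x \<in> {0..1}" "y \<in> {0..1}" "x \<le> y" for x y
  proof (rule le_of_deriv_nonneg_within[OF that(3)])
    fix z assume "z \<in> {x..y}"
    then have z: "z \<in> {0..1}"
      using that by simp
    show "(\<theta> has_real_derivative sqrt \<mu> * dPhi (u z)) (at z within {x..y})"
      using \<theta>'[OF z] by (rule DERIV_subset) (use that in auto)
    show "0 \<le> sqrt \<mu> * dPhi (u z)"
      using dPhi_pos[OF solution_in_uset[OF sol \<mu> z]] \<mu> by simp
  qed
  then have \<theta>_in: "\<theta> x \<in> {0..real j * pi}" if "x \<in> {0..1}" for x
    using mono[of 0 x] mono[of x 1] that \<theta>0 j by simp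
  note g = continuous_gs[OF amp] gs_ge_1[OF amp]
  have "((\<lambda>x. prim (gs j s) (\<theta> x) - sqrt \<mu> * x) has_real_derivative 0) (at x within {0..1})"
    if x: "x \<in> {0..1}" for x
  proof -
    have u: "u x \<in> uset"
      using solution_in_uset[OF sol \<mu> x] .
    have "gs j s (\<theta> x) = G (Phi (u x))"
      using gs_eq[OF \<theta>_in[OF x]] Phi_u[OF x] by (simp add: s_def)
    also have "\<dots> = 1 / dPhi (u x)"
      using psi_Phi[OF u] by (simp add: G_def)
    finally have "gs j s (\<theta> x) * (sqrt \<mu> * dPhi (u x)) - sqrt \<mu> * 1 = 0"
      using dPhi_pos[OF u] by simp
    moreover have "((\<lambda>x. prim (gs j s) (\<theta> x) - sqrt \<mu> * x) has_real_derivative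
        gs j s (\<theta> x) * (sqrt \<mu> * dPhi (u x)) - sqrt \<mu> * 1) (at x within {0..1})"
      by (intro DERIV_diff DERIV_cmult DERIV_ident
          DERIV_chain2[where f = "prim (gs j s)"] prim_deriv[OF g(1)] \<theta>' x)
    ultimately show ?thesis
      by (simp only:)
  qed
  then have X: "prim (gs j s) (\<theta> x) = sqrt \<mu> * x" if "x \<in> {0..1}" for x
    using constant_of_deriv_zero_within[of "\<lambda>x. prim (gs j s) (\<theta> x) - sqrt \<mu> * x" x 0] that
      \<theta>0 prim_0[OF g(1)] by simp
  have J: "J j s = sqrt \<mu>"
    using X[of 1] prim_gs_end[OF amp] j by simp
  have "Theta j s x = \<theta> x" if "x \<in> {0..1}" for x
    using inv_prim_prim[OF g, of "\<theta> x"] X[OF that] J by (simp add: Theta_def)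
  then have "U j s x = psi (Phi (u x))" if "x \<in> {0..1}" for x
    using that Phi_u by (simp add: U_eq s_def)
  then have "U j s x = u x" if "x \<in> {0..1}" for x
    using psi_Phi[OF solution_in_uset[OF sol \<mu> that]] that by simp
  then have "u = U j s"
    using bdry(2) by (intro ext) (metis U_def)
  then show ?thesis
    using J s amp j1 \<mu> by (intro exI[of _ j] conjI bexI[of _ s]) auto
qed

text \<open>At the left end simplicity of the zero excludes slope 0 and positivity next to it
  excludes a negative slope, so \<open>solution_form\<close> applies; counting zeros identifies the
  index.\<close>

lemma is_v_iff:
  assumes \<mu>: "0 < \<mu>" and j: "1 \<le> j"
  shows "is_v f \<mu> 1 j u \<longleftrightarrow> (\<exists>s\<in>amp j. 0 < s \<and> \<mu> = (J j s)\<^sup>2 \<and> u = U j s)"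
proof
  assume v: "is_v f \<mu> 1 j u"
  then have sol: "chafee_infante_solution f \<mu> u"
    and simple: "\<forall>x\<in>{0..1}. u x = 0 \<longrightarrow> \<not> (u has_real_derivative 0) (at x within {0..1})"
    by (auto simp: is_v_def)
  obtain z where z: "0 < z" "z \<le> 1" "\<And>x. x \<in> {0<..<z} \<Longrightarrow> 0 < u x"
    using v by (auto simp: is_v_def)
  obtain c where c: "(u has_real_derivative c) (at 0 within {0..1})" and u0: "u 0 = 0"
    using chafee_infante_solutionE[OF sol] by (metis atLeastAtMost_iff order_refl zero_le_one)
  have "c \<noteq> 0"
    using simple c u0 by auto
  moreover have "\<not> c < 0"
  proof
    assume "c < 0"
    then obtain d where d: "0 < d" "\<And>h. 0 < h \<Longrightarrow> 0 + h \<in> {0..1} \<Longrightarrow> h < d \<Longrightarrow> u (0 + h) < u 0"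
      using has_real_derivative_neg_dec_right[OF c] by blast
    define h where "h = min (d / 2) (z / 2)"
    have "0 < h" "h < d" "h < z" "h \<le> 1"
      using d(1) z(1,2) by (auto simp: h_def min_less_iff_disj)
    then show False
      using d(2)[of h] z(3)[of h] u0 by simp
  qed
  ultimately obtain i s where i: "1 \<le> i" "s \<in> amp i" "0 < s" "\<mu> = (J i s)\<^sup>2" "u = U i s"
    using solution_form[OF sol \<mu> c] by force
  moreover have "i = j"
    using U_card_zeros[OF i(2,3,1)] v i(5) by (simp add: is_v_def)
  ultimately show "\<exists>s\<in>amp j. 0 < s \<and> \<mu> = (J j s)\<^sup>2 \<and> u = U j s"
    by blast
qed (use is_v_U j in auto)

end

context ci_nonlin
begin

interpretation R: ci_nonlin "\<lambda>x. - f (- x)"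
  by (rule reflect)

lemma solution_cases:
  assumes sol: "chafee_infante_solution f \<mu> u" and \<mu>: "0 < \<mu>"
  shows "u = (\<lambda>x. 0) \<or> (\<exists>j\<ge>1. \<exists>\<sigma>\<in>{1, -1}. is_v f \<mu> \<sigma> j u)"
proof -
  obtain c where c: "(u has_real_derivative c) (at 0 within {0..1})"
    using chafee_infante_solutionE[OF sol] by (metis atLeastAtMost_iff order_refl zero_le_one)
  consider "c = 0" | "0 < c" | "c < 0"
    by linarith
  then show ?thesis
  proof cases
    case 1
    then show ?thesis
      using solution_zero[OF sol \<mu>] c by simp
  next
    case 2
    then obtain j s where "1 \<le> j" "s \<in> amp j" "0 < s" "\<mu> = (J j s)\<^sup>2" "u = U j s"
      using solution_form[OF sol \<mu> c] by blast
    then show ?thesis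
      using is_v_U by blast
  next
    case 3
    then have "0 < - c"
      by simp
    then obtain j s where "1 \<le> j" "s \<in> R.amp j" "0 < s" "\<mu> = (R.J j s)\<^sup>2" "(\<lambda>x. - u x) = R.U j s"
      using R.solution_form[OF chafee_infante_solution_reflect[OF sol] \<mu> DERIV_minus[OF c]] by blast
    then have "is_v (\<lambda>x. - f (- x)) \<mu> 1 j (\<lambda>x. - u x)" "1 \<le> j"
      using R.is_v_U by metis+
    then show ?thesis
      using is_v_reflect[of "\<lambda>x. - f (- x)" \<mu> 1 j "\<lambda>x. - u x"] by auto
  qed
qed

end

section \<open>Norms along the branches\<close>

lemma set_lebesgue_open_unit_cong:
  fixes g h :: "real \<Rightarrow> real"
  assumes "\<And>x. x \<in> {0<..<1} \<Longrightarrow> g x = h x"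
  shows "(LINT x:{0<..<1}|lborel. g x) = (LINT x:{0<..<1}|lborel. h x)"
  using assms by (intro set_lebesgue_integral_cong) auto

lemma H01_norm_eq:
  assumes "\<And>x. x \<in> {0..1} \<Longrightarrow> (u has_real_derivative u' x) (at x within {0..1})"
    "continuous_on {0..1} u'"
  shows "H01_norm u = sqrt (integral {0..1} (\<lambda>x. (u' x)\<^sup>2))"
proof -
  have "deriv u x = u' x" if "x \<in> {0<..<1}" for x
    using assms(1)[of x] at_within_Icc_at[of 0 x 1] that by (auto intro: DERIV_imp_deriv)
  then have "(LINT x:{0<..<1}|lborel. (deriv u x)\<^sup>2) = (LINT x:{0<..<1}|lborel. (u' x)\<^sup>2)"
    by (intro set_lebesgue_open_unit_cong) simp
  also have "\<dots> = integral {0..1} (\<lambda>x. (u' x)\<^sup>2)"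
    using assms(2) by (intro set_lborel_integral_open_interval continuous_intros)
  finally show ?thesis
    by (simp add: H01_norm_def)
qed

lemma Lq_norm_eq:
  assumes "continuous_on {0..1} u" "1 \<le> q"
  shows "Lq_norm q u = (integral {0..1} (\<lambda>x. \<bar>u x\<bar> powr q)) powr (1 / q)"
proof -
  have "continuous_on {0..1} (\<lambda>x. \<bar>u x\<bar> powr q)"
    using assms by (intro continuous_on_powr' continuous_intros) auto
  then show ?thesis
    by (simp add: Lq_norm_def set_lborel_integral_open_interval)
qed

lemma continuous_on_powr_const:
  fixes g :: "'a::topological_space \<Rightarrow> real"
  assumes "continuous_on S g" "\<And>x. x \<in> S \<Longrightarrow> 0 \<le> g x" "0 < r"
  shows "continuous_on S (\<lambda>x. g x powr r)"
  using assms by (intro continuous_on_powr' continuous_intros) auto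

context ci_nonlin
begin

text \<open>Change of variables from position to angle,
  \<open>dx = G (s * sin t) dt / J j s\<close>. A primitive of the clamped integrand composed with
  \<open>Theta\<close> is an antiderivative of the left-hand integrand, up to the factor
  \<open>J j s\<close>.\<close>

lemma integral_Theta:
  assumes s: "s \<in> amp j" and j: "1 \<le> j" and k: "continuous_on {0..real j * pi} k"
  shows "integral {0..1} (\<lambda>x. k (Theta j s x)) =
    integral {0..real j * pi} (\<lambda>t. k t * G (s * sin t)) / J j s"
proof -
  define h where "h = (\<lambda>t. k (max 0 (min t (real j * pi))) * gs j s t)"
  have h: "continuous_on UNIV h"
    unfolding h_def
    by (intro continuous_on_mult continuous_gs[OF s] continuous_on_compose2[OF k])
      (auto intro!: continuous_intros)
  have h_eq: "h t = k t * G (s * sin t)" if "t \<in> {0..real j * pi}" for t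
    using that gs_eq by (simp add: h_def)
  have "integral {0..1} (\<lambda>x. J j s * k (Theta j s x)) =
      prim h (Theta j s 1) - prim h (Theta j s 0)"
  proof (rule integral_eq_diffI)
    fix x :: real assume x: "x \<in> {0..1}"
    let ?t = "Theta j s x"
    have "((\<lambda>x. prim h (Theta j s x)) has_real_derivative h ?t * (J j s / gs j s ?t)) (at x within {0..1})"
      by (rule has_field_derivative_at_within)
        (rule DERIV_chain2[where f = "prim h", OF prim_deriv[OF h] Theta_deriv_gs[OF s j]])
    moreover have "gs j s ?t \<noteq> 0"
      using gs_ge_1[OF s, of ?t] by auto
    then have "h ?t * (J j s / gs j s ?t) = J j s * k ?t"
      using h_eq[OF Theta_in[OF s j x]] gs_eq[OF Theta_in[OF s j x]] by simp
    ultimately show "((\<lambda>x. prim h (Theta j s x)) has_real_derivative J j s * k ?t) (at x within {0..1})"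
      by simp
  qed simp
  also have "\<dots> = integral {0..real j * pi} h"
    using integral_eq_prim[OF h, of "real j * pi"] prim_0[OF h]
    by (simp add: Theta_0[OF s j] Theta_1[OF s j])
  also have "\<dots> = integral {0..real j * pi} (\<lambda>t. k t * G (s * sin t))"
    using h_eq by (intro integral_cong) auto
  finally show ?thesis
    using J_pos[OF s j] by (simp add: field_simps)
qed

text \<open>The \<open>H01_norm\<close> of \<open>U j s\<close> in the angle variable: the squared
  derivative \<open>(J * s * cos t)^2\<close> is integrated against \<open>G dt / J\<close>, leaving
  one factor \<open>J\<close>.\<close>

definition ellH :: "nat \<Rightarrow> real \<Rightarrow> real" where
  "ellH j s = sqrt (J j s * s\<^sup>2 * integral {0..real j * pi} (\<lambda>t. (cos t)\<^sup>2 * G (s * sin t)))"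

text \<open>The \<open>Lq_norm\<close> of \<open>U j s\<close> in the angle variable.\<close>

definition ellq :: "real \<Rightarrow> nat \<Rightarrow> real \<Rightarrow> real" where
  "ellq q j s = (integral {0..real j * pi} (\<lambda>t. \<bar>psi (s * sin t)\<bar> powr q * G (s * sin t)) / J j s) powr (1 / q)"

lemma continuous_on_Theta: "s \<in> amp j \<Longrightarrow> 1 \<le> j \<Longrightarrow> continuous_on S (Theta j s)"
  using Theta_deriv_gs by (meson DERIV_isCont continuous_at_imp_continuous_on)

lemma H01_norm_U:
  assumes s: "s \<in> amp j" and j: "1 \<le> j"
  shows "H01_norm (U j s) = ellH j s"
proof -
  have "H01_norm (U j s) = sqrt (integral {0..1} (\<lambda>x. (J j s * s * cos (Theta j s x))\<^sup>2))"
    by (intro H01_norm_eq U_deriv[OF s j] continuous_intros continuous_on_Theta[OF s j])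
  also have "integral {0..1} (\<lambda>x. (J j s * s * cos (Theta j s x))\<^sup>2) =
      integral {0..real j * pi} (\<lambda>t. (J j s * s * cos t)\<^sup>2 * G (s * sin t)) / J j s"
    by (rule integral_Theta[OF s j]) (intro continuous_intros)
  also have "\<dots> = integral {0..real j * pi} (\<lambda>t. (J j s * s)\<^sup>2 * ((cos t)\<^sup>2 * G (s * sin t))) / J j s"
    by (simp add: power_mult_distrib mult.assoc)
  also have "\<dots> = J j s * s\<^sup>2 * integral {0..real j * pi} (\<lambda>t. (cos t)\<^sup>2 * G (s * sin t))"
    using J_pos[OF s j] by (simp add: power2_eq_square)
  finally show ?thesis
    by (simp add: ellH_def)
qed

lemma continuous_on_psi: "continuous_on wset psi"
  using isCont_psi by (simp add: continuous_at_imp_continuous_on)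

lemma continuous_on_U:
  assumes s: "s \<in> amp j" and j: "1 \<le> j" shows "continuous_on {0..1} (U j s)"
  using U_deriv[OF s j] by (rule DERIV_continuous_on)

lemma Lq_norm_U:
  assumes s: "s \<in> amp j" and j: "1 \<le> j" and q: "1 \<le> q"
  shows "Lq_norm q (U j s) = ellq q j s"
proof -
  have c: "continuous_on {0..real j * pi} (\<lambda>t. \<bar>psi (s * sin t)\<bar> powr q)"
    using amp_wset[OF s] q
    by (intro continuous_on_powr_const continuous_on_rabs continuous_on_compose2[OF continuous_on_psi])
      (auto intro!: continuous_intros)
  have "Lq_norm q (U j s) = (integral {0..1} (\<lambda>x. \<bar>U j s x\<bar> powr q)) powr (1 / q)"
    by (rule Lq_norm_eq[OF continuous_on_U[OF s j] q])
  also have "integral {0..1} (\<lambda>x. \<bar>U j s x\<bar> powr q) =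
      integral {0..1} (\<lambda>x. \<bar>psi (s * sin (Theta j s x))\<bar> powr q)"
    by (intro integral_cong) (simp add: U_eq)
  also have "\<dots> = integral {0..real j * pi} (\<lambda>t. \<bar>psi (s * sin t)\<bar> powr q * G (s * sin t)) / J j s"
    by (rule integral_Theta[OF s j c])
  finally show ?thesis
    by (simp add: ellq_def)
qed

text \<open>The weight \<open>c\<close> is arbitrary: a product that is not integrable has integral
  0 by convention.\<close>

lemma amp_integral_nonneg:
  assumes "s \<in> amp j" "\<And>t. t \<in> {0..real j * pi} \<Longrightarrow> 0 \<le> c t"
  shows "0 \<le> integral {0..real j * pi} (\<lambda>t. c t * G (s * sin t))"
proof (cases "(\<lambda>t. c t * G (s * sin t)) integrable_on {0..real j * pi}")
  case True
  moreover have "0 \<le> c t * G (s * sin t)" if "t \<in> {0..real j * pi}" for t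
    using assms(2)[OF that] G_pos[OF amp_wset[OF assms(1) that]] by simp
  ultimately show ?thesis
    by (rule integral_nonneg)
qed (simp add: not_integrable_integral)

lemma continuous_on_ellH: "continuous_on (amp j) (ellH j)"
  unfolding ellH_def
  by (intro continuous_intros continuous_on_J continuous_on_amp_integral continuous_on_G)

lemma continuous_on_ellq:
  assumes j: "1 \<le> j" and q: "1 \<le> q"
  shows "continuous_on (amp j) (ellq q j)"
  unfolding ellq_def
proof (rule continuous_on_powr_const)
  have "continuous_on wset (\<lambda>w. \<bar>psi w\<bar> powr q * G w)"
    using q by (intro continuous_on_mult continuous_on_powr_const continuous_on_rabs
        continuous_on_psi continuous_on_G) auto
  then have "continuous_on (amp j) (\<lambda>s. integral {0..real j * pi}
      (\<lambda>t. \<bar>psi (s * sin t)\<bar> powr q * G (s * sin t)))"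
    using continuous_on_amp_integral[of "\<lambda>_. 1" "\<lambda>w. \<bar>psi w\<bar> powr q * G w" j] by simp
  then show "continuous_on (amp j) (\<lambda>s. integral {0..real j * pi}
      (\<lambda>t. \<bar>psi (s * sin t)\<bar> powr q * G (s * sin t)) / J j s)"
    using J_pos[OF _ j] by (intro continuous_on_divide continuous_on_J) force+
  show "0 \<le> integral {0..real j * pi} (\<lambda>t. \<bar>psi (s * sin t)\<bar> powr q * G (s * sin t)) / J j s"
    if "s \<in> amp j" for s
    using amp_integral_nonneg[OF that, of "\<lambda>t. \<bar>psi (s * sin t)\<bar> powr q"] J_pos[OF that j] by simp
qed (use q in simp)

lemma ellH_0: "ellH j 0 = 0"
  by (simp add: ellH_def)

lemma ellq_0: "ellq q j 0 = 0"
  by (simp add: ellq_def psi_0)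

text \<open>On the branch of amplitudes \<open>s\<close> the nonlocal problem is the scalar equation
  \<open>a (ell s) * (J j s)\<^sup>2 = lam\<close>. Its least root \<open>s\<close> has the property that
  \<open>a (ell y) * (j * pi)\<^sup>2 < lam\<close> for all \<open>y \<le> s\<close>, which places \<open>ell s\<close> below \<open>d_sup\<close>.\<close>

lemma least_root_below_d_sup:
  assumes j: "1 \<le> j" and a: "continuous_on {0..} a" "0 < m" "\<And>s. 0 \<le> s \<Longrightarrow> m \<le> a s"
    and a0: "a 0 * pi\<^sup>2 * (real j)\<^sup>2 < lam"
    and ell: "continuous_on (amp j) ell" "ell 0 = 0" "\<And>s. 0 \<le> ell s"
  shows "\<exists>s\<in>amp j. 0 < s \<and> a (ell s) * (J j s)\<^sup>2 = lam \<and> ereal (ell s) < d_sup a lam j"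
proof -
  define K where "K = (\<lambda>s. a (ell s) * (J j s)\<^sup>2)"
  have K: "continuous_on (amp j) K"
    unfolding K_def using ell
    by (intro continuous_on_mult continuous_on_power continuous_on_J continuous_on_compose2[OF a(1)]) auto
  \<comment> \<open>Then \<open>m * (J j S)^2 >= lam\<close>, and since \<open>a >= m\<close>, the
    value \<open>lam\<close> is reached or exceeded at \<open>S\<close> whatever
    \<open>ell S\<close> is.\<close>
  obtain S where S: "S \<in> amp j" "sqrt (\<bar>lam\<bar> / m) \<le> J j S"
    using J_unbounded[OF j] by blast
  have "lam \<le> m * (sqrt (\<bar>lam\<bar> / m))\<^sup>2"
    using a(2) by simp
  also have "\<dots> \<le> a (ell S) * (J j S)\<^sup>2"
    using S a(2,3) ell(3) by (intro mult_mono power_mono) (auto intro: order_trans[of 0 m] less_imp_le)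
  finally have KS: "lam \<le> K S"
    by (simp add: K_def)
  have S0: "0 \<le> S"
    using S by (simp add: amp_def)
  have sub: "{0..S} \<subseteq> amp j"
    using amp_below[OF S(1)] by auto
  define Z where "Z = {s \<in> {0..S}. lam \<le> K s}"
  have "closed ({0..S} \<inter> K -` {lam..})"
    using continuous_on_subset[OF K sub] by (intro continuous_closed_preimage) auto
  moreover have "Z = {0..S} \<inter> ({0..S} \<inter> K -` {lam..})"
    by (auto simp: Z_def)
  ultimately have "compact Z"
    by (simp only: compact_Int_closed[OF compact_Icc])
  moreover have "Z \<noteq> {}"
    using KS S0 by (auto simp: Z_def)
  ultimately obtain s where s: "s \<in> Z" "\<And>y. y \<in> Z \<Longrightarrow> s \<le> y"
    using compact_attains_inf by metis
  have s_amp: "s \<in> amp j" "0 \<le> s" "s \<le> S"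
    using s sub by (auto simp: Z_def)
  have sub_s: "{0..s} \<subseteq> amp j"
    using sub s_amp by auto
  have K0: "K 0 < lam"
    using a0 ell by (simp add: K_def J_0 power_mult_distrib mult_ac)
  then have s0: "0 < s"
    using s s_amp by (cases "s = 0") (auto simp: Z_def)
  obtain z where z: "0 \<le> z" "z \<le> s" "K z = lam"
    using IVT'[of K 0 lam s] K0 s(1) s_amp continuous_on_subset[OF K sub_s]
    by (auto simp: Z_def)
  then have "z = s"
    using s(2)[of z] s_amp by (auto simp: Z_def)
  then have Ks: "K s = lam"
    using z by simp
  have below: "a (ell y) * pi\<^sup>2 * (real j)\<^sup>2 < lam" if y: "0 \<le> y" "y \<le> s" for y
  proof (cases "y = 0")
    case True
    then show ?thesis
      using a0 ell by simp
  next
    case False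
    then have "y \<in> amp j" "0 < y"
      using y s_amp sub by auto
    then have "(real j * pi)\<^sup>2 < (J j y)\<^sup>2"
      using J_gt[of y j] j by (intro power_strict_mono) auto
    moreover have "0 < a (ell y)"
      using a ell(3) by (meson less_le_trans)
    ultimately have "a (ell y) * (real j * pi)\<^sup>2 < K y"
      unfolding K_def by (intro mult_strict_left_mono)
    also have "K y \<le> lam"
    proof (rule ccontr)
      assume *: "\<not> K y \<le> lam"
      then have "y \<in> Z"
        using y s_amp by (simp add: Z_def)
      then have "y = s"
        using s(2)[of y] y by simp
      then show False
        using * Ks by simp
    qed
    finally show ?thesis
      by (simp add: power_mult_distrib mult_ac)
  qed
  \<comment> \<open>As \<open>ell\<close> is continuous with \<open>ell 0 = 0\<close>, each such
    \<open>d\<close> equals \<open>ell y\<close> for some \<open>y <= s\<close>, even where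
    \<open>ell\<close> is not monotone.\<close>
  have below_d: "a d * pi\<^sup>2 * (real j)\<^sup>2 < lam" if d: "0 \<le> d" "d \<le> ell s" for d
  proof -
    obtain y where "0 \<le> y" "y \<le> s" "ell y = d"
      using IVT'[of ell 0 d s] ell(2) d s_amp continuous_on_subset[OF ell(1) sub_s] by auto
    then show ?thesis
      using below by blast
  qed
  \<comment> \<open>The inequality is strict at \<open>ell s\<close> itself, so it persists on a
    short interval beyond; this puts the supremum strictly above \<open>ell s\<close>.\<close>
  have "((\<lambda>d. a d * pi\<^sup>2 * (real j)\<^sup>2) \<longlongrightarrow> a (ell s) * pi\<^sup>2 * (real j)\<^sup>2) (at (ell s) within {0..})"
    using a(1) ell(3)[of s] by (intro tendsto_intros) (auto simp: continuous_on_def)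
  then have "\<forall>\<^sub>F d in at (ell s) within {0..}. a d * pi\<^sup>2 * (real j)\<^sup>2 < lam"
    by (rule order_tendstoD) (use below_d ell(3) in blast)
  then obtain e where e: "0 < e"
    "\<And>d. 0 \<le> d \<Longrightarrow> d \<noteq> ell s \<Longrightarrow> \<bar>d - ell s\<bar> < e \<Longrightarrow> a d * pi\<^sup>2 * (real j)\<^sup>2 < lam"
    by (auto simp: eventually_at dist_real_def)
  have "a d * pi\<^sup>2 * (real j)\<^sup>2 < lam" if "d \<in> {0..ell s + e / 2}" for d
    using that below_d[of d] e(2)[of d] e(1) by (cases "d \<le> ell s") auto
  then have "ereal (ell s + e / 2) \<le> d_sup a lam j"
    unfolding d_sup_def using ell(3)[of s] e(1) by (intro Sup_upper) auto
  moreover have "ereal (ell s) < ereal (ell s + e / 2)"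
    using e by simp
  ultimately have "ereal (ell s) < d_sup a lam j"
    by (rule less_le_trans[rotated])
  then show ?thesis
    using s_amp s0 Ks by (auto simp: K_def)
qed

lemma exists_self_consistent:
  assumes j: "1 \<le> j" and a: "continuous_on {0..} a" "0 < m" "\<And>s. 0 \<le> s \<Longrightarrow> m \<le> a s"
    and a0: "a 0 * pi\<^sup>2 * (real j)\<^sup>2 < lam" and q: "1 \<le> q" and r: "0 < r"
    and l: "l = (\<lambda>u. H01_norm u powr r) \<or> l = (\<lambda>u. Lq_norm q u powr r)"
  shows "\<exists>u. ereal (l u) < d_sup a lam j \<and> is_u f a lam 1 j (l u) u"
proof -
  define ell where "ell = (\<lambda>s. (if l = (\<lambda>u. H01_norm u powr r) then ellH j s else ellq q j s) powr r)"
  have l_U: "l (U j s) = ell s" if "s \<in> amp j" for s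
    using l H01_norm_U[OF that j] Lq_norm_U[OF that j q] by (auto simp: ell_def)
  have nonneg: "0 \<le> ellH j s" "0 \<le> ellq q j s" if "s \<in> amp j" for s
    using amp_integral_nonneg[OF that, of "\<lambda>t. (cos t)\<^sup>2"] J_pos[OF that j]
    by (auto simp: ellH_def ellq_def)
  have "continuous_on (amp j) ell"
    unfolding ell_def using nonneg r continuous_on_ellH continuous_on_ellq[OF j q]
    by (cases "l = (\<lambda>u. H01_norm u powr r)") (simp_all add: continuous_on_powr_const)
  moreover have "ell 0 = 0" "\<And>s. 0 \<le> ell s"
    by (simp_all add: ell_def ellH_0 ellq_0)
  ultimately obtain s where s: "s \<in> amp j" "0 < s" "a (ell s) * (J j s)\<^sup>2 = lam" "ereal (ell s) < d_sup a lam j"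
    using least_root_below_d_sup[OF j a a0] by blast
  have "0 < a (ell s)"
    using a(2) a(3)[of "ell s"] \<open>\<And>s. 0 \<le> ell s\<close>[of s] by auto
  then have "lam / a (ell s) = (J j s)\<^sup>2"
    using s(3) by (simp add: field_simps)
  then have "is_u f a lam 1 j (ell s) (U j s)"
    using is_v_U[OF s(1,2) j] \<open>\<And>s. 0 \<le> ell s\<close> by (simp add: is_u_def)
  then show ?thesis
    using s l_U[OF s(1)] by metis
qed

section \<open>Dependence on the parameter along one branch\<close>

lemma is_v_pos_gt:
  assumes "is_v f \<mu> 1 j u" "0 < \<mu>" "1 \<le> j"
  shows "(real j * pi)\<^sup>2 < \<mu>"
proof -
  obtain s where s: "s \<in> amp j" "0 < s" "\<mu> = (J j s)\<^sup>2"
    using is_v_iff assms by blast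
  then show ?thesis
    using J_gt[of s j] assms by (simp add: power_strict_mono)
qed

lemma J_square_le_iff:
  assumes "s \<in> amp j" "r \<in> amp j" "1 \<le> j"
  shows "(J j s)\<^sup>2 \<le> (J j r)\<^sup>2 \<longleftrightarrow> s \<le> r"
proof -
  have "(J j s)\<^sup>2 \<le> (J j r)\<^sup>2 \<longleftrightarrow> J j s \<le> J j r"
    using J_pos assms by (simp add: power_mono_iff less_imp_le)
  moreover have "0 \<le> s" "0 \<le> r"
    using assms by (auto simp: amp_def)
  ultimately show ?thesis
    using J_less[of s j r] J_less[of r j s] assms
    by (cases s r rule: linorder_cases) auto
qed

lemma is_v_pos_unique:
  assumes "is_v f \<mu> 1 j u" "is_v f \<mu> 1 j v" "0 < \<mu>" "1 \<le> j"
  shows "u = v"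
proof -
  obtain s where s: "s \<in> amp j" "\<mu> = (J j s)\<^sup>2" "u = U j s"
    using is_v_iff assms by blast
  obtain r where r: "r \<in> amp j" "\<mu> = (J j r)\<^sup>2" "v = U j r"
    using is_v_iff assms by blast
  have "s = r"
    using J_square_le_iff[of s j r] J_square_le_iff[of r j s] s r assms by auto
  then show ?thesis
    using s r by simp
qed

text \<open>A larger parameter means a larger amplitude, and each of the three factors under the
  root in \<open>ellH\<close> grows with the amplitude.\<close>

lemma H01_norm_pos_mono:
  assumes "is_v f \<mu> 1 j u" "is_v f \<nu> 1 j v" "0 < \<mu>" "\<mu> \<le> \<nu>" "1 \<le> j"
  shows "H01_norm u \<le> H01_norm v"
proof -
  obtain s where s: "s \<in> amp j" "\<mu> = (J j s)\<^sup>2" "u = U j s"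
    using is_v_iff assms by blast
  obtain r where r: "r \<in> amp j" "\<nu> = (J j r)\<^sup>2" "v = U j r"
    using is_v_iff[of \<nu> j v] assms by auto
  have le: "s \<le> r"
    using J_square_le_iff[of s j r] s r assms by simp
  have nonneg: "0 \<le> s"
    using s by (simp add: amp_def)
  have "integral {0..real j * pi} (\<lambda>t. (cos t)\<^sup>2 * G (s * sin t)) \<le>
      integral {0..real j * pi} (\<lambda>t. (cos t)\<^sup>2 * G (r * sin t))"
    using G_amp_mono[OF r(1) nonneg le] s(1) r(1)
    by (intro integral_le integrable_continuous_real continuous_intros continuous_on_G_amp mult_left_mono) auto
  moreover have "J j s \<le> J j r"
    using J_less[OF r(1) nonneg] le assms by (cases "s = r") auto
  ultimately have "ellH j s \<le> ellH j r"
    unfolding ellH_def using le nonneg J_pos[OF s(1)] J_pos[OF r(1)] assms(5)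
      amp_integral_nonneg[OF s(1), of "\<lambda>t. (cos t)\<^sup>2"]
    by (intro real_sqrt_le_mono mult_mono power_mono mult_nonneg_nonneg) (auto intro: less_imp_le)
  then show ?thesis
    using H01_norm_U s r assms by simp
qed

end

section \<open>Comparison of positive solutions\<close>

context ci_nonlin
begin

text \<open>Sturm's argument: on a maximal interval where \<open>v < u\<close> the Wronskian \<open>u' v - v' u\<close>
  would be strictly increasing, yet nonnegative at the left and nonpositive at the right end.\<close>

lemma positive_solution_compare:
  assumes u: "chafee_infante_solution f \<mu> u" and v: "chafee_infante_solution f \<nu> v"
    and \<mu>: "0 < \<mu>" "\<mu> < \<nu>"
    and v_pos: "\<And>x. x \<in> {0<..<1} \<Longrightarrow> 0 < v x"
    and x0: "x0 \<in> {0..1}"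
  shows "u x0 \<le> v x0"
proof (rule ccontr)
  assume less: "\<not> u x0 \<le> v x0"
  obtain u' where u': "\<And>x. x \<in> {0..1} \<Longrightarrow> (u has_real_derivative u' x) (at x within {0..1})"
    and u'': "\<And>x. x \<in> {0..1} \<Longrightarrow> (u' has_real_derivative - (\<mu> * f (u x))) (at x within {0..1})"
    and u0: "u 0 = 0" "u 1 = 0"
    using chafee_infante_solutionE[OF u] by metis
  obtain v' where v': "\<And>x. x \<in> {0..1} \<Longrightarrow> (v has_real_derivative v' x) (at x within {0..1})"
    and v'': "\<And>x. x \<in> {0..1} \<Longrightarrow> (v' has_real_derivative - (\<nu> * f (v x))) (at x within {0..1})"
    and v0: "v 0 = 0" "v 1 = 0"
    using chafee_infante_solutionE[OF v] by metis
  define h where "h = (\<lambda>x. u x - v x)"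
  have h': "(h has_real_derivative u' x - v' x) (at x within {0..1})" if "x \<in> {0..1}" for x
    unfolding h_def using u'[OF that] v'[OF that] by (rule DERIV_diff)
  have h_cont: "continuous_on {0..1} h"
    using h' by (rule DERIV_continuous_on)
  have h_x0: "0 < h x0"
    using less by (simp add: h_def)
  define Z where "Z = {0..1} \<inter> h -` {0}"
  have Z: "closed Z"
    unfolding Z_def by (intro continuous_closed_preimage h_cont) auto
  have Z01: "0 \<in> Z" "1 \<in> Z"
    by (auto simp: Z_def h_def u0 v0)
  \<comment> \<open>\<open>a\<close> and \<open>b\<close> will be the zeros of \<open>h\<close>
    nearest to \<open>x0\<close> on either side, so that \<open>v < u\<close> holds throughout the
    interval between them.\<close>
  have "compact ({0..x0} \<inter> Z)" "{0..x0} \<inter> Z \<noteq> {}"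
    using Z Z01 x0 by (auto intro: compact_Int_closed)
  then obtain a where a: "a \<in> {0..x0} \<inter> Z" "\<And>y. y \<in> {0..x0} \<inter> Z \<Longrightarrow> y \<le> a"
    using compact_attains_sup by metis
  have "compact ({x0..1} \<inter> Z)" "{x0..1} \<inter> Z \<noteq> {}"
    using Z Z01 x0 by (auto intro: compact_Int_closed)
  then obtain b where b: "b \<in> {x0..1} \<inter> Z" "\<And>y. y \<in> {x0..1} \<inter> Z \<Longrightarrow> b \<le> y"
    using compact_attains_inf by metis
  have h_ab: "h a = 0" "h b = 0"
    using a b by (auto simp: Z_def)
  have ab: "0 \<le> a" "a < x0" "x0 < b" "b \<le> 1"
    using a(1) b(1) h_ab h_x0 by (auto simp: less_le)
  have sub: "{x..y} \<subseteq> {0..1}" if "a \<le> x" "y \<le> b" for x y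
    using that ab by auto
  have h_pos: "0 < h x" if x: "a < x" "x < b" for x
  proof (rule ccontr)
    assume neg: "\<not> 0 < h x"
    show False
    proof (cases "x \<le> x0")
      case True
      then obtain y where "x \<le> y" "y \<le> x0" "h y = 0"
        using IVT'[of h x 0 x0] neg h_x0 continuous_on_subset[OF h_cont sub[of x x0]] x ab by auto
      then show False
        using a(2)[of y] x ab by (auto simp: Z_def)
    next
      case False
      then obtain y where "x0 \<le> y" "y \<le> x" "h y = 0"
        using IVT2'[of h x 0 x0] neg h_x0 continuous_on_subset[OF h_cont sub[of x0 x]] x ab by auto
      then show False
        using b(2)[of y] x ab by (auto simp: Z_def)
    qed
  qed
  define Wr where "Wr = (\<lambda>x. u' x * v x - v' x * u x)"
  have Wr': "(Wr has_real_derivative \<nu> * f (v x) * u x - \<mu> * f (u x) * v x) (at x within {0..1})"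
    if "x \<in> {0..1}" for x
    unfolding Wr_def
    by (rule DERIV_cong[OF DERIV_diff[OF DERIV_mult[OF u''[OF that] v'[OF that]]
          DERIV_mult[OF v''[OF that] u'[OF that]]]])
      (simp add: algebra_simps)
  have "Wr a < Wr b"
  proof (rule DERIV_pos_imp_increasing_open[where f = Wr])
    show "a < b"
      using ab by simp
    show "continuous_on {a..b} Wr"
      using DERIV_continuous_on[OF Wr'] by (rule continuous_on_subset) (use ab in auto)
  next
    fix x assume x: "a < x" "x < b"
    then have x01: "0 < x" "x < 1"
      using ab by auto
    have vu: "0 < v x" "v x < u x"
      using h_pos[OF x] v_pos[of x] x01 by (auto simp: h_def)
    have fv: "0 < f (v x)"
      using solution_in_uset[OF v] \<mu> x01 vu uset_pos_iff[of "v x"] by auto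
    have "f (u x) / u x < f (v x) / v x"
      using ratio_strict_antimono[OF vu] .
    then have "f (u x) * v x < f (v x) * u x"
      using vu by (simp add: field_simps)
    then have "\<mu> * (f (u x) * v x) < \<mu> * (f (v x) * u x)"
      using \<mu> by simp
    also have "\<dots> < \<nu> * (f (v x) * u x)"
      using \<mu> fv vu by (intro mult_strict_right_mono mult_pos_pos) auto
    finally have "0 < \<nu> * f (v x) * u x - \<mu> * f (u x) * v x"
      by (simp add: mult.assoc)
    then show "\<exists>y. (Wr has_real_derivative y) (at x) \<and> 0 < y"
      using Wr'[of x] at_within_Icc_at[OF x01] x01 by auto
  qed
  moreover have "0 \<le> Wr a"
  proof -
    have "\<not> u' a - v' a < 0"
    proof
      assume neg: "u' a - v' a < 0"
      have "a \<in> {0..1}"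
        using ab by simp
      then obtain d where d: "0 < d" "\<And>e. 0 < e \<Longrightarrow> a + e \<in> {0..1} \<Longrightarrow> e < d \<Longrightarrow> h (a + e) < h a"
        using has_real_derivative_neg_dec_right[OF h' neg] by blast
      define e where "e = min (d / 2) ((b - a) / 2)"
      have "0 < e" "e < d" "a + e < b"
        using d(1) ab by (auto simp: e_def min_def field_simps)
      then show False
        using d(2)[of e] h_pos[of "a + e"] h_ab ab by simp
    qed
    moreover have "0 \<le> v a"
      using v_pos[of a] v0 ab by (cases "a = 0") (auto intro: less_imp_le)
    moreover have "u a = v a"
      using h_ab by (simp add: h_def)
    ultimately show ?thesis
      by (simp add: Wr_def mult_right_mono)
  qed
  moreover have "Wr b \<le> 0"
  proof -
    have "\<not> 0 < u' b - v' b"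
    proof
      assume pos: "0 < u' b - v' b"
      have "b \<in> {0..1}"
        using ab by simp
      then obtain d where d: "0 < d" "\<And>e. 0 < e \<Longrightarrow> b - e \<in> {0..1} \<Longrightarrow> e < d \<Longrightarrow> h (b - e) < h b"
        using has_real_derivative_pos_inc_left[OF h' pos] by blast
      define e where "e = min (d / 2) ((b - a) / 2)"
      have "0 < e" "e < d" "a < b - e"
        using d(1) ab by (auto simp: e_def min_def field_simps)
      then show False
        using d(2)[of e] h_pos[of "b - e"] h_ab ab by simp
    qed
    moreover have "0 \<le> v b"
      using v_pos[of b] v0 ab by (cases "b = 1") (auto intro: less_imp_le)
    moreover have "u b = v b"
      using h_ab by (simp add: h_def)
    ultimately show ?thesis
      by (simp add: Wr_def mult_right_mono)
  qed
  ultimately show False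
    by simp
qed

lemma U_1_pos:
  assumes s: "s \<in> amp 1" "0 < s" and x: "x \<in> {0<..<1}"
  shows "0 < U 1 s x"
proof -
  have x': "x \<in> {0..1}"
    using x by simp
  have "0 < Theta 1 s x" "Theta 1 s x < pi"
    using Theta_le_iff[OF s(1) order_refl, of x 0] Theta_le_iff[OF s(1) order_refl, of 1 x]
      Theta_0[OF s(1) order_refl] Theta_1[OF s(1) order_refl] x by auto
  then have "0 < s * sin (Theta 1 s x)"
    using s by (simp add: sin_gt_zero)
  then show ?thesis
    using psi_pos amp_wset[OF s(1) Theta_in[OF s(1) order_refl x']] x' by (simp add: U_eq)
qed

text \<open>On a single lobe a larger amplitude means a larger parameter, hence by comparison a
  pointwise larger positive solution.\<close>

lemma Lq_norm_U_1_mono: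
  assumes s: "s \<in> amp 1" "0 < s" and r: "r \<in> amp 1" and sr: "s \<le> r" and q: "1 \<le> q"
  shows "Lq_norm q (U 1 s) \<le> Lq_norm q (U 1 r)"
proof (cases "s = r")
  case False
  then have sr': "s < r"
    using sr by simp
  have le: "U 1 s x \<le> U 1 r x" if "x \<in> {0..1}" for x
  proof (rule positive_solution_compare[where u = "U 1 s" and v = "U 1 r" and ?x0.0 = x])
    show "(J 1 s)\<^sup>2 < (J 1 r)\<^sup>2"
      using J_less[OF r _ sr' order_refl] J_pos[OF s(1) order_refl] s(2)
      by (intro power_strict_mono) auto
    show "0 < (J 1 s)\<^sup>2"
      using J_pos[OF s(1) order_refl] by simp
  qed (use U_solution[OF s(1)] U_solution[OF r] U_1_pos[OF r] sr' s that in auto)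
  have nonneg: "0 \<le> U 1 s x" if "x \<in> {0..1}" for x
    using U_1_pos[OF s, of x] U_solution[OF s(1) order_refl] that
    by (cases "x = 0 \<or> x = 1") (auto simp: chafee_infante_solution_def dirichlet_solution_def intro: less_imp_le)
  have pm: "\<bar>U 1 s x\<bar> powr q \<le> \<bar>U 1 r x\<bar> powr q" if "x \<in> {0..1}" for x
    using le[OF that] nonneg[OF that] q by (intro powr_mono2) auto
  have c: "continuous_on {0..1} (\<lambda>x. \<bar>U 1 z x\<bar> powr q)" if "z \<in> amp 1" for z
    using q by (intro continuous_on_powr_const continuous_on_rabs continuous_on_U that) auto
  have "integral {0..1} (\<lambda>x. \<bar>U 1 s x\<bar> powr q) \<le> integral {0..1} (\<lambda>x. \<bar>U 1 r x\<bar> powr q)"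
    by (intro integral_le integrable_continuous_real c s(1) r pm)
  moreover have "0 \<le> integral {0..1} (\<lambda>x. \<bar>U 1 s x\<bar> powr q)"
    by (intro integral_nonneg integrable_continuous_real c s(1)) auto
  ultimately show ?thesis
    unfolding Lq_norm_eq[OF continuous_on_U[OF s(1) order_refl] q]
      Lq_norm_eq[OF continuous_on_U[OF r order_refl] q]
    using q by (intro powr_mono2) auto
qed simp

end

section \<open>Odd nonlinearities\<close>

locale odd_ci_nonlin = ci_nonlin +
  assumes f_odd: "f (- x) = - f x"
begin

interpretation R: ci_nonlin "\<lambda>x. - f (- x)"
  by (rule reflect)

text \<open>Here reflection changes nothing, so the reflection lemmas become symmetries of
  \<open>wset\<close>, \<open>psi\<close> and \<open>G\<close>.\<close>

lemma reflect_eq: "(\<lambda>x. - f (- x)) = f"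
  by (simp add: f_odd)

lemma odd_wset: "- w \<in> wset \<longleftrightarrow> w \<in> wset"
  using reflect_wset[of w] by (simp add: reflect_eq)

lemma odd_psi: "w \<in> wset \<Longrightarrow> psi (- w) = - psi w"
  using reflect_psi[of w] by (simp add: reflect_eq)

lemma even_G: "w \<in> wset \<Longrightarrow> G (- w) = G w"
  using reflect_G[of w] by (simp add: reflect_eq)

text \<open>The orbit attains \<open>s\<close> at \<open>pi / 2\<close>; as \<open>wset\<close> is
  symmetric, \<open>- s\<close> then fits as well, and any number of lobes is admissible.\<close>

lemma odd_amp:
  assumes "s \<in> amp j" "1 \<le> j"
  shows "s \<in> amp i"
proof -
  have "pi / 2 \<in> {0..real j * pi}"
    using assms(2) mult_right_mono[of 1 "real j" pi] by auto
  then have "s \<in> wset"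
    using amp_wset[OF assms(1), of "pi / 2"] by simp
  then show ?thesis
    using amp_of_both[of s i] odd_wset assms(1) by (simp add: amp_def)
qed

text \<open>A shift by \<open>j * pi\<close> changes the sine by a sign at most, which the even
  function \<open>K\<close> does not see.\<close>

lemma integral_lobes:
  assumes s: "s \<in> amp 1" and K: "continuous_on wset K" "\<And>w. w \<in> wset \<Longrightarrow> K (- w) = K w"
  shows "integral {0..real j * pi} (\<lambda>t. K (s * sin t)) = real j * integral {0..pi} (\<lambda>t. K (s * sin t))"
proof (induction j)
  case (Suc j)
  have wset: "s * sin t \<in> wset" if "0 \<le> t" for t
  proof -
    obtain i where "t \<le> real i * pi"
      using reals_Archimedean3[OF pi_gt_zero] by (meson less_imp_le)
    then show ?thesis
      using amp_wset[OF odd_amp[OF s order_refl, of i], of t] that by simp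
  qed
  have c: "continuous_on {0..real (Suc j) * pi} (\<lambda>t. K (s * sin t))"
    by (rule continuous_on_compose2[OF K(1)]) (use wset in \<open>auto intro!: continuous_intros\<close>)
  have "integral {0..real (Suc j) * pi} (\<lambda>t. K (s * sin t)) =
      integral {0..real j * pi} (\<lambda>t. K (s * sin t)) +
      integral {real j * pi..real (Suc j) * pi} (\<lambda>t. K (s * sin t))"
    by (rule Henstock_Kurzweil_Integration.integral_combine[symmetric]) (use c integrable_continuous_real in \<open>auto simp: mult_right_mono\<close>)
  also have "integral {real j * pi..real (Suc j) * pi} (\<lambda>t. K (s * sin t)) =
      integral {0..pi} (\<lambda>t. K (s * sin (t + real j * pi)))"
    using integral_shift_real_ivl[of "real j * pi" "real j * pi" "real (Suc j) * pi" "\<lambda>t. K (s * sin t)"]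
    by (simp add: algebra_simps)
  also have "\<dots> = integral {0..pi} (\<lambda>t. K (s * sin t))"
  proof (rule integral_cong)
    fix t assume "t \<in> {0..pi}"
    moreover have "sin (t + real j * pi) = sin t \<or> sin (t + real j * pi) = - sin t"
      by (cases "even j") (auto simp: sin_add sin_npi cos_npi)
    ultimately show "K (s * sin (t + real j * pi)) = K (s * sin t)"
      using K(2)[OF wset[of t]] by auto
  qed
  finally show ?case
    using Suc by (simp add: algebra_simps)
qed simp

text \<open>The equal lobes multiply both the integral in \<open>ellq\<close> and the time map by
  \<open>j\<close>, and the factor cancels.\<close>

lemma Lq_norm_U_lobes:
  assumes s: "s \<in> amp j" and j: "1 \<le> j" and q: "1 \<le> q"
  shows "Lq_norm q (U j s) = Lq_norm q (U 1 s)"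
proof -
  have s1: "s \<in> amp 1"
    by (rule odd_amp[OF s j])
  have "J j s = real j * J 1 s"
    using integral_lobes[OF s1 continuous_on_G even_G, of j] by (simp add: J_def)
  moreover have "continuous_on wset (\<lambda>w. \<bar>psi w\<bar> powr q * G w)"
    using q by (intro continuous_on_mult continuous_on_powr_const continuous_on_rabs
        continuous_on_psi continuous_on_G) auto
  then have "integral {0..real j * pi} (\<lambda>t. \<bar>psi (s * sin t)\<bar> powr q * G (s * sin t)) =
      real j * integral {0..pi} (\<lambda>t. \<bar>psi (s * sin t)\<bar> powr q * G (s * sin t))"
    by (rule integral_lobes[OF s1]) (simp add: odd_psi even_G)
  ultimately have "ellq q j s = ellq q 1 s"
    using j by (simp add: ellq_def)
  then show ?thesis
    using Lq_norm_U[OF s j q] Lq_norm_U[OF s1 order_refl q] by simp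
qed

lemma Lq_norm_pos_mono:
  assumes "is_v f \<mu> 1 j u" "is_v f \<nu> 1 j v" "0 < \<mu>" "\<mu> \<le> \<nu>" "1 \<le> j" "1 \<le> q"
  shows "Lq_norm q u \<le> Lq_norm q v"
proof -
  obtain s where s: "s \<in> amp j" "0 < s" "\<mu> = (J j s)\<^sup>2" "u = U j s"
    using is_v_iff assms by blast
  obtain r where r: "r \<in> amp j" "\<nu> = (J j r)\<^sup>2" "v = U j r"
    using is_v_iff[of \<nu> j v] assms by auto
  have "s \<le> r"
    using J_square_le_iff[of s j r] s r assms by simp
  then have "Lq_norm q (U 1 s) \<le> Lq_norm q (U 1 r)"
    using Lq_norm_U_1_mono odd_amp s r assms by blast
  then show ?thesis
    using Lq_norm_U_lobes s r assms by simp
qed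

end

section \<open>The nonlocal problem\<close>

lemma Lq_norm_uminus: "Lq_norm q (\<lambda>x. - u x) = Lq_norm q u"
  by (simp add: Lq_norm_def)

lemma H01_norm_nonneg: "0 \<le> H01_norm u"
  unfolding H01_norm_def set_lebesgue_integral_def
  by (intro real_sqrt_ge_zero Bochner_Integration.integral_nonneg) simp

lemma H01_norm_uminus:
  assumes "chafee_infante_solution f \<mu> u"
  shows "H01_norm (\<lambda>x. - u x) = H01_norm u"
proof -
  obtain u' u'' where u': "\<And>x. x \<in> {0..1} \<Longrightarrow> (u has_real_derivative u' x) (at x within {0..1})"
    and u'': "\<And>x. x \<in> {0..1} \<Longrightarrow> (u' has_real_derivative u'' x) (at x within {0..1})"
    using assms unfolding chafee_infante_solution_def dirichlet_solution_def by blast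
  have c: "continuous_on {0..1} u'"
    using u'' by (rule DERIV_continuous_on)
  have "H01_norm (\<lambda>x. - u x) = sqrt (integral {0..1} (\<lambda>x. (- u' x)\<^sup>2))"
    by (intro H01_norm_eq DERIV_minus u' continuous_on_minus c)
  then show ?thesis
    using H01_norm_eq[OF u' c] by simp
qed

lemma nonlocal_solution_iff:
  assumes "0 < a (l u)"
  shows "nonlocal_solution f a l lam u \<longleftrightarrow> chafee_infante_solution f (lam / a (l u)) u"
proof -
  have "- a (l u) * y = lam * z \<longleftrightarrow> - 1 * y = lam / a (l u) * z" for y z
    using assms by (auto simp: field_simps)
  then show ?thesis
    unfolding nonlocal_solution_def chafee_infante_solution_def dirichlet_solution_def by simp
qed

lemma is_v_sign_unique:
  assumes "is_v f \<mu> 1 i u" "is_v g \<nu> (- 1) j u"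
  shows False
proof -
  obtain y z where "0 < y" "\<forall>x\<in>{0<..<y}. 0 < 1 * u x" "0 < z" "\<forall>x\<in>{0<..<z}. 0 < - 1 * u x"
    using assms unfolding is_v_def by blast
  moreover from this have "min y z / 2 \<in> {0<..<y}" "min y z / 2 \<in> {0<..<z}"
    by (auto simp: min_def)
  ultimately show False
    by fastforce
qed

context ci_nonlin
begin

interpretation R: ci_nonlin "\<lambda>x. - f (- x)"
  by (rule reflect)

lemma is_v_minus_reflect:
  "is_v f \<mu> (- 1) j u \<Longrightarrow> is_v (\<lambda>x. - f (- x)) \<mu> 1 j (\<lambda>x. - u x)"
  using is_v_reflect[of f \<mu> "- 1" j u] by simp

lemma is_v_gt:
  assumes "is_v f \<mu> \<sigma> j u" "\<sigma> \<in> {1, -1}" "0 < \<mu>" "1 \<le> j"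
  shows "(real j * pi)\<^sup>2 < \<mu>"
proof (cases "\<sigma> = 1")
  case True
  then show ?thesis
    using is_v_pos_gt[of \<mu> j u] assms by simp
next
  case False
  then have "\<sigma> = - 1"
    using assms(2) by blast
  then have "is_v f \<mu> (- 1) j u"
    using assms(1) by (simp only:)
  from R.is_v_pos_gt[OF is_v_minus_reflect[OF this] assms(3,4)] show ?thesis .
qed

lemma is_v_unique:
  assumes "is_v f \<mu> \<sigma> j u" "is_v f \<mu> \<sigma> j v" "\<sigma> \<in> {1, -1}" "0 < \<mu>" "1 \<le> j"
  shows "u = v"
proof (cases "\<sigma> = 1")
  case True
  then show ?thesis
    using is_v_pos_unique assms by blast
next
  case False
  then have "\<sigma> = - 1"
    using assms(3) by blast
  then have "is_v f \<mu> (- 1) j u" "is_v f \<mu> (- 1) j v"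
    using assms(1,2) by (simp_all only:)
  then have "(\<lambda>x. - u x) = (\<lambda>x. - v x)"
    by (rule R.is_v_pos_unique[OF is_v_minus_reflect is_v_minus_reflect assms(4,5)])
  then show ?thesis
    by (simp add: fun_eq_iff)
qed

lemma H01_norm_mono:
  assumes "is_v f \<mu> \<sigma> j u" "is_v f \<nu> \<sigma> j v" "\<sigma> \<in> {1, -1}" "0 < \<mu>" "\<mu> \<le> \<nu>" "1 \<le> j"
  shows "H01_norm u \<le> H01_norm v"
proof (cases "\<sigma> = 1")
  case True
  then show ?thesis
    using H01_norm_pos_mono assms by blast
next
  case False
  then have "\<sigma> = - 1"
    using assms(3) by blast
  then have "is_v f \<mu> (- 1) j u" "is_v f \<nu> (- 1) j v"
    using assms(1,2) by (simp_all only:)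
  then have "H01_norm (\<lambda>x. - u x) \<le> H01_norm (\<lambda>x. - v x)"
    by (rule R.H01_norm_pos_mono[OF is_v_minus_reflect is_v_minus_reflect assms(4-6)])
  then show ?thesis
    using H01_norm_uminus assms(1,2) unfolding is_v_def by metis
qed

lemma exists_self_consistent_signed:
  assumes j: "1 \<le> j" and \<sigma>: "\<sigma> \<in> {1, -1}"
    and a: "continuous_on {0..} a" "0 < m" "\<And>s. 0 \<le> s \<Longrightarrow> m \<le> a s"
    and a0: "a 0 * pi\<^sup>2 * (real j)\<^sup>2 < lam" and q: "1 \<le> q" and r: "0 < r"
    and l: "l = (\<lambda>u. H01_norm u powr r) \<or> l = (\<lambda>u. Lq_norm q u powr r)"
  shows "\<exists>u. ereal (l u) < d_sup a lam j \<and> is_u f a lam \<sigma> j (l u) u"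
proof (cases "\<sigma> = 1")
  case True
  then show ?thesis
    using exists_self_consistent[OF j a a0 q r l] by simp
next
  case False
  obtain u where u: "ereal (l u) < d_sup a lam j" "is_u (\<lambda>x. - f (- x)) a lam 1 j (l u) u"
    using R.exists_self_consistent[OF j a a0 q r l] by blast
  then have "chafee_infante_solution (\<lambda>x. - f (- x)) (lam / a (l u)) u"
    by (simp add: is_u_def is_v_def)
  then have "l (\<lambda>x. - u x) = l u"
    using l H01_norm_uminus Lq_norm_uminus by auto
  moreover have "is_u f a lam (- 1) j (l u) (\<lambda>x. - u x)"
    using u(2) is_v_reflect[of "\<lambda>x. - f (- x)" _ 1 j u] by (simp add: is_u_def)
  ultimately show ?thesis
    using u(1) False \<sigma> by (intro exI[of _ "\<lambda>x. - u x"]) auto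
qed

text \<open>Monotonicity of \<open>l\<close> along a branch is a hypothesis so that both norms are
  served. Two parameters on one branch cannot differ: the solution with the larger
  \<open>lam / a (l u)\<close> would have at least as large an \<open>l\<close>, hence at least as
  large an \<open>a\<close>, hence a parameter that is not larger.\<close>

lemma nonlocal_solutions_counted:
  assumes lam: "0 < lam" and a: "0 < a 0" "mono_on {0..} a"
    and k: "lam \<le> a 0 * pi\<^sup>2 * (real k + 1)\<^sup>2"
    and l: "\<And>u. 0 \<le> l u"
    and mono: "\<And>\<mu> \<nu> \<sigma> j u v. is_v f \<mu> \<sigma> j u \<Longrightarrow> is_v f \<nu> \<sigma> j v \<Longrightarrow> \<sigma> \<in> {1, -1} \<Longrightarrow>
      0 < \<mu> \<Longrightarrow> \<mu> \<le> \<nu> \<Longrightarrow> 1 \<le> j \<Longrightarrow> l u \<le> l v"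
    and d: "\<And>j \<sigma>. j \<in> {1..k} \<Longrightarrow> \<sigma> \<in> {1, -1} \<Longrightarrow> \<exists>u. is_u f a lam \<sigma> j (d \<sigma> j) u \<and> l u = d \<sigma> j"
  shows "card {u. nonlocal_solution f a l lam u} = 2 * k + 1 \<and>
    {u. nonlocal_solution f a l lam u} =
      insert (\<lambda>x. 0) {u. \<exists>j\<in>{1..k}. \<exists>\<sigma>\<in>{1, -1}. is_u f a lam \<sigma> j (d \<sigma> j) u}"
proof -
  define T where "T = {u. \<exists>j\<in>{1..k}. \<exists>\<sigma>\<in>{1, -1}. is_u f a lam \<sigma> j (d \<sigma> j) u}"
  have a_ge: "a 0 \<le> a s" if "0 \<le> s" for s
    using monotone_onD[OF a(2), of 0 s] that by simp
  have a_pos: "0 < a s" if "0 \<le> s" for s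
    using a_ge[OF that] a(1) by linarith
  \<comment> \<open>By \<open>is_v_unique\<close> the choice is forced for each index and sign, so
    \<open>w\<close> enumerates \<open>T\<close>.\<close>
  define w where "w = (\<lambda>(j, \<sigma>). SOME u. is_u f a lam \<sigma> j (d \<sigma> j) u \<and> l u = d \<sigma> j)"
  have w: "is_u f a lam \<sigma> j (d \<sigma> j) (w (j, \<sigma>))" "l (w (j, \<sigma>)) = d \<sigma> j"
    if "j \<in> {1..k}" "\<sigma> \<in> {1, -1}" for j \<sigma>
    using someI_ex[OF d[OF that]] by (auto simp: w_def)
  have w_v: "is_v f (lam / a (d \<sigma> j)) \<sigma> j (w (j, \<sigma>))" "0 \<le> d \<sigma> j" "0 < lam / a (d \<sigma> j)"
    if "j \<in> {1..k}" "\<sigma> \<in> {1, -1}" for j \<sigma>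
    using w(1)[OF that] a_pos lam by (auto simp: is_u_def)
  have T: "T = w ` ({1..k} \<times> {1, -1})"
  proof
    show "T \<subseteq> w ` ({1..k} \<times> {1, -1})"
    proof
      fix u assume "u \<in> T"
      then obtain j \<sigma> where j: "j \<in> {1..k}" "\<sigma> \<in> {1, -1}" "is_u f a lam \<sigma> j (d \<sigma> j) u"
        unfolding T_def by blast
      have "u = w (j, \<sigma>)"
        by (rule is_v_unique[OF _ w_v(1)[OF j(1,2)] j(2) w_v(3)[OF j(1,2)]])
          (use j in \<open>auto simp: is_u_def\<close>)
      then show "u \<in> w ` ({1..k} \<times> {1, -1})"
        using j by blast
    qed
    show "w ` ({1..k} \<times> {1, -1}) \<subseteq> T"
      using w(1) unfolding T_def by blast
  qed
  have inj: "inj_on w ({1..k} \<times> {1, -1})"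
  proof (rule inj_onI, clarify)
    fix i j \<sigma> \<tau> assume *: "i \<in> {1..k}" "\<sigma> \<in> {1, - 1}" "j \<in> {1..k}" "\<tau> \<in> {1, - 1}" "w (i, \<sigma>) = w (j, \<tau>)"
    have vi: "is_v f (lam / a (d \<sigma> i)) \<sigma> i (w (i, \<sigma>))"
      using w_v(1) * by blast
    moreover have vj: "is_v f (lam / a (d \<tau> j)) \<tau> j (w (i, \<sigma>))"
      using w_v(1)[of j \<tau>] * by simp
    ultimately have "i + 1 = j + 1"
      unfolding is_v_def by metis
    moreover have "\<sigma> = \<tau>"
      using is_v_sign_unique[of f _ i "w (i, \<sigma>)" f _ j] is_v_sign_unique[of f _ j "w (i, \<sigma>)" f _ i]
        vi vj *(2,4) by auto
    ultimately show "i = j \<and> \<sigma> = \<tau>"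
      by simp
  qed
  have not0: "(\<lambda>x. 0) \<notin> T"
  proof
    assume "(\<lambda>x. 0) \<in> T"
    then obtain j \<mu> \<sigma> where "is_v f \<mu> \<sigma> j (\<lambda>x. 0)"
      by (auto simp: T_def is_u_def)
    \<comment> \<open>The zero function vanishes on an infinite set, whose \<open>card\<close> is 0
      by convention and never \<open>j + 1\<close>.\<close>
    moreover have "{x \<in> {0..1::real}. (0::real) = 0} = {0..1}"
      by auto
    ultimately have "card {0..1::real} = j + 1"
      unfolding is_v_def by metis
    then show False
      using infinite_Icc[of "0::real" 1] by simp
  qed
  have "{u. nonlocal_solution f a l lam u} = insert (\<lambda>x. 0) T"
  proof (intro set_eqI iffI)
    fix u assume "u \<in> {u. nonlocal_solution f a l lam u}"
    then have sol: "chafee_infante_solution f (lam / a (l u)) u"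
      using nonlocal_solution_iff a_pos[OF l] by blast
    have \<mu>: "0 < lam / a (l u)"
      using lam a_pos[OF l] by simp
    show "u \<in> insert (\<lambda>x. 0) T"
    proof (cases "u = (\<lambda>x. 0)")
      case False
      then obtain j \<sigma> where j: "1 \<le> j" "\<sigma> \<in> {1, -1}" "is_v f (lam / a (l u)) \<sigma> j u"
        using solution_cases[OF sol \<mu>] by blast
      \<comment> \<open>Since \<open>a 0\<close> is the least value of \<open>a\<close>, a solution
        on branch \<open>j\<close> forces \<open>j < k + 1\<close>.\<close>
      have "(real j * pi)\<^sup>2 < lam / a (l u)"
        using is_v_gt[OF j(3,2) \<mu> j(1)] .
      also have "\<dots> \<le> lam / a 0"
        using a_ge[OF l] a(1) lam by (intro divide_left_mono) (auto intro!: mult_pos_pos a_pos[OF l])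
      also have "\<dots> \<le> ((real k + 1) * pi)\<^sup>2"
        using k a(1) by (simp add: pos_divide_le_eq power_mult_distrib mult_ac)
      finally have "real j * pi < (real k + 1) * pi"
        by (rule power_less_imp_less_base) simp
      then have jk: "j \<in> {1..k}"
        using j(1) by simp
      let ?v = "w (j, \<sigma>)"
      have v: "is_v f (lam / a (l ?v)) \<sigma> j ?v" "0 < lam / a (l ?v)"
        using w_v[OF jk j(2)] w(2)[OF jk j(2)] by simp_all
      have eq: "lam / a (l u) = lam / a (l ?v)"
      proof (rule antisym; rule ccontr)
        assume neg: "\<not> lam / a (l u) \<le> lam / a (l ?v)"
        then have "l ?v \<le> l u"
          using mono[OF v(1) j(3) j(2) v(2)] j(1) by simp
        then have "a (l ?v) \<le> a (l u)"
          using monotone_onD[OF a(2)] l by simp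
        then have "lam / a (l u) \<le> lam / a (l ?v)"
          using lam a_pos[OF l] by (intro divide_left_mono mult_pos_pos) auto
        then show False
          using neg by simp
      next
        assume neg: "\<not> lam / a (l ?v) \<le> lam / a (l u)"
        then have "l u \<le> l ?v"
          using mono[OF j(3) v(1) j(2) \<mu>] j(1) by simp
        then have "a (l u) \<le> a (l ?v)"
          using monotone_onD[OF a(2)] l by simp
        then have "lam / a (l ?v) \<le> lam / a (l u)"
          using lam a_pos[OF l] by (intro divide_left_mono mult_pos_pos) auto
        then show False
          using neg by simp
      qed
      have "u = ?v"
        by (rule is_v_unique[OF j(3) _ j(2) \<mu> j(1)]) (simp only: eq v)
      then show ?thesis
        using T jk j(2) by blast
    qed simp
  next
    fix u assume u: "u \<in> insert (\<lambda>x. 0) T"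
    show "u \<in> {u. nonlocal_solution f a l lam u}"
    proof (cases "u = (\<lambda>x. 0)")
      case True
      then show ?thesis
        by (auto simp: nonlocal_solution_def dirichlet_solution_def f_0 intro!: exI[of _ "\<lambda>x. 0"])
    next
      case False
      then have "u \<in> w ` ({1..k} \<times> {1, -1})"
        using u T by simp
      then obtain j \<sigma> where j: "j \<in> {1..k}" "\<sigma> \<in> {1, -1}" "u = w (j, \<sigma>)"
        by (blast elim!: imageE SigmaE)
      have "chafee_infante_solution f (lam / a (l u)) u"
        using w_v(1)[OF j(1,2)] w(2)[OF j(1,2)] j(3) by (simp add: is_v_def)
      then show ?thesis
        using nonlocal_solution_iff[of a l u] a_pos[OF l] by simp
    qed
  qed
  moreover have "card (insert (\<lambda>x. 0) T) = 2 * k + 1"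
  proof -
    have "card T = card ({1..k} \<times> {1, -1 :: real})"
      unfolding T by (rule card_image[OF inj])
    also have "\<dots> = 2 * k"
      by (simp add: card_cartesian_product)
    finally have "card T = 2 * k" .
    moreover have "finite T"
      unfolding T by simp
    ultimately show ?thesis
      using not0 by simp
  qed
  ultimately show ?thesis
    by (simp add: T_def)
qed

end

lemma (in odd_ci_nonlin) Lq_norm_mono:
  assumes "is_v f \<mu> \<sigma> j u" "is_v f \<nu> \<sigma> j v" "\<sigma> \<in> {1, -1}" "0 < \<mu>" "\<mu> \<le> \<nu>" "1 \<le> j" "1 \<le> q"
  shows "Lq_norm q u \<le> Lq_norm q v"
proof (cases "\<sigma> = 1")
  case True
  then show ?thesis
    using Lq_norm_pos_mono assms by blast
next
  case False
  then have "\<sigma> = - 1"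
    using assms(3) by blast
  then have "is_v f \<mu> (- 1) j u" "is_v f \<nu> (- 1) j v"
    using assms(1,2) by (simp_all only:)
  then have "is_v f \<mu> 1 j (\<lambda>x. - u x)" "is_v f \<nu> 1 j (\<lambda>x. - v x)"
    using is_v_minus_reflect[unfolded reflect_eq] by blast+
  then have "Lq_norm q (\<lambda>x. - u x) \<le> Lq_norm q (\<lambda>x. - v x)"
    by (rule Lq_norm_pos_mono[OF _ _ assms(4-7)])
  then show ?thesis
    by (simp add: Lq_norm_uminus)
qed

section \<open>Sublinearity from the two growth alternatives\<close>

lemma sublinear_of_superlinear_absorption:
  fixes f :: "real \<Rightarrow> real"
  assumes "\<And>u. f u * u \<le> C3 - C4 * \<bar>u\<bar> powr p" "0 < C3" "0 < C4" "0 < \<epsilon>"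
  shows "\<exists>M. \<forall>u\<ge>M. f u \<le> \<epsilon> * u" "\<exists>M. \<forall>u\<ge>M. f (- u) \<ge> - \<epsilon> * u"
proof -
  \<comment> \<open>For \<open>|u| >= M\<close> both \<open>1 <= |u|\<close> and
    \<open>C3 <= \<epsilon> * |u|\<close> hold, hence \<open>C3 <= \<epsilon> * u^2\<close>.\<close>
  define M where "M = max 1 (C3 / \<epsilon>)"
  have le: "f u * u \<le> \<epsilon> * u\<^sup>2" if "M \<le> \<bar>u\<bar>" for u
  proof -
    have "0 \<le> C4 * \<bar>u\<bar> powr p"
      using assms(3) by simp
    then have "f u * u \<le> C3"
      using assms(1)[of u] by linarith
    also have "\<dots> = \<epsilon> * (C3 / \<epsilon>)"
      using assms(4) by simp
    also have "\<dots> \<le> \<epsilon> * (\<bar>u\<bar> * 1)"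
      using that assms(4) by (intro mult_left_mono) (auto simp: M_def)
    also have "\<dots> \<le> \<epsilon> * (\<bar>u\<bar> * \<bar>u\<bar>)"
      using that assms(4) by (intro mult_left_mono) (auto simp: M_def)
    finally show ?thesis
      by (simp add: power2_eq_square)
  qed
  have "f u \<le> \<epsilon> * u" if "M \<le> u" for u
  proof -
    have "0 < u"
      using that by (simp add: M_def)
    moreover have "f u * u \<le> \<epsilon> * u * u"
      using le[of u] that by (simp add: power2_eq_square mult.assoc)
    ultimately show ?thesis
      by simp
  qed
  then show "\<exists>M. \<forall>u\<ge>M. f u \<le> \<epsilon> * u"
    by blast
  have "f (- u) \<ge> - \<epsilon> * u" if "M \<le> u" for u
  proof -
    have "0 < u"
      using that by (simp add: M_def)
    moreover have "- f (- u) * u \<le> \<epsilon> * u * u"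
      using le[of "- u"] that by (simp add: power2_eq_square mult.assoc)
    ultimately have "- f (- u) \<le> \<epsilon> * u"
      by (meson mult_right_le_imp_le)
    then show ?thesis
      by simp
  qed
  then show "\<exists>M. \<forall>u\<ge>M. f (- u) \<ge> - \<epsilon> * u"
    by blast
qed

lemma sublinear_of_Limsup:
  fixes f :: "real \<Rightarrow> real"
  assumes "Limsup at_top (\<lambda>u. ereal (f u / u)) \<le> 0" "Limsup at_bot (\<lambda>u. ereal (f u / u)) \<le> 0" "0 < \<epsilon>"
  shows "\<exists>M. \<forall>u\<ge>M. f u \<le> \<epsilon> * u" "\<exists>M. \<forall>u\<ge>M. f (- u) \<ge> - \<epsilon> * u"
proof -
  have "\<forall>\<^sub>F u in at_top. ereal (f u / u) < ereal \<epsilon>"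
    using assms(1,3) by (intro Limsup_lessD) (auto intro: le_less_trans)
  then obtain M where M: "\<And>u. M \<le> u \<Longrightarrow> f u / u < \<epsilon>"
    by (auto simp: eventually_at_top_linorder)
  have "f u \<le> \<epsilon> * u" if "max M 1 \<le> u" for u
    using M[of u] that by (simp add: pos_divide_less_eq less_imp_le)
  then show "\<exists>M. \<forall>u\<ge>M. f u \<le> \<epsilon> * u"
    by blast
  have "\<forall>\<^sub>F u in at_bot. ereal (f u / u) < ereal \<epsilon>"
    using assms(2,3) by (intro Limsup_lessD) (auto intro: le_less_trans)
  then obtain N where N: "\<And>u. u \<le> N \<Longrightarrow> f u / u < \<epsilon>"
    by (auto simp: eventually_at_bot_linorder)
  have "f (- u) \<ge> - \<epsilon> * u" if "max (- N) 1 \<le> u" for u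
  proof -
    have "- f (- u) / u < \<epsilon>"
      using N[of "- u"] that by simp
    then have "- f (- u) < \<epsilon> * u"
      using that by (simp only: pos_divide_less_eq)
    then show ?thesis
      by simp
  qed
  then show "\<exists>M. \<forall>u\<ge>M. f (- u) \<ge> - \<epsilon> * u"
    by blast
qed

theorem theorem24:
  fixes f a :: "real \<Rightarrow> real"
    and l :: "(real \<Rightarrow> real) \<Rightarrow> real"
    and lam m p C1 C2 C3 C4 q r :: real
    and k :: nat
  assumes lam_pos: "lam > 0" and k_ge_1: "k \<ge> 1"
    and f_cont: "continuous_on UNIV f"
    and f_0: "f 0 = 0"
    and f_deriv_0: "(f has_real_derivative 1) (at 0)"
    and f_concave: "strictly_concave_on {0<..} f"
    and f_convex: "strictly_convex_on {..<0} f"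
    and p_ge_2: "p \<ge> 2"
    and C_pos: "C1 > 0" "C2 > 0" "C3 > 0" "C4 > 0"
    and f_growth: "\<And>u. \<bar>f u\<bar> \<le> C1 + C2 * \<bar>u\<bar> powr (p - 1)"
    and f_dissip: "p > 2 \<Longrightarrow> \<forall>u. f u * u \<le> C3 - C4 * \<bar>u\<bar> powr p"
    and f_limsup: "p = 2 \<Longrightarrow> Limsup at_top (\<lambda>u. ereal (f u / u)) \<le> 0 \<and>
                              Limsup at_bot (\<lambda>u. ereal (f u / u)) \<le> 0"
    and a_cont: "continuous_on {0..} a"
    and m_pos: "m > 0"
    and a_ge_m: "\<And>s. s \<ge> 0 \<Longrightarrow> a s \<ge> m"
    and a_0_k: "a 0 * pi\<^sup>2 * (real k)\<^sup>2 < lam"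
    and q_ge_1: "q \<ge> 1" and r_pos: "r > 0"
    and l_cases: "l = (\<lambda>u. H01_norm u powr r) \<or> l = (\<lambda>u. Lq_norm q u powr r)"
  shows
    "\<exists>dstar :: real \<Rightarrow> nat \<Rightarrow> real.
       (\<forall>j\<in>{1..k}. \<forall>\<sigma>\<in>{1, -1}. ereal (dstar \<sigma> j) < d_sup a lam j \<and>
          (\<exists>u. is_u f a lam \<sigma> j (dstar \<sigma> j) u \<and> nonlocal_solution f a l lam u)) \<and>
       (lam \<le> a 0 * pi\<^sup>2 * (real k + 1)\<^sup>2 \<and> (\<forall>s\<ge>0. a 0 \<le> a s) \<longrightarrow>
          (\<forall>j>k. \<forall>\<sigma>\<in>{1, -1}.
             \<not> (\<exists>d u. is_u f a lam \<sigma> j d u \<and> nonlocal_solution f a l lam u))) \<and>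
       (\<forall>N\<ge>k. lam \<le> (INF s\<in>{0..}. a s * pi\<^sup>2 * (real N + 1)\<^sup>2) \<and>
          (\<forall>M<N. \<not> lam \<le> (INF s\<in>{0..}. a s * pi\<^sup>2 * (real M + 1)\<^sup>2)) \<longrightarrow>
          (\<forall>j>N. \<forall>\<sigma>\<in>{1, -1}.
             \<not> (\<exists>d u. is_u f a lam \<sigma> j d u \<and> nonlocal_solution f a l lam u))) \<and>
       (l = (\<lambda>u. H01_norm u powr r) \<and> lam \<le> a 0 * pi\<^sup>2 * (real k + 1)\<^sup>2 \<and> mono_on {0..} a \<longrightarrow>
          card {u. nonlocal_solution f a l lam u} = 2 * k + 1 \<and>
          {u. nonlocal_solution f a l lam u} =
            insert (\<lambda>x. 0) {u. \<exists>j\<in>{1..k}. \<exists>\<sigma>\<in>{1, -1}. is_u f a lam \<sigma> j (dstar \<sigma> j) u}) \<and>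
       (l = (\<lambda>u. Lq_norm q u powr r) \<and> lam \<le> a 0 * pi\<^sup>2 * (real k + 1)\<^sup>2 \<and>
          (\<forall>x. f (- x) = - f x) \<and> mono_on {0..} a \<longrightarrow>
          card {u. nonlocal_solution f a l lam u} = 2 * k + 1 \<and>
          {u. nonlocal_solution f a l lam u} =
            insert (\<lambda>x. 0) {u. \<exists>j\<in>{1..k}. \<exists>\<sigma>\<in>{1, -1}. is_u f a lam \<sigma> j (dstar \<sigma> j) u})"
proof -
  have dissip: "f u * u \<le> C3 - C4 * \<bar>u\<bar> powr p" if "p > 2" for u
    using f_dissip that by blast
  have top: "\<exists>M. \<forall>u\<ge>M. f u \<le> \<epsilon> * u" and bot: "\<exists>M. \<forall>u\<ge>M. f (- u) \<ge> - \<epsilon> * u"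
    if "0 < \<epsilon>" for \<epsilon>
    using sublinear_of_superlinear_absorption[OF dissip C_pos(3,4) that]
      sublinear_of_Limsup[of f \<epsilon>] f_limsup p_ge_2 that
    by (cases "p > 2"; force)+
  interpret ci_nonlin f
    by unfold_locales (fact f_cont f_0 f_deriv_0 f_concave f_convex top bot)+
  have a_pos: "0 < a s" if "0 \<le> s" for s
    using a_ge_m[OF that] m_pos by linarith
  have l_nonneg: "0 \<le> l u" for u
    using l_cases by auto
  have a0_j: "a 0 * pi\<^sup>2 * (real j)\<^sup>2 < lam" if "j \<le> k" for j
  proof -
    have "a 0 * pi\<^sup>2 * (real j)\<^sup>2 \<le> a 0 * pi\<^sup>2 * (real k)\<^sup>2"
      using that a_pos[of 0] by (intro mult_left_mono power_mono) auto
    then show ?thesis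
      using a_0_k by simp
  qed
  \<comment> \<open>Besides the strict bound the choice records \<open>l u = d\<close>, which makes
    the function solve the nonlocal problem and is what the counting argument takes as
    input.\<close>
  define d where "d = (\<lambda>\<sigma> j. SOME d. ereal d < d_sup a lam j \<and> (\<exists>u. is_u f a lam \<sigma> j d u \<and> l u = d))"
  have d: "ereal (d \<sigma> j) < d_sup a lam j" "\<exists>u. is_u f a lam \<sigma> j (d \<sigma> j) u \<and> l u = d \<sigma> j"
    if "j \<in> {1..k}" "\<sigma> \<in> {1, -1}" for j \<sigma>
  proof -
    have "\<exists>u. ereal (l u) < d_sup a lam j \<and> is_u f a lam \<sigma> j (l u) u"
      using that by (intro exists_self_consistent_signed[OF _ _ a_cont m_pos a_ge_m _ q_ge_1 r_pos l_cases] a0_j) auto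
    then have "\<exists>d. ereal d < d_sup a lam j \<and> (\<exists>u. is_u f a lam \<sigma> j d u \<and> l u = d)"
      by blast
    from someI_ex[OF this] show "ereal (d \<sigma> j) < d_sup a lam j"
      "\<exists>u. is_u f a lam \<sigma> j (d \<sigma> j) u \<and> l u = d \<sigma> j"
      by (simp_all add: d_def)
  qed
  \<comment> \<open>A function with index \<open>j\<close> requires
    \<open>lam > a s * pi^2 * j^2\<close>, so bounding \<open>lam\<close> by the value at
    \<open>n + 1\<close> excludes every \<open>j > n\<close>.\<close>
  have no_branch: "\<not> is_u f a lam \<sigma> j s u"
    if "n < j" "\<sigma> \<in> {1, -1}" "0 \<le> s \<Longrightarrow> lam \<le> a s * pi\<^sup>2 * (real n + 1)\<^sup>2" for n j \<sigma> s u
  proof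
    assume u: "is_u f a lam \<sigma> j s u"
    then have s: "0 \<le> s"
      by (simp add: is_u_def)
    have "(real j * pi)\<^sup>2 < lam / a s"
      using u that(1,2) a_pos[OF s] lam_pos by (intro is_v_gt[of _ \<sigma> j u]) (auto simp: is_u_def)
    then have "a s * pi\<^sup>2 * (real j)\<^sup>2 < lam"
      using a_pos[OF s] by (simp add: pos_less_divide_eq power_mult_distrib mult_ac)
    moreover have "a s * pi\<^sup>2 * (real n + 1)\<^sup>2 \<le> a s * pi\<^sup>2 * (real j)\<^sup>2"
      using that(1) a_pos[OF s] by (intro mult_left_mono power_mono) auto
    ultimately show False
      using that(3)[OF s] by linarith
  qed
  show ?thesis
  proof (intro exI[of _ d] conjI)
    show "\<forall>j\<in>{1..k}. \<forall>\<sigma>\<in>{1, -1}. ereal (d \<sigma> j) < d_sup a lam j \<and>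
        (\<exists>u. is_u f a lam \<sigma> j (d \<sigma> j) u \<and> nonlocal_solution f a l lam u)"
    proof (intro ballI conjI)
      fix j and \<sigma> :: real assume j: "j \<in> {1..k}" "\<sigma> \<in> {1, -1}"
      show "ereal (d \<sigma> j) < d_sup a lam j"
        by (rule d(1)[OF j])
      obtain u where u: "is_u f a lam \<sigma> j (d \<sigma> j) u" "l u = d \<sigma> j"
        using d(2)[OF j] by blast
      then have "nonlocal_solution f a l lam u"
        by (subst nonlocal_solution_iff) (auto simp: a_pos l_nonneg is_u_def is_v_def)
      then show "\<exists>u. is_u f a lam \<sigma> j (d \<sigma> j) u \<and> nonlocal_solution f a l lam u"
        using u by blast
    qed
    show "lam \<le> a 0 * pi\<^sup>2 * (real k + 1)\<^sup>2 \<and> (\<forall>s\<ge>0. a 0 \<le> a s) \<longrightarrow>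
        (\<forall>j>k. \<forall>\<sigma>\<in>{1, -1}. \<not> (\<exists>d u. is_u f a lam \<sigma> j d u \<and> nonlocal_solution f a l lam u))"
    proof (intro impI allI ballI notI)
      fix j and \<sigma> :: real
      assume *: "lam \<le> a 0 * pi\<^sup>2 * (real k + 1)\<^sup>2 \<and> (\<forall>s\<ge>0. a 0 \<le> a s)" "k < j" "\<sigma> \<in> {1, -1}"
        "\<exists>d u. is_u f a lam \<sigma> j d u \<and> nonlocal_solution f a l lam u"
      have "lam \<le> a s * pi\<^sup>2 * (real k + 1)\<^sup>2" if "0 \<le> s" for s
      proof -
        have "a 0 * pi\<^sup>2 * (real k + 1)\<^sup>2 \<le> a s * pi\<^sup>2 * (real k + 1)\<^sup>2"
          using *(1) that by (intro mult_right_mono) auto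
        then show ?thesis
          using *(1) by linarith
      qed
      then show False
        using no_branch[OF *(2,3)] *(4) by blast
    qed
    show "\<forall>N\<ge>k. lam \<le> (INF s\<in>{0..}. a s * pi\<^sup>2 * (real N + 1)\<^sup>2) \<and>
        (\<forall>M<N. \<not> lam \<le> (INF s\<in>{0..}. a s * pi\<^sup>2 * (real M + 1)\<^sup>2)) \<longrightarrow>
        (\<forall>j>N. \<forall>\<sigma>\<in>{1, -1}. \<not> (\<exists>d u. is_u f a lam \<sigma> j d u \<and> nonlocal_solution f a l lam u))"
    proof (intro impI allI ballI notI)
      fix N j and \<sigma> :: real
      assume *: "lam \<le> (INF s\<in>{0..}. a s * pi\<^sup>2 * (real N + 1)\<^sup>2) \<and>
          (\<forall>M<N. \<not> lam \<le> (INF s\<in>{0..}. a s * pi\<^sup>2 * (real M + 1)\<^sup>2))" "N < j" "\<sigma> \<in> {1, -1}"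
        "\<exists>d u. is_u f a lam \<sigma> j d u \<and> nonlocal_solution f a l lam u"
      \<comment> \<open>A real infimum bounds the values from below only if the set is bounded
        below; positivity of \<open>a\<close> provides this.\<close>
      have "bdd_below ((\<lambda>s. a s * pi\<^sup>2 * (real N + 1)\<^sup>2) ` {0..})"
      proof (rule bdd_belowI2)
        show "0 \<le> a s * pi\<^sup>2 * (real N + 1)\<^sup>2" if "s \<in> {0..}" for s
          using a_pos[of s] that by (intro mult_nonneg_nonneg) auto
      qed
      then have "lam \<le> a s * pi\<^sup>2 * (real N + 1)\<^sup>2" if "0 \<le> s" for s
        using cINF_lower[of "\<lambda>s. a s * pi\<^sup>2 * (real N + 1)\<^sup>2" "{0..}" s] *(1) that by simp
      then show False
        using no_branch[OF *(2,3)] *(4) by blast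
    qed
    show "l = (\<lambda>u. H01_norm u powr r) \<and> lam \<le> a 0 * pi\<^sup>2 * (real k + 1)\<^sup>2 \<and> mono_on {0..} a \<longrightarrow>
        card {u. nonlocal_solution f a l lam u} = 2 * k + 1 \<and>
        {u. nonlocal_solution f a l lam u} =
          insert (\<lambda>x. 0) {u. \<exists>j\<in>{1..k}. \<exists>\<sigma>\<in>{1, -1}. is_u f a lam \<sigma> j (d \<sigma> j) u}"
    proof
      assume *: "l = (\<lambda>u. H01_norm u powr r) \<and> lam \<le> a 0 * pi\<^sup>2 * (real k + 1)\<^sup>2 \<and> mono_on {0..} a"
      have "l u \<le> l v"
        if "is_v f \<mu> \<sigma> j u" "is_v f \<nu> \<sigma> j v" "\<sigma> \<in> {1, -1}" "0 < \<mu>" "\<mu> \<le> \<nu>" "1 \<le> j" for \<mu> \<nu> \<sigma> j u v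
        using H01_norm_mono[OF that] * r_pos H01_norm_nonneg by (auto intro: powr_mono2)
      then show "card {u. nonlocal_solution f a l lam u} = 2 * k + 1 \<and>
        {u. nonlocal_solution f a l lam u} =
          insert (\<lambda>x. 0) {u. \<exists>j\<in>{1..k}. \<exists>\<sigma>\<in>{1, -1}. is_u f a lam \<sigma> j (d \<sigma> j) u}"
        using * d(2) by (intro nonlocal_solutions_counted lam_pos a_pos l_nonneg) blast+
    qed
    show "l = (\<lambda>u. Lq_norm q u powr r) \<and> lam \<le> a 0 * pi\<^sup>2 * (real k + 1)\<^sup>2 \<and>
        (\<forall>x. f (- x) = - f x) \<and> mono_on {0..} a \<longrightarrow>
        card {u. nonlocal_solution f a l lam u} = 2 * k + 1 \<and>
        {u. nonlocal_solution f a l lam u} =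
          insert (\<lambda>x. 0) {u. \<exists>j\<in>{1..k}. \<exists>\<sigma>\<in>{1, -1}. is_u f a lam \<sigma> j (d \<sigma> j) u}"
    proof
      assume *: "l = (\<lambda>u. Lq_norm q u powr r) \<and> lam \<le> a 0 * pi\<^sup>2 * (real k + 1)\<^sup>2 \<and>
        (\<forall>x. f (- x) = - f x) \<and> mono_on {0..} a"
      interpret odd_ci_nonlin f
        by unfold_locales (use * in blast)
      have "l u \<le> l v"
        if "is_v f \<mu> \<sigma> j u" "is_v f \<nu> \<sigma> j v" "\<sigma> \<in> {1, -1}" "0 < \<mu>" "\<mu> \<le> \<nu>" "1 \<le> j" for \<mu> \<nu> \<sigma> j u v
        using Lq_norm_mono[OF that q_ge_1] * r_pos by (auto simp: Lq_norm_def intro!: powr_mono2)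
      then show "card {u. nonlocal_solution f a l lam u} = 2 * k + 1 \<and>
        {u. nonlocal_solution f a l lam u} =
          insert (\<lambda>x. 0) {u. \<exists>j\<in>{1..k}. \<exists>\<sigma>\<in>{1, -1}. is_u f a lam \<sigma> j (d \<sigma> j) u}"
        using * d(2) by (intro nonlocal_solutions_counted lam_pos a_pos l_nonneg) blast+
    qed
  qed
qed

end
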